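(* Let $n,d\ge 2$ and let $f\in\Sigma_{n,2d}$ be non-singular. If $F\subseteq\operatorname{Gram}(f)$ is a face of corank $k$ with $1\le k\le d-1$, then \[ \dim F\le\binom{\dim\mathbb{R}[\underline{x}]_d-k+1}{2}-\dim\mathbb{R}[\underline{x}]_{2d}+k^2+\binom{k+2}{3}. \]
   Context: $\mathbb{R}[\underline{x}]=\mathbb{R}[x_1,\dots,x_n]$, and $\mathbb{R}[\underline{x}]_e$ is its space of forms of degree $e$. $\Sigma_{n,2d}\subseteq\mathbb{R}[\underline{x}]_{2d}$ is the set of all $f$ for which there exist $f_1,\dots,f_r\in\mathbb{R}[\underline{x}]_d$ with $f=\sum_{i=1}^r f_i^2$. A form $f$ is non-singular if there is no point $\xi\in\mathbb{P}^{n-1}$ (complex projective space) at which all partial derivatives of $f$ vanish (in particular $f\neq 0$). Let $N=\dim\mathbb{R}[\underline{x}]_d$ and let $X$ be the column vector of all monomials of degree $d$. The Gram spectrahedron of $f$ is $\operatorname{Gram}(f)=\{G\in\mathbb{R}^{N\times N}: G \text{ symmetric positive semidefinite},\ X^TGX=f\}$, a compact convex set. A convex subset $F$ of a convex set $C$ is a face of $C$ if $x,y\in C$ and $\frac{x+y}{2}\in F$ imply $x,y\in F$. The dimension of a convex set is the dimension of its affine hull. All relative interior points of a nonempty face $F$ of $\operatorname{Gram}(f)$ have the same image; this image, viewed as a subspace $U=\{v^TGX: v\in\mathbb{R}^N\}$ of $\mathbb{R}[\underline{x}]_d$ for $G$ a relative interior point of $F$, is the subspace associated to $F$. The face $F$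 has corank $k$ if its relative interior points are matrices of rank $N-k$, i.e. $U$ has codimension $k$ in $\mathbb{R}[\underline{x}]_d$. *)

theory Defs
  imports "HOL-Analysis.Analysis" "HOL-Analysis.Finite_Function_Topology"
begin

text \<open>
  Real polynomials in the variables \<open>x\<^sub>0, x\<^sub>1, \<dots>\<close>: finitely supported coefficient functions on
  exponent vectors.  The ring structure comes from \<^theory>\<open>HOL-Library.Poly_Mapping\<close> and the real
  vector space structure from \<^theory>\<open>HOL-Analysis.Finite_Function_Topology\<close>.
  The polynomials in \<open>n\<close> variables are those that only involve \<open>x\<^sub>0, \<dots>, x\<^sub>n\<^sub>-\<^sub>1\<close>.
\<close>

type_synonym mpoly = "(nat \<Rightarrow>\<^sub>0 nat) \<Rightarrow>\<^sub>0 real"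

definition exponents :: "nat \<Rightarrow> nat \<Rightarrow> (nat \<Rightarrow>\<^sub>0 nat) set" where
  "exponents n e = {m. Poly_Mapping.keys m \<subseteq> {..<n} \<and> (\<Sum>i<n. Poly_Mapping.lookup m i) = e}"

definition monomials :: "nat \<Rightarrow> nat \<Rightarrow> mpoly set" where
  "monomials n e = (\<lambda>m. Poly_Mapping.single m 1) ` exponents n e"

definition forms :: "nat \<Rightarrow> nat \<Rightarrow> mpoly set" where
  "forms n e = {p. Poly_Mapping.keys p \<subseteq> exponents n e}"

text \<open>\<open>sos_forms n d\<close> is the cone usually written \<open>\<Sigma>\<^bsub>n,2d\<^esub>\<close>: its elements have degree \<open>2d\<close>.\<close>

definition sos_forms :: "nat \<Rightarrow> nat \<Rightarrow> mpoly set" where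
  "sos_forms n d = {f. \<exists>gs. set gs \<subseteq> forms n d \<and> f = (\<Sum>g\<leftarrow>gs. g ^ 2)}"

definition partial_deriv :: "nat \<Rightarrow> mpoly \<Rightarrow> mpoly" where
  "partial_deriv i p = (\<Sum>m\<in>Poly_Mapping.keys p.
     Poly_Mapping.single (m - Poly_Mapping.single i 1)
       (real (Poly_Mapping.lookup m i) * Poly_Mapping.lookup p m))"

definition eval_complex :: "(nat \<Rightarrow> complex) \<Rightarrow> mpoly \<Rightarrow> complex" where
  "eval_complex \<xi> p = (\<Sum>m\<in>Poly_Mapping.keys p.
     of_real (Poly_Mapping.lookup p m) *
     (\<Prod>i\<in>Poly_Mapping.keys m. \<xi> i ^ Poly_Mapping.lookup m i))"

text \<open>
  A point of the complex projective space of dimension \<open>n - 1\<close> is given by homogeneous coordinates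
  \<open>\<xi> 0, \<dots>, \<xi> (n - 1)\<close>, not all zero; the values \<open>\<xi> i\<close> for \<open>i \<ge> n\<close> play no role.
\<close>

definition nonsingular_form :: "nat \<Rightarrow> mpoly \<Rightarrow> bool" where
  "nonsingular_form n f \<longleftrightarrow>
     \<not> (\<exists>\<xi>. (\<exists>i<n. \<xi> i \<noteq> 0) \<and> (\<forall>i<n. eval_complex \<xi> (partial_deriv i f) = 0))"

text \<open>
  The size \<open>N = dim \<real>[x]\<^sub>d\<close> of the Gram matrices is the cardinality of the index type \<open>'m\<close>; this
  is enforced by the requirement that \<open>X\<close>, indexed by \<open>'m\<close>, lists every monomial of degree \<open>d\<close>
  exactly once.
\<close>

definition monomial_vector :: "nat \<Rightarrow> nat \<Rightarrow> mpoly ^ 'm::finite \<Rightarrow> bool" where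
  "monomial_vector n d X \<longleftrightarrow> bij_betw (\<lambda>i. X $ i) UNIV (monomials n d)"

text \<open>\<open>X\<^sup>T G X\<close>\<close>

definition gram_poly :: "mpoly ^ 'm::finite \<Rightarrow> real ^ 'm ^ 'm \<Rightarrow> mpoly" where
  "gram_poly X G = (\<Sum>i\<in>UNIV. \<Sum>j\<in>UNIV. (G $ i $ j) *\<^sub>R (X $ i * X $ j))"

definition psd :: "real ^ 'm::finite ^ 'm \<Rightarrow> bool" where
  "psd G \<longleftrightarrow> transpose G = G \<and> (\<forall>v. 0 \<le> v \<bullet> (G *v v))"

definition Gram :: "mpoly ^ 'm::finite \<Rightarrow> mpoly \<Rightarrow> (real ^ 'm ^ 'm) set" where
  "Gram X f = {G. psd G \<and> gram_poly X G = f}"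

text \<open>
  Only nonempty faces have a corank. All relative interior points of a face of \<open>Gram X f\<close> have the
  same rank, which is \<open>N - k\<close>; writing this as \<open>rank G + k = N\<close> avoids truncated subtraction.
\<close>

definition has_corank :: "(real ^ 'm::finite ^ 'm) set \<Rightarrow> nat \<Rightarrow> bool" where
  "has_corank F k \<longleftrightarrow> F \<noteq> {} \<and> (\<forall>G\<in>rel_interior F. rank G + k = CARD('m))"

lemma convex_Gram:
  fixes X :: "mpoly ^ 'm::finite"
  shows "convex (Gram X f)"
proof (rule convexI)
  fix A B :: "real ^ 'm ^ 'm" and u v :: real
  assume A: "A \<in> Gram X f" and B: "B \<in> Gram X f" and u: "0 \<le> u" "0 \<le> v" "u + v = 1"
  have "transpose (u *\<^sub>R A + v *\<^sub>R B) = u *\<^sub>R transpose A + v *\<^sub>R transpose B"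
    by (simp add: transpose_def vec_eq_iff)
  moreover have "0 \<le> w \<bullet> ((u *\<^sub>R A + v *\<^sub>R B) *v w)" for w
  proof -
    have "(u *\<^sub>R A + v *\<^sub>R B) *v w = u *\<^sub>R (A *v w) + v *\<^sub>R (B *v w)"
      by (simp add: matrix_vector_mult_add_rdistrib scaleR_matrix_vector_assoc)
    then show ?thesis
      using A B u by (simp add: Gram_def psd_def inner_add_right)
  qed
  moreover have "gram_poly X (u *\<^sub>R A + v *\<^sub>R B) = u *\<^sub>R gram_poly X A + v *\<^sub>R gram_poly X B"
    by (simp add: gram_poly_def scaleR_add_left scaleR_sum_right sum.distrib)
  ultimately show "u *\<^sub>R A + v *\<^sub>R B \<in> Gram X f"
    using A B u by (simp add: Gram_def psd_def flip: scaleR_add_left)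
qed

lemma finite_exponents: "finite (exponents n e)"
proof -
  have "inj_on (\<lambda>m. restrict (Poly_Mapping.lookup m) {..<n}) (exponents n e)"
  proof (rule inj_onI)
    fix m m' assume m: "m \<in> exponents n e" "m' \<in> exponents n e"
      and eq: "restrict (Poly_Mapping.lookup m) {..<n} = restrict (Poly_Mapping.lookup m') {..<n}"
    have "Poly_Mapping.lookup m i = Poly_Mapping.lookup m' i" for i
    proof (cases "i < n")
      case True
      then show ?thesis using fun_cong[OF eq, of i] by simp
    next
      case False
      then have "i \<notin> Poly_Mapping.keys m" "i \<notin> Poly_Mapping.keys m'"
        using m by (auto simp: exponents_def)
      then show ?thesis by (simp add: in_keys_iff)
    qed
    then show "m = m'" by (simp add: poly_mapping_eqI)
  qed
  moreover have "(\<lambda>m. restrict (Poly_Mapping.lookup m) {..<n}) ` exponents n e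
      \<subseteq> ({..<n} \<rightarrow>\<^sub>E {..e})"
    by (auto simp: exponents_def intro: member_le_sum split: if_splits)
  ultimately show ?thesis
    by (metis finite_PiE finite_atMost finite_lessThan finite_subset finite_imageD)
qed

lemma lookup_scaleR_mpoly [simp]:
  "Poly_Mapping.lookup (c *\<^sub>R p) m = c * Poly_Mapping.lookup (p :: mpoly) m"
proof -
  have "finite {m. c *\<^sub>R Poly_Mapping.lookup p m \<noteq> 0}"
    by (rule finite_subset[OF _ finite_lookup[of p]]) auto
  then show ?thesis
    by (simp add: scaleR_poly_mapping_def Abs_poly_mapping_inverse)
qed

lemma dim_forms_eq_card: "dim (forms n e) = card (monomials n e)"
proof (rule dim_unique)
  show "monomials n e \<subseteq> forms n e"
    by (auto simp: monomials_def forms_def)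
  show "forms n e \<subseteq> span (monomials n e)"
  proof
    fix p assume p: "p \<in> forms n e"
    have "p = (\<Sum>m\<in>Poly_Mapping.keys p. Poly_Mapping.lookup p m *\<^sub>R Poly_Mapping.single m 1)"
      by (rule poly_mapping_eqI)
        (auto simp: lookup_sum lookup_single when_def in_keys_iff if_distrib sum.If_cases
          cong: if_cong)
    also have "\<dots> \<in> span (monomials n e)"
      using p by (intro span_sum span_scale span_base) (auto simp: monomials_def forms_def)
    finally show "p \<in> span (monomials n e)" .
  qed
  show "independent (monomials n e)"
  proof (rule independent_if_scalars_zero)
    show "finite (monomials n e)" by (simp add: monomials_def finite_exponents)
    fix c p assume s: "(\<Sum>q\<in>monomials n e. c q *\<^sub>R q) = 0" and "p \<in> monomials n e"
    then obtain m where m: "m \<in> exponents n e" "p = Poly_Mapping.single m 1"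
      by (auto simp: monomials_def)
    have inj: "inj_on (\<lambda>m. Poly_Mapping.single m (1::real)) (exponents n e)"
      by (rule inj_onI) (metis keys_single singleton_inject zero_neq_one)
    have "0 = Poly_Mapping.lookup (\<Sum>q\<in>monomials n e. c q *\<^sub>R q) m" using s by simp
    also have "\<dots> = (\<Sum>m'\<in>exponents n e. c (Poly_Mapping.single m' 1) * (1 when m' = m))"
      by (simp add: monomials_def sum.reindex[OF inj] lookup_sum lookup_single)
    also have "\<dots> = (\<Sum>m'\<in>exponents n e. if m' = m then c p else 0)"
      by (rule sum.cong) (auto simp: m when_def)
    also have "\<dots> = c p"
      using m by (simp add: finite_exponents)
    finally show "c p = 0" by simp
  qed
qed simp

lemma card_eq_dim_forms:
  fixes X :: "mpoly ^ 'm::finite"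
  assumes "monomial_vector n d X"
  shows "CARD('m) = dim (forms n d)"
  using bij_betw_same_card[OF assms[unfolded monomial_vector_def]] by (simp add: dim_forms_eq_card)

text \<open>For convex sets, \<^const>\<open>face_of\<close> agrees with the notion of face defined through midpoints.\<close>

lemma face_of_iff_midpoint:
  fixes C :: "'a::real_vector set"
  assumes C: "convex C"
  shows "F face_of C \<longleftrightarrow>
    F \<subseteq> C \<and> convex F \<and> (\<forall>x\<in>C. \<forall>y\<in>C. midpoint x y \<in> F \<longrightarrow> x \<in> F \<and> y \<in> F)"
    (is "?L \<longleftrightarrow> ?R")
proof
  assume L: ?L
  show ?R
  proof (intro conjI ballI impI)
    show "F \<subseteq> C" "convex F" using L by (auto simp: face_of_def)
    fix x y assume xy: "x \<in> C" "y \<in> C" "midpoint x y \<in> F"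
    have "x \<in> F \<and> y \<in> F"
    proof (cases "x = y")
      case True then show ?thesis using xy by simp
    next
      case False
      then have "midpoint x y \<in> open_segment x y" by simp
      then show ?thesis using L xy unfolding face_of_def by blast
    qed
    then show "x \<in> F" "y \<in> F" by auto
  qed
next
  assume R: ?R
  have key: "b \<in> F"
    if "a \<in> C" "b \<in> C" "(1 - t) *\<^sub>R a + t *\<^sub>R b \<in> F" "1 / 2 ^ Suc k \<le> t" "t \<le> 1" for a b t k
    using that
  proof (induction k arbitrary: t)
    case 0
    let ?x = "(1 - t) *\<^sub>R a + t *\<^sub>R b" and ?y = "(2 - 2 * t) *\<^sub>R a + (2 * t - 1) *\<^sub>R b"
    have "?y \<in> C" using C 0 by (intro convexD) auto
    moreover have "midpoint b ?y = ?x"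
      by (simp add: midpoint_def algebra_simps flip: scaleR_add_left)
    ultimately show ?case using R 0 by metis
  next
    case (Suc k)
    show ?case
    proof (cases "t \<le> 1 / 2")
      case True
      let ?x = "(1 - t) *\<^sub>R a + t *\<^sub>R b" and ?y = "(1 - 2 * t) *\<^sub>R a + (2 * t) *\<^sub>R b"
      have "0 < t" using Suc.prems(4) by (smt (verit) divide_pos_pos zero_less_power)
      then have "?y \<in> C" using C Suc.prems True by (intro convexD) auto
      moreover have "midpoint a ?y = ?x"
        by (simp add: midpoint_def algebra_simps flip: scaleR_add_left)
      ultimately have "?y \<in> F" using R Suc.prems by metis
      then show ?thesis
        using Suc.IH[of "2 * t"] Suc.prems True by (simp add: field_simps)
    next
      case False
      let ?x = "(1 - t) *\<^sub>R a + t *\<^sub>R b" and ?y = "(2 - 2 * t) *\<^sub>R a + (2 * t - 1) *\<^sub>R b"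
      have "?y \<in> C" using C Suc.prems False by (intro convexD) auto
      moreover have "midpoint b ?y = ?x"
        by (simp add: midpoint_def algebra_simps flip: scaleR_add_left)
      ultimately show ?thesis using R Suc.prems by metis
    qed
  qed
  have key': "b \<in> F"
    if "a \<in> C" "b \<in> C" "(1 - t) *\<^sub>R a + t *\<^sub>R b \<in> F" "0 < t" "t \<le> 1" for a b t
  proof -
    obtain k where "(1 / 2) ^ k < t"
      using real_arch_pow_inv[OF \<open>0 < t\<close>, of "1 / 2"] by auto
    moreover have "(1 / 2) ^ Suc k \<le> (1 / 2 :: real) ^ k" by simp
    ultimately show ?thesis
      using key[of a b t k] that by (simp add: power_divide)
  qed
  show ?L
    unfolding face_of_def
  proof (intro conjI ballI impI)
    show "F \<subseteq> C" "convex F" using R by auto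
    fix a b x assume ab: "a \<in> C" "b \<in> C" "x \<in> F" "x \<in> open_segment a b"
    then obtain t where t: "0 < t" "t < 1" "x = (1 - t) *\<^sub>R a + t *\<^sub>R b"
      by (auto simp: in_segment)
    show "b \<in> F" using key'[of a b t] t ab by auto
    have "x = (1 - (1 - t)) *\<^sub>R b + (1 - t) *\<^sub>R a" using t by (simp add: add.commute)
    then show "a \<in> F" using key'[of b a "1 - t"] t(1,2) ab(1-3) by auto
  qed
qed

end

theory Submission
  imports Defs "HOL-Computational_Algebra.Fundamental_Theorem_Algebra"
begin

text \<open>
  For \<open>G\<close> in the relative interior of \<open>F\<close>, the differences \<open>G' - G\<close> with \<open>G' \<in> F\<close> are symmetric,
  kill the kernel of \<open>G\<close>, and lie in the kernel of the Gram map, which sends such matrices onto the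
  span \<open>U\<^sup>2\<close> of all products of two elements of the subspace \<open>U\<close> associated to \<open>F\<close>. Hence
  \<open>dim F \<le> (N - k + 1 choose 2) - dim U\<^sup>2\<close>, and it remains to bound the codimension of \<open>U\<^sup>2\<close>. As \<open>f\<close>
  is non-singular, \<open>U\<close> has no common complex zero: such a zero would kill all partial derivatives of
  \<open>f\<close>.

  Write \<open>S\<^sub>e\<close> for the forms of degree \<open>e\<close> and induct on \<open>k\<close>. Choose \<open>e < d\<close> and \<open>g \<in> S\<^sub>d\<^sub>-\<^sub>e\<close> such that
  \<open>J = {s \<in> S\<^sub>e. g s \<in> U}\<close> has minimal codimension \<open>r\<close> with \<open>1 \<le> r \<le> e\<close>. Then \<open>U + g S\<^sub>e\<close> has codimension
  \<open>k - r\<close> and its square lies in \<open>U\<^sup>2 + g S\<^sub>d\<^sub>+\<^sub>e\<close>, while \<open>g J U \<subseteq> U\<^sup>2\<close>; so the codimension of \<open>J U\<close> in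
  \<open>S\<^sub>d\<^sub>+\<^sub>e\<close> has to be estimated. Enlarging \<open>U\<close> step by step to \<open>V = U + J S\<^sub>d\<^sub>-\<^sub>e\<close> costs at most
  \<open>(k + 1 choose 2) - (c + 1 choose 2)\<close>, where \<open>c\<close> is the codimension of \<open>V\<close>. For a generic linear
  form \<open>l\<close> one has \<open>S\<^sub>e = J + l S\<^sub>e\<^sub>-\<^sub>1\<close>, and modulo \<open>J\<^sup>2\<close> and products that are controlled by \<open>J V\<close> the
  space \<open>S\<^sub>2\<^sub>e\<close> is spanned by the products of three out of \<open>r\<close> fixed forms, rescaled by powers of \<open>l\<close>.
  This gives codimension at most \<open>r c + (r + 2 choose 3)\<close> for \<open>J V\<close>.
\<close>

section \<open>Finite-dimensional subspaces\<close>

text \<open>Since \<open>k < d\<close>, a linear \<open>g\<close> with \<open>e = d - 1\<close>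
  already gives an admissible pair, and r \<le> e keeps the flag of powers of \<open>l\<close> above
  \<open>J\<close> from having e + 1 strict steps; this is why \<open>J\<close> and the multiples of
  a generic \<open>l\<close> fill S_e. Minimality of \<open>r\<close> yields a dichotomy for linear
  \<open>s\<close>: either s S_(e-1) lies in \<open>J\<close>, or J + s S_(e-1) is all of S_e.

  The obstacle is the bound on J V. If \<open>V\<close> is not everything, a functional that kills
  it singles out a space \<open>X\<close> of linear forms of codimension at most \<open>r\<close>,
  and the dichotomy puts X S_(e-1) inside \<open>J\<close>. As there is no common zero, multiplying
  \<open>V\<close> by linear forms lowers its codimension at every step, so S_(e-1) V is everything
  and X S_(d+e-1) lies in J V. What remains is a complement of \<open>X\<close> times a complement
  of \<open>V\<close>: the term r c.

  The constants are those of the case r = k: the maximum over \<open>c\<close> of (k+1 choose 2) -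
  (c+1 choose 2) + k c is k^2, attained at c = k and c = k - 1, and (k+2 choose 3) counts the triple
  products. The case r < k does not exceed this.\<close>

definition fin_span :: "'a::real_vector set \<Rightarrow> bool" where
  "fin_span V \<longleftrightarrow> (\<exists>B. finite B \<and> V \<subseteq> span B)"

lemma fin_span_mono: "fin_span W \<Longrightarrow> V \<subseteq> W \<Longrightarrow> fin_span V"
  by (auto simp: fin_span_def)

lemma subset_span_Un: "V \<subseteq> span (V \<union> T)" "T \<subseteq> span (V \<union> T)"
  using span_superset[of "V \<union> T"] by auto

lemma fin_span_span: "fin_span V \<Longrightarrow> fin_span (span V)"
  unfolding fin_span_def by (metis span_mono span_span)

lemma fin_span_Un: "fin_span V \<Longrightarrow> fin_span W \<Longrightarrow> fin_span (V \<union> W)"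
  unfolding fin_span_def by (metis Un_upper1 Un_upper2 finite_UnI le_sup_iff order_trans span_mono)

lemma fin_span_finite: "finite Q \<Longrightarrow> fin_span Q"
  unfolding fin_span_def using span_superset by blast

lemma fin_span_euclidean: "fin_span (V :: 'a::euclidean_space set)"
  unfolding fin_span_def using finite_Basis span_Basis by blast

lemma fin_span_image:
  assumes "linear h" "fin_span V"
  shows "fin_span (h ` V)"
  using assms unfolding fin_span_def
  by (metis finite_imageI image_mono linear_span_image)

text \<open>The ambient type of polynomials is infinite-dimensional and \<open>dim\<close> is 0 on
  an infinite-dimensional space, so monotonicity needs \<open>fin_span\<close>.\<close>

lemma dim_le_dim:
  fixes V W :: "'a::real_vector set"
  assumes "fin_span W" "V \<subseteq> span W"
  shows "dim V \<le> dim W"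
proof -
  obtain B where B: "B \<subseteq> W" "independent B" "W \<subseteq> span B" "card B = dim W"
    using basis_exists by blast
  have "finite B"
    using assms(1) B independent_span_bound unfolding fin_span_def by (metis order_trans)
  moreover have "V \<subseteq> span B"
    using assms(2) B by (metis order_trans span_minimal subspace_span)
  ultimately show ?thesis using dim_le_card B by metis
qed

lemma finite_basis_exists:
  fixes W :: "'a::real_vector set"
  assumes "fin_span W"
  obtains B where "B \<subseteq> W" "independent B" "W \<subseteq> span B" "card B = dim W" "finite B"
proof -
  obtain B where B: "B \<subseteq> W" "independent B" "W \<subseteq> span B" "card B = dim W"
    using basis_exists by blast
  have "finite B"
    using assms(1) B independent_span_bound unfolding fin_span_def by (metis order_trans)
  with B that show ?thesis by blast
qed

lemma independent_card_le_dim_fin_span: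
  fixes B W :: "'a::real_vector set"
  assumes "fin_span W" "B \<subseteq> span W" "independent B"
  shows "finite B" "card B \<le> dim W"
proof -
  obtain C where C: "C \<subseteq> W" "independent C" "W \<subseteq> span C" "card C = dim W" "finite C"
    using finite_basis_exists[OF assms(1)] by blast
  have "B \<subseteq> span C" using assms(2) C by (metis order_trans span_minimal subspace_span)
  then show "finite B" "card B \<le> dim W"
    using independent_span_bound[OF C(5) assms(3)] C by auto
qed

text \<open>Codimensions enter spanning arguments through such a \<open>Q\<close>:
  \<open>card Q\<close> counts the generators that are still missing. The most frequent case is
  \<open>T = S\<close>.\<close>

lemma complement_exists:
  fixes V S T :: "'a::real_vector set"
  assumes "fin_span S" "V \<subseteq> S" "T \<subseteq> S" "S \<subseteq> span (V \<union> T)"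
  obtains Q where "finite Q" "Q \<subseteq> T" "S \<subseteq> span (V \<union> Q)" "card Q + dim V = dim S"
proof -
  have fV: "fin_span V" using assms fin_span_mono by blast
  obtain B where B: "B \<subseteq> V" "independent B" "V \<subseteq> span B" "card B = dim V" "finite B"
    using finite_basis_exists[OF fV] by blast
  obtain C where C: "B \<subseteq> C" "C \<subseteq> B \<union> T" "independent C" "B \<union> T \<subseteq> span C"
    using maximal_independent_subset_extend[OF _ B(2), of "B \<union> T"] by blast
  have CS: "C \<subseteq> S" using C B assms by blast
  have SC: "S \<subseteq> span C"
  proof -
    have "V \<union> T \<subseteq> span C" using B C
      by (metis Un_subset_iff order_trans span_minimal subspace_span)
    then show ?thesis using assms(4) by (metis order_trans span_minimal subspace_span)
  qed
  have fC: "finite C" using independent_card_le_dim_fin_span[OF assms(1) _ C(3)] CS span_superset by blast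
  have "card C = dim S" using basis_card_eq_dim[OF CS SC C(3)] .
  moreover have "card (C - B) + card B = card C"
    using C fC B by (metis card_Diff_subset card_mono le_add_diff_inverse2)
  moreover have "S \<subseteq> span (V \<union> (C - B))"
    using SC B(1) span_mono[of C "V \<union> (C - B)"] by blast
  moreover have "C - B \<subseteq> T" using C by blast
  ultimately show ?thesis using that[of "C - B"] fC B by auto
qed

lemma dim_le_add_card:
  fixes V S :: "'a::real_vector set"
  assumes "fin_span V" "S \<subseteq> span (V \<union> Q)" "finite Q"
  shows "dim S \<le> dim V + card Q"
proof -
  obtain B where B: "B \<subseteq> V" "independent B" "V \<subseteq> span B" "card B = dim V" "finite B"
    using finite_basis_exists[OF assms(1)] by blast
  have "V \<union> Q \<subseteq> span (B \<union> Q)"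
    using B by (metis Un_subset_iff Un_upper1 order_trans span_mono span_superset)
  then have "S \<subseteq> span (B \<union> Q)" using assms(2) by (metis order_trans span_minimal subspace_span)
  then have "dim S \<le> card (B \<union> Q)" using dim_le_card B assms by blast
  also have "\<dots> \<le> card B + card Q" by (rule card_Un_le)
  finally show ?thesis using B by simp
qed

lemma subspace_eq_of_dim_le:
  fixes V S :: "'a::real_vector set"
  assumes "subspace V" "V \<subseteq> S" "fin_span S" "dim S \<le> dim V"
  shows "V = S"
proof -
  obtain Q where Q: "finite Q" "S \<subseteq> span (V \<union> Q)" "card Q + dim V = dim S"
    using complement_exists[OF assms(3,2) order_refl subset_span_Un(2)] by metis
  then have "Q = {}" using assms by (metis add_le_same_cancel2 card_0_eq le_zero_eq)
  then have "S \<subseteq> span V" using Q by simp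
  moreover have "span V = V" using assms(1) by (simp add: span_eq_iff)
  ultimately show ?thesis using assms(2) by blast
qed

lemma mem_span_UnD:
  assumes "x \<in> span (V \<union> Q)" "subspace V"
  obtains v w where "v \<in> V" "w \<in> span Q" "x = v + w"
proof -
  obtain v w where "v \<in> span V" "w \<in> span Q" "x = v + w"
    using assms(1) unfolding span_Un by auto
  moreover have "span V = V" using assms(2) by (simp add: span_eq_iff)
  ultimately show ?thesis using that by metis
qed

lemma mem_span_UnI: "v \<in> V \<Longrightarrow> w \<in> span Q \<Longrightarrow> v + w \<in> span (V \<union> Q)"
  using subset_span_Un(1)[of V Q] span_mono[of Q "V \<union> Q"] by (intro span_add) auto

lemma subspace_preimage:
  assumes "linear h" "subspace S" "subspace V"
  shows "subspace {s \<in> S. h s \<in> V}"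
  using assms by (auto simp: subspace_def linear_add linear_scale linear_0)

text \<open>Rank-nullity for the map from \<open>S\<close> to the quotient by \<open>V\<close>
  induced by \<open>h\<close>; sums of dimensions take the place of quotient spaces.\<close>

lemma dim_preimage:
  fixes h :: "'a::real_vector \<Rightarrow> 'b::real_vector"
  assumes h: "linear h" and S: "subspace S" "fin_span S" and V: "subspace V" "fin_span V"
  shows "dim {s \<in> S. h s \<in> V} + dim (span (V \<union> h ` S)) = dim S + dim V"
proof -
  let ?J = "{s \<in> S. h s \<in> V}" and ?W = "span (V \<union> h ` S)"
  have J: "subspace ?J" using h S V by (intro subspace_preimage)
  have fW: "fin_span ?W" by (intro fin_span_span fin_span_Un V fin_span_image[OF h S(2)])
  have hW: "V \<subseteq> ?W" "h ` S \<subseteq> ?W" by (rule subset_span_Un)+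
  obtain Q where Q: "finite Q" "Q \<subseteq> h ` S" "?W \<subseteq> span (V \<union> Q)" "card Q + dim V = dim ?W"
    using complement_exists[OF fW hW order_refl] by metis
  \<comment> \<open>Lifts the complement of \<open>V\<close> back to \<open>S\<close>; together with
    \<open>?J\<close> it spans \<open>S\<close>, and injectivity keeps the cardinality.\<close>
  obtain P where P: "P \<subseteq> S" "inj_on h P" "h ` P = Q"
    using iffD1[OF subset_image_inj Q(2)] by auto
  have fP: "finite P" using finite_imageD[OF _ P(2)] P(3) Q(1) by simp
  have cP: "card P = card Q" using card_image[OF P(2)] P(3) by simp
  have "s \<in> span (?J \<union> P)" if s: "s \<in> S" for s
  proof -
    have "h s \<in> span (V \<union> Q)" using s hW(2) Q(3) by blast
    then obtain v w where vw: "v \<in> V" "w \<in> span Q" "h s = v + w" using mem_span_UnD V(1) by blast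
    then obtain p where p: "p \<in> span P" "w = h p"
      using P(3) linear_span_image[OF h, of P] by auto
    have "p \<in> S" using p(1) span_minimal[OF P(1) S(1)] by blast
    moreover have "h (s - p) = v" using vw p h by (simp add: linear_diff)
    ultimately have "s - p \<in> ?J" using s vw S by (simp add: subspace_diff)
    from mem_span_UnI[OF this p(1)] show ?thesis by simp
  qed
  then have "S \<subseteq> span (?J \<union> P)" by (rule subsetI)
  then have 1: "dim S \<le> dim ?J + card P"
    by (intro dim_le_add_card fP fin_span_mono[OF S(2)]) auto
  have "?J \<subseteq> S" by blast
  then obtain R where R: "finite R" "R \<subseteq> S" "S \<subseteq> span (?J \<union> R)" "card R + dim ?J = dim S"
    by (rule complement_exists[OF S(2) _ order_refl subset_span_Un(2)])
  have "h s \<in> span (V \<union> h ` R)" if s: "s \<in> S" for s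
  proof -
    obtain j r where jr: "j \<in> ?J" "r \<in> span R" "s = j + r"
      using mem_span_UnD[OF subsetD[OF R(3) s] J] by blast
    then have "h s = h j + h r" "h j \<in> V" "h r \<in> span (h ` R)"
      using h linear_span_image[OF h, of R] by (auto simp: linear_add)
    then show ?thesis using mem_span_UnI by metis
  qed
  then have "V \<union> h ` S \<subseteq> span (V \<union> h ` R)" using subset_span_Un(1)[of V "h ` R"] by blast
  then have "?W \<subseteq> span (V \<union> h ` R)" by (intro span_minimal) auto
  then have "dim ?W \<le> dim V + card (h ` R)" using R(1) by (intro dim_le_add_card V) auto
  also have "\<dots> \<le> dim V + card R" using R(1) by (simp add: card_image_le)
  finally show ?thesis using 1 R Q cP by linarith
qed

section \<open>Products of spaces of forms\<close>

abbreviation lookup where "lookup \<equiv> Poly_Mapping.lookup"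
abbreviation keys where "keys \<equiv> Poly_Mapping.keys"
abbreviation single where "single \<equiv> Poly_Mapping.single"

lemma scaleR_mpoly_conv_mult: "c *\<^sub>R (p::mpoly) = single 0 c * p"
proof (rule poly_mapping_eqI)
  fix m
  have "lookup (c *\<^sub>R p) m = lookup (Poly_Mapping.map (times c) p) m"
    by (simp add: Poly_Mapping.map.rep_eq when_def)
  then show "lookup (c *\<^sub>R p) m = lookup (single 0 c * p) m"
    by (simp add: mult_map_scale_conv_mult)
qed

lemma mpoly_scaleR_mult_left [simp]: "(c *\<^sub>R (p::mpoly)) * q = c *\<^sub>R (p * q)"
  by (simp add: scaleR_mpoly_conv_mult mult.assoc)

lemma mpoly_scaleR_mult_right [simp]: "(p::mpoly) * (c *\<^sub>R q) = c *\<^sub>R (p * q)"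
  by (simp add: scaleR_mpoly_conv_mult ac_simps)

lemma linear_mult_mpoly: "linear (\<lambda>p::mpoly. g * p)"
  by (rule linearI) (auto simp: distrib_left)

lemma subspace_forms [simp]: "subspace (forms n e)"
  by (auto simp: subspace_def forms_def in_keys_iff subset_iff lookup_add) (metis add.right_neutral)

lemma forms_iff: "p \<in> forms n e \<longleftrightarrow> (\<forall>m. lookup p m \<noteq> 0 \<longrightarrow> m \<in> exponents n e)"
  by (auto simp: forms_def in_keys_iff subset_iff)

lemma single_in_forms [simp]: "m \<in> exponents n e \<Longrightarrow> single m c \<in> forms n e"
  by (auto simp: forms_def)

lemma forms_subset_span: "forms n e \<subseteq> span (monomials n e)"
proof
  fix p assume p: "p \<in> forms n e"
  have "p = (\<Sum>m\<in>keys p. lookup p m *\<^sub>R single m 1)"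
    by (rule poly_mapping_eqI)
      (auto simp: lookup_sum lookup_single when_def in_keys_iff if_distrib sum.If_cases cong: if_cong)
  also have "\<dots> \<in> span (monomials n e)"
    using p by (intro span_sum span_scale span_base) (auto simp: monomials_def forms_def)
  finally show "p \<in> span (monomials n e)" .
qed

lemma span_monomials: "span (monomials n e) = forms n e"
proof
  have "monomials n e \<subseteq> forms n e" by (auto simp: monomials_def)
  then show "span (monomials n e) \<subseteq> forms n e" by (rule span_minimal) simp
qed (rule forms_subset_span)

lemma fin_span_forms [simp]: "fin_span (forms n e)"
  unfolding fin_span_def using forms_subset_span finite_exponents
  by (metis finite_imageI monomials_def)

lemma exponents_add:
  assumes "m \<in> exponents n a" "m' \<in> exponents n b"
  shows "m + m' \<in> exponents n (a + b)"
proof -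
  have "keys (m + m') \<subseteq> keys m \<union> keys m'" by (rule keys_add)
  then show ?thesis using assms by (auto simp: exponents_def lookup_add sum.distrib)
qed

lemma forms_mult:
  assumes "p \<in> forms n a" "q \<in> forms n b"
  shows "p * q \<in> forms n (a + b)"
proof -
  have "keys (p * q) \<subseteq> {x + y |x y. x \<in> keys p \<and> y \<in> keys q}" by (rule keys_mult)
  then show ?thesis using assms exponents_add unfolding forms_def by blast
qed

lemma one_in_forms [simp]: "1 \<in> forms n 0"
  by (auto simp: forms_def exponents_def)

lemma forms_power: "p \<in> forms n a \<Longrightarrow> p ^ i \<in> forms n (i * a)"
  by (induction i) (auto intro: forms_mult)

lemma forms_power1: "p \<in> forms n 1 \<Longrightarrow> p ^ i \<in> forms n i"
  using forms_power[of p n 1 i] by simp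

lemma forms_0_eq: "p \<in> forms n 0 \<Longrightarrow> p = lookup p 0 *\<^sub>R 1"
proof (rule poly_mapping_eqI)
  fix m assume p: "p \<in> forms n 0"
  have "m = 0" if "m \<in> exponents n 0"
    using that by (intro poly_mapping_eqI) (auto simp: exponents_def in_keys_iff subset_iff)
  then show "lookup p m = lookup (lookup p 0 *\<^sub>R 1) m"
    using p by (auto simp: forms_iff lookup_one when_def)
qed

lemma single_mult_single1: "single (m + m') (1::real) = single m 1 * single m' 1"
  by (simp add: mult_single)

definition var :: "nat \<Rightarrow> mpoly" where "var i = single (single i 1) 1"

lemma exponent_single [simp]: "i < n \<Longrightarrow> single i 1 \<in> exponents n 1"
  by (auto simp: exponents_def lookup_single when_def)

lemma var_in_forms [simp]: "i < n \<Longrightarrow> var i \<in> forms n 1"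
  unfolding var_def by (rule single_in_forms) (rule exponent_single)

lemma exponents_Suc_split:
  assumes "m \<in> exponents n (Suc e)"
  obtains i m' where "i < n" "m' \<in> exponents n e" "m = single i 1 + m'"
proof -
  have "\<exists>i<n. lookup m i \<noteq> 0"
    using assms by (rule contrapos_pp) (auto simp: exponents_def)
  then obtain i where i: "i < n" "lookup m i \<noteq> 0" by blast
  have eq: "m = single i 1 + (m - single i 1)"
    using i by (intro poly_mapping_eqI) (auto simp: lookup_add lookup_minus lookup_single when_def)
  have "keys (m - single i 1) \<subseteq> keys m"
    by (auto simp: in_keys_iff lookup_minus)
  moreover have "(\<Sum>j<n. lookup m j) = (\<Sum>j<n. lookup (single i 1) j) + (\<Sum>j<n. lookup (m - single i 1) j)"
    by (subst eq) (simp add: lookup_add sum.distrib)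
  moreover have "(\<Sum>j<n. lookup (single i (1::nat)) j) = 1"
    using i by (simp add: lookup_single when_def)
  ultimately have "m - single i 1 \<in> exponents n e"
    using assms by (auto simp: exponents_def)
  with i eq that show ?thesis by blast
qed

definition pmul :: "mpoly set \<Rightarrow> mpoly set \<Rightarrow> mpoly set" (infixl \<open>\<odot>\<close> 70) where
  "A \<odot> B = span {a * b |a b. a \<in> A \<and> b \<in> B}"

lemma subspace_pmul [simp]: "subspace (A \<odot> B)"
  by (simp add: pmul_def)

lemma pmulI: "a \<in> A \<Longrightarrow> b \<in> B \<Longrightarrow> a * b \<in> A \<odot> B"
  unfolding pmul_def by (rule span_base) blast

lemma pmul_subsetI:
  assumes "subspace V" "\<And>a b. a \<in> A \<Longrightarrow> b \<in> B \<Longrightarrow> a * b \<in> V"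
  shows "A \<odot> B \<subseteq> V"
  unfolding pmul_def using assms by (intro span_minimal) auto

lemma pmul_mono: "A \<subseteq> A' \<Longrightarrow> B \<subseteq> B' \<Longrightarrow> A \<odot> B \<subseteq> A' \<odot> B'"
  by (rule pmul_subsetI) (auto intro: pmulI)

lemma pmul_commute: "A \<odot> B = B \<odot> A"
proof -
  have "A \<odot> B \<subseteq> B \<odot> A" for A B
    by (rule pmul_subsetI) (simp, metis mult.commute pmulI)
  then show ?thesis by blast
qed

text \<open>Lets inclusions between products be checked on generators of one factor while the other
  factor \<open>g\<close> stays fixed.\<close>

lemma subspace_mult_preimage: "subspace V \<Longrightarrow> subspace {p::mpoly. g * p \<in> V}"
  using subspace_preimage[OF linear_mult_mpoly subspace_UNIV, of V g] by simp

lemma span_mult_subset: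
  assumes "subspace V" "\<And>a. a \<in> A \<Longrightarrow> (g::mpoly) * a \<in> V" "x \<in> span A"
  shows "g * x \<in> V"
proof -
  have "span A \<subseteq> {p. g * p \<in> V}"
    using assms by (intro span_minimal subspace_mult_preimage) auto
  with assms(3) show ?thesis by blast
qed

lemma pmul_span_right [simp]: "A \<odot> span B = A \<odot> B"
proof
  show "A \<odot> span B \<subseteq> A \<odot> B"
    by (intro pmul_subsetI) (auto intro: span_mult_subset[of "A \<odot> B" B] pmulI)
qed (intro pmul_mono order_refl span_superset)

lemma pmul_span_left [simp]: "span A \<odot> B = A \<odot> B"
  by (metis pmul_commute pmul_span_right)

lemma pmul_assoc: "A \<odot> B \<odot> C = A \<odot> (B \<odot> C)"
proof
  have "(x * c) \<in> A \<odot> (B \<odot> C)" if x: "x \<in> A \<odot> B" and c: "c \<in> C" for x c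
  proof -
    have "c * x \<in> A \<odot> (B \<odot> C)"
      using x unfolding pmul_def[of A B]
    proof (rule span_mult_subset[rotated 2])
      fix y assume "y \<in> {a * b |a b. a \<in> A \<and> b \<in> B}"
      then obtain a b where "y = a * b" "a \<in> A" "b \<in> B" by blast
      then have "a * (b * c) \<in> A \<odot> (B \<odot> C)" using c by (intro pmulI)
      then show "c * y \<in> A \<odot> (B \<odot> C)" using \<open>y = a * b\<close> by (simp add: ac_simps)
    qed simp
    then show ?thesis by (simp add: mult.commute)
  qed
  then show "A \<odot> B \<odot> C \<subseteq> A \<odot> (B \<odot> C)" by (intro pmul_subsetI) auto
next
  have "(a * x) \<in> A \<odot> B \<odot> C" if x: "x \<in> B \<odot> C" and a: "a \<in> A" for x a
    using x unfolding pmul_def[of B C]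
  proof (rule span_mult_subset[rotated 2])
    fix y assume "y \<in> {b * c |b c. b \<in> B \<and> c \<in> C}"
    then obtain b c where "y = b * c" "b \<in> B" "c \<in> C" by blast
    then have "(a * b) * c \<in> A \<odot> B \<odot> C" using a by (intro pmulI)
    then show "a * y \<in> A \<odot> B \<odot> C" using \<open>y = b * c\<close> by (simp add: ac_simps)
  qed simp
  then show "A \<odot> (B \<odot> C) \<subseteq> A \<odot> B \<odot> C" by (intro pmul_subsetI) auto
qed

lemma forms_Suc: "forms n (Suc e) = forms n 1 \<odot> forms n e"
proof
  have "single m 1 \<in> forms n 1 \<odot> forms n e" if "m \<in> exponents n (Suc e)" for m
    using that by (rule exponents_Suc_split)
      (auto simp del: One_nat_def simp: single_mult_single1 intro!: pmulI)
  then have "monomials n (Suc e) \<subseteq> forms n 1 \<odot> forms n e" by (auto simp: monomials_def)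
  then have "span (monomials n (Suc e)) \<subseteq> forms n 1 \<odot> forms n e" by (rule span_minimal) simp
  then show "forms n (Suc e) \<subseteq> forms n 1 \<odot> forms n e" by (simp add: span_monomials)
  show "forms n 1 \<odot> forms n e \<subseteq> forms n (Suc e)"
    using forms_mult[of _ n 1 _ e] by (intro pmul_subsetI) auto
qed

lemma pmul_forms_0: "subspace V \<Longrightarrow> forms n 0 \<odot> V = V"
proof
  assume V: "subspace V"
  show "forms n 0 \<odot> V \<subseteq> V"
  proof (rule pmul_subsetI[OF V])
    fix a b assume "a \<in> forms n 0" "b \<in> V"
    then show "a * b \<in> V" using forms_0_eq[of a n] V
      by (metis mpoly_scaleR_mult_left mult_1 subspace_scale)
  qed
  show "V \<subseteq> forms n 0 \<odot> V" using pmulI[of 1 "forms n 0" _ V] by auto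
qed

lemma forms_add: "forms n (a + b) = forms n a \<odot> forms n b"
proof (induction a)
  case 0 then show ?case by (simp add: pmul_forms_0)
next
  case (Suc a)
  have "forms n (Suc (a + b)) = forms n 1 \<odot> (forms n a \<odot> forms n b)"
    unfolding forms_Suc[of n "a + b"] Suc.IH ..
  also have "\<dots> = forms n (Suc a) \<odot> forms n b"
    unfolding forms_Suc[of n a] pmul_assoc ..
  finally show ?case unfolding add_Suc .
qed

section \<open>Generic linear forms\<close>

text \<open>Independence is an open condition, as some minor does not vanish at the limit. Instead
  of determinants, each induction step eliminates one pivot.\<close>

lemma eventually_independent_family:
  fixes v :: "'i \<Rightarrow> real \<Rightarrow> mpoly"
  assumes "finite I"
    and "\<And>i m. i \<in> I \<Longrightarrow> ((\<lambda>t. lookup (v i t) m) \<longlongrightarrow> lookup (w i) m) (at 0)"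
    and "\<And>c. (\<Sum>i\<in>I. c i *\<^sub>R w i) = 0 \<Longrightarrow> \<forall>i\<in>I. c i = 0"
  shows "\<forall>\<^sub>F t in at 0. \<forall>c. (\<Sum>i\<in>I. c i *\<^sub>R v i t) = 0 \<longrightarrow> (\<forall>i\<in>I. c i = 0)"
  using assms
proof (induction I arbitrary: v w rule: finite_induct)
  case empty then show ?case by simp
next
  case (insert k I)
  have "w k \<noteq> 0"
  proof
    assume "w k = 0"
    then have "(\<Sum>i\<in>insert k I. (if i = k then 1 else 0) *\<^sub>R w i) = 0"
      by (intro sum.neutral) auto
    from insert.prems(2)[OF this] show False by simp
  qed
  then obtain m where m: "lookup (w k) m \<noteq> 0" by (metis lookup_zero poly_mapping_eqI)
  define a where "a = (\<lambda>t. lookup (v k t) m)"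
  define b where "b = (\<lambda>i t. lookup (v i t) m)"
  \<comment> \<open>Elimination of the coefficient at the pivot \<open>m\<close>, cross-multiplied
    so that nothing is divided by \<open>a t\<close>, which may vanish for some
    \<open>t\<close>.\<close>
  define v' where "v' = (\<lambda>i t. a t *\<^sub>R v i t - b i t *\<^sub>R v k t)"
  define w' where "w' = (\<lambda>i. lookup (w k) m *\<^sub>R w i - lookup (w i) m *\<^sub>R w k)"
  have tend: "((\<lambda>t. lookup (v i t) m') \<longlongrightarrow> lookup (w i) m') (at 0)" if "i \<in> insert k I" for i m'
    using insert.prems(1) that by blast
  have ev: "\<forall>\<^sub>F t in at 0. \<forall>c. (\<Sum>i\<in>I. c i *\<^sub>R v' i t) = 0 \<longrightarrow> (\<forall>i\<in>I. c i = 0)"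
  proof (rule insert.IH[where w = w'])
    fix i m' assume i: "i \<in> I"
    show "((\<lambda>t. lookup (v' i t) m') \<longlongrightarrow> lookup (w' i) m') (at 0)"
      unfolding v'_def w'_def a_def b_def lookup_minus lookup_scaleR_mpoly
      using i by (intro tendsto_intros tend) auto
  next
    fix c assume c: "(\<Sum>i\<in>I. c i *\<^sub>R w' i) = 0"
    \<comment> \<open>The combination of the \<open>w i\<close> that equals the given combination of
      the \<open>w' i\<close>.\<close>
    define c' where "c' = (\<lambda>i. if i = k then - (\<Sum>i\<in>I. c i * lookup (w i) m) else c i * lookup (w k) m)"
    have "(\<Sum>i\<in>I. c' i *\<^sub>R w i) = (\<Sum>i\<in>I. (c i * lookup (w k) m) *\<^sub>R w i)"
      using insert.hyps by (intro sum.cong) (auto simp: c'_def)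
    then have "(\<Sum>i\<in>insert k I. c' i *\<^sub>R w i) = (\<Sum>i\<in>I. c i *\<^sub>R w' i)"
      using insert.hyps
      by (simp add: c'_def w'_def scaleR_diff_right sum_subtractf scaleR_sum_left[symmetric])
    then have "\<forall>i\<in>insert k I. c' i = 0" using insert.prems(2)[of c'] c by simp
    then show "\<forall>i\<in>I. c i = 0" using m insert.hyps(2) unfolding c'_def by (metis insertCI mult_eq_0_iff)
  qed
  have "\<forall>\<^sub>F t in at 0. a t \<noteq> 0"
    unfolding a_def using tend[of k m] m by (intro tendsto_imp_eventually_ne) auto
  with ev show ?case
  proof eventually_elim
    case (elim t)
    show ?case
    proof (intro allI impI)
      fix c assume c: "(\<Sum>i\<in>insert k I. c i *\<^sub>R v i t) = 0"
      let ?s = "\<Sum>i\<in>I. c i *\<^sub>R v i t"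
      have s: "?s = - (c k *\<^sub>R v k t)" using c insert.hyps by (simp add: eq_neg_iff_add_eq_0 add.commute)
      have "(\<Sum>i\<in>I. c i * b i t) = lookup ?s m" by (simp add: lookup_sum b_def)
      also have "\<dots> = - (c k * a t)" unfolding s by (simp add: a_def)
      finally have bs: "(\<Sum>i\<in>I. c i * b i t) = - (c k * a t)" .
      have "(\<Sum>i\<in>I. c i *\<^sub>R v' i t) = a t *\<^sub>R ?s - (\<Sum>i\<in>I. c i * b i t) *\<^sub>R v k t"
        by (simp add: v'_def scaleR_diff_right sum_subtractf scaleR_sum_right scaleR_sum_left mult.commute)
      also have "\<dots> = 0" unfolding s bs by simp
      finally have cI: "\<forall>i\<in>I. c i = 0" using elim by blast
      then have "c k *\<^sub>R v k t = 0" using s by simp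
      moreover have "v k t \<noteq> 0" using elim by (auto simp: a_def)
      ultimately show "\<forall>i\<in>insert k I. c i = 0" using cI by simp
    qed
  qed
qed

text \<open>Indexed families are needed because the deformed vectors \<open>v i t\<close> are not
  known in advance to be distinct.\<close>

lemma card_le_dim_family:
  fixes v :: "'i \<Rightarrow> 'a::real_vector"
  assumes "finite I" "fin_span W" "\<And>i. i \<in> I \<Longrightarrow> v i \<in> W"
    and ind: "\<And>c. (\<Sum>i\<in>I. c i *\<^sub>R v i) = 0 \<Longrightarrow> \<forall>i\<in>I. c i = 0"
  shows "card I \<le> dim W"
proof -
  have inj: "inj_on v I"
  proof (rule inj_onI, rule ccontr)
    fix i k assume ik: "i \<in> I" "k \<in> I" "v i = v k" "i \<noteq> k"
    let ?c = "\<lambda>j. (if j = i then 1 else 0) - (if j = k then 1 else 0 :: real)"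
    have "(\<Sum>j\<in>I. ?c j *\<^sub>R v j) = (\<Sum>j\<in>I. (if j = i then v j else 0)) - (\<Sum>j\<in>I. (if j = k then v j else 0))"
      unfolding sum_subtractf[symmetric] by (intro sum.cong) auto
    also have "\<dots> = 0" using ik assms(1) by simp
    finally have "\<forall>j\<in>I. ?c j = 0" by (rule ind)
    then show False using ik by auto
  qed
  have "independent (v ` I)"
  proof (rule independent_if_scalars_zero)
    fix g x assume g: "(\<Sum>x\<in>v ` I. g x *\<^sub>R x) = 0" and x: "x \<in> v ` I"
    then have "(\<Sum>i\<in>I. g (v i) *\<^sub>R v i) = 0" by (simp add: sum.reindex[OF inj])
    from ind[OF this] x show "g x = 0" by blast
  qed (use assms in simp)
  moreover have "v ` I \<subseteq> span W" using assms(3) span_superset by blast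
  ultimately have "card (v ` I) \<le> dim W"
    using independent_card_le_dim_fin_span(2)[OF assms(2)] by blast
  then show ?thesis by (simp add: card_image inj)
qed

lemma scaleR_power_mpoly: "(t *\<^sub>R (x::mpoly)) ^ k = t ^ k *\<^sub>R x ^ k"
  by (induction k) (auto simp: mult.commute)

lemma power_add_scaleR_mpoly:
  "((l::mpoly) + t *\<^sub>R x) ^ m = (\<Sum>k\<le>m. t ^ k *\<^sub>R (of_nat (m choose k) * x ^ k * l ^ (m - k)))"
  unfolding add.commute[of l] binomial_ring scaleR_power_mpoly
  by (intro sum.cong) auto

lemma tendsto_lookup_power:
  "((\<lambda>t. lookup (((l::mpoly) + t *\<^sub>R x) ^ m * s) q) \<longlongrightarrow> lookup (l ^ m * s) q) (at 0)"
proof -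
  define c where "c = (\<lambda>k. of_nat (m choose k) * x ^ k * l ^ (m - k) * s)"
  have eq: "lookup ((l + t *\<^sub>R x) ^ m * s) q = (\<Sum>k\<le>m. t ^ k * lookup (c k) q)" for t
    by (simp add: power_add_scaleR_mpoly sum_distrib_right lookup_sum c_def)
  have "((\<lambda>t. \<Sum>k\<le>m. t ^ k * lookup (c k) q) \<longlongrightarrow> (\<Sum>k\<le>m. 0 ^ k * lookup (c k) q)) (at 0)"
    by (intro tendsto_intros)
  then show ?thesis using eq[of 0] by (simp add: eq)
qed

text \<open>Only the summand linear in \<open>t\<close> of the binomial expansion survives in the
  difference quotient.\<close>

lemma tendsto_lookup_power_deriv:
  "((\<lambda>t. lookup ((1 / t) *\<^sub>R (((l::mpoly) + t *\<^sub>R x) ^ Suc m * s - l ^ Suc m * s)) q)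
    \<longlongrightarrow> lookup (of_nat (Suc m) * (l ^ m * (x * s))) q) (at 0)"
proof -
  define c where "c = (\<lambda>k. of_nat (Suc m choose k) * x ^ k * l ^ (Suc m - k) * s)"
  have c: "c 0 = l ^ Suc m * s" "c (Suc 0) = of_nat (Suc m) * (l ^ m * (x * s))"
    by (simp_all add: c_def ac_simps)
  have eq: "lookup ((1 / t) *\<^sub>R ((l + t *\<^sub>R x) ^ Suc m * s - l ^ Suc m * s)) q
      = (\<Sum>k\<le>m. t ^ k * lookup (c (Suc k)) q)" if "t \<noteq> 0" for t
  proof -
    have "(l + t *\<^sub>R x) ^ Suc m * s = (\<Sum>k\<le>Suc m. t ^ k *\<^sub>R c k)"
      unfolding power_add_scaleR_mpoly sum_distrib_right c_def by (intro sum.cong) (auto simp: ac_simps)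
    also have "\<dots> = l ^ Suc m * s + (\<Sum>k\<le>m. t ^ Suc k *\<^sub>R c (Suc k))"
      unfolding sum.atMost_Suc_shift using c by simp
    finally have "(l + t *\<^sub>R x) ^ Suc m * s - l ^ Suc m * s = (\<Sum>k\<le>m. t ^ Suc k *\<^sub>R c (Suc k))" by simp
    then have "lookup ((1 / t) *\<^sub>R ((l + t *\<^sub>R x) ^ Suc m * s - l ^ Suc m * s)) q
      = (\<Sum>k\<le>m. (1 / t) * (t ^ Suc k * lookup (c (Suc k)) q))"
      by (simp only: lookup_scaleR_mpoly lookup_sum sum_distrib_left)
    then show ?thesis using that by simp
  qed
  have "((\<lambda>t. \<Sum>k\<le>m. t ^ k * lookup (c (Suc k)) q) \<longlongrightarrow> (\<Sum>k\<le>m. 0 ^ k * lookup (c (Suc k)) q)) (at 0)"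
    by (intro tendsto_intros)
  also have "(\<Sum>k\<le>m. 0 ^ k * lookup (c (Suc k)) q) = lookup (c (Suc 0)) q"
    by (simp add: power_0_left if_distrib[of "\<lambda>x. x * _"] cong: if_cong)
  finally show ?thesis unfolding c
  proof (rule Lim_transform_eventually)
    show "\<forall>\<^sub>F t in at 0. (\<Sum>k\<le>m. t ^ k * lookup (c (Suc k)) q)
        = lookup ((1 / t) *\<^sub>R ((l + t *\<^sub>R x) ^ Suc m * s - l ^ Suc m * s)) q"
      unfolding eventually_at_filter by (intro always_eventually allI impI) (rule eq[symmetric])
  qed
qed

lemma independent_sum_zeroD:
  assumes "finite C" "independent C" "(\<Sum>x\<in>C. c x *\<^sub>R x) = 0"
  shows "\<forall>x\<in>C. c x = 0"
  using assms independentD by blast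

text \<open>For j \<le> f these spaces climb from \<open>J\<close> plus the line through
  \<open>l ^ f\<close> to all of \<open>forms n f\<close>; their dimensions record the colon spaces
  of \<open>J\<close> by powers of \<open>l\<close>.\<close>

definition flag :: "nat \<Rightarrow> nat \<Rightarrow> mpoly set \<Rightarrow> mpoly \<Rightarrow> nat \<Rightarrow> mpoly set" where
  "flag n f J l j = span (J \<union> (\<lambda>s. l ^ (f - j) * s) ` forms n j)"

lemma flag_subset:
  assumes "J \<subseteq> forms n f" "l \<in> forms n 1" "j \<le> f"
  shows "flag n f J l j \<subseteq> forms n f"
  unfolding flag_def using assms forms_mult[OF forms_power1[OF assms(2), of "f - j"], of _ j]
  by (intro span_minimal) auto

text \<open>A basis of the flag of \<open>l\<close> deforms into the flag of \<open>l + t x\<close>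
  and stays independent for small \<open>t\<close>. In the second part the difference quotient of
  \<open>(l + t x) ^ (f - j) * s\<close> lies in the deformed flag too, because
  \<open>l ^ (f - j) * s\<close> is in \<open>J\<close>, which does not move. Its limit is a nonzero
  multiple of the excluded form, so one more independent vector appears.\<close>

lemma dim_flag_le_eventually:
  assumes J: "J \<subseteq> forms n f" and l: "l \<in> forms n 1" and x: "x \<in> forms n 1" and j: "j \<le> f"
  shows "\<forall>\<^sub>F t in at 0. dim (flag n f J l j) \<le> dim (flag n f J (l + t *\<^sub>R x) j)"
    and "\<lbrakk>s \<in> forms n j; l ^ (f - j) * s \<in> J; Suc j \<le> f; l ^ (f - Suc j) * (x * s) \<notin> flag n f J l j\<rbrakk>
      \<Longrightarrow> \<forall>\<^sub>F t in at 0. dim (flag n f J l j) < dim (flag n f J (l + t *\<^sub>R x) j)"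
proof -
  let ?T = "J \<union> (\<lambda>s. l ^ (f - j) * s) ` forms n j"
  let ?F = "flag n f J l j"
  have lt: "l + t *\<^sub>R x \<in> forms n 1" for t
    using l x by (intro subspace_add subspace_scale) auto
  have fF: "fin_span (flag n f J (l + t *\<^sub>R x) j)" for t
    using fin_span_mono[OF fin_span_forms flag_subset[OF J lt j]] .
  \<comment> \<open>The basis is taken from the generators, so that each element is either fixed in
    \<open>J\<close> or an explicit multiple of a power of \<open>l\<close>, which can be
    deformed.\<close>
  obtain C where C: "C \<subseteq> ?T" "independent C" "?T \<subseteq> span C" "card C = dim ?T"
    using basis_exists by blast
  have Cf: "C \<subseteq> forms n f"
    using C(1) flag_subset[OF J l j] span_superset unfolding flag_def by blast
  have finC: "finite C"
    using independent_card_le_dim_fin_span(1)[OF fin_span_forms _ C(2)] Cf span_superset by blast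
  have FC: "?F = span C"
    unfolding flag_def using C by (metis span_eq span_mono span_superset order_trans)
  have dF: "dim ?F = card C" unfolding FC by (rule dim_span_eq_card_independent[OF C(2)])
  have "\<forall>c\<in>C. \<exists>s. c \<notin> J \<longrightarrow> s \<in> forms n j \<and> c = l ^ (f - j) * s" using C(1) by blast
  then obtain \<sigma> where \<sigma>: "\<And>c. c \<in> C \<Longrightarrow> c \<notin> J \<Longrightarrow> \<sigma> c \<in> forms n j \<and> c = l ^ (f - j) * \<sigma> c" by metis
  define v where "v = (\<lambda>c t. if c \<in> J then c else (l + t *\<^sub>R x) ^ (f - j) * \<sigma> c)"
  have vF: "v c t \<in> flag n f J (l + t *\<^sub>R x) j" if "c \<in> C" for c t
    using \<sigma>[OF that] unfolding v_def flag_def by (auto intro!: span_base)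
  have vt: "((\<lambda>t. lookup (v c t) m) \<longlongrightarrow> lookup c m) (at 0)" if "c \<in> C" for c m
  proof (cases "c \<in> J")
    case False
    then have "c = l ^ (f - j) * \<sigma> c" using \<sigma>[OF that] by blast
    then show ?thesis using tendsto_lookup_power[of l x "f - j" "\<sigma> c" m] False
      by (simp add: v_def)
  qed (simp add: v_def)
  have "\<forall>\<^sub>F t in at 0. \<forall>c. (\<Sum>i\<in>C. c i *\<^sub>R v i t) = 0 \<longrightarrow> (\<forall>i\<in>C. c i = 0)"
    using independent_sum_zeroD[OF finC C(2)] by (intro eventually_independent_family[OF finC vt]) auto
  then show "\<forall>\<^sub>F t in at 0. dim ?F \<le> dim (flag n f J (l + t *\<^sub>R x) j)"
  proof eventually_elim
    case (elim t)
    then have "card C \<le> dim (flag n f J (l + t *\<^sub>R x) j)"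
      by (intro card_le_dim_family[OF finC fF vF]) auto
    then show ?case by (simp add: dF)
  qed
  assume s: "s \<in> forms n j" "l ^ (f - j) * s \<in> J" and jf: "Suc j \<le> f"
    and nz: "l ^ (f - Suc j) * (x * s) \<notin> ?F"
  define m where "m = f - Suc j"
  have m: "f - j = Suc m" using jf by (simp add: m_def)
  define z where "z = of_nat (Suc m) * (l ^ m * (x * s))"
  have zs: "z = real (Suc m) *\<^sub>R (l ^ m * (x * s))"
    unfolding z_def scaleR_mpoly_conv_mult single_of_nat ..
  have "z \<notin> span C"
  proof
    assume "z \<in> span C"
    then have "(1 / real (Suc m)) *\<^sub>R z \<in> span C" by (rule span_scale)
    then show False using nz FC unfolding zs m_def[symmetric] by simp
  qed
  then have zC: "z \<notin> C" using span_base by blast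
  have ind: "independent (insert z C)"
    using independent_insertI[OF \<open>z \<notin> span C\<close> C(2)] .
  define v' where "v' = (\<lambda>c t. if c = z then (1 / t) *\<^sub>R ((l + t *\<^sub>R x) ^ Suc m * s - l ^ Suc m * s) else v c t)"
  have fI: "finite (insert z C)" using finC by simp
  have v't: "((\<lambda>t. lookup (v' c t) q) \<longlongrightarrow> lookup c q) (at 0)" if c: "c \<in> insert z C" for c q
  proof (cases "c = z")
    case True
    then show ?thesis using tendsto_lookup_power_deriv[of l x m s q] by (simp only: v'_def z_def[symmetric] refl[THEN eqTrueI] if_True)
  next
    case False
    then show ?thesis using vt c by (simp add: v'_def)
  qed
  have v'F: "v' c t \<in> flag n f J (l + t *\<^sub>R x) j" if "c \<in> insert z C" for c t
  proof (cases "c = z")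
    case True
    have "(l + t *\<^sub>R x) ^ Suc m * s \<in> flag n f J (l + t *\<^sub>R x) j" "l ^ Suc m * s \<in> flag n f J (l + t *\<^sub>R x) j"
      using s unfolding flag_def m by (auto intro!: span_base)
    then show ?thesis using True unfolding v'_def flag_def
      by (simp only: refl[THEN eqTrueI] if_True) (intro span_scale span_diff)
  next
    case False
    then show ?thesis using vF that by (simp add: v'_def)
  qed
  have "\<forall>\<^sub>F t in at 0. \<forall>c. (\<Sum>i\<in>insert z C. c i *\<^sub>R v' i t) = 0 \<longrightarrow> (\<forall>i\<in>insert z C. c i = 0)"
    using independent_sum_zeroD[OF fI ind] by (intro eventually_independent_family[OF fI v't]) auto
  then show "\<forall>\<^sub>F t in at 0. dim ?F < dim (flag n f J (l + t *\<^sub>R x) j)"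
  proof eventually_elim
    case (elim t)
    then have "card (insert z C) \<le> dim (flag n f J (l + t *\<^sub>R x) j)"
      by (intro card_le_dim_family[OF fI fF v'F]) auto
    then show ?case using zC finC by (simp add: dF)
  qed
qed

text \<open>
  For small \<open>t\<close> the flag of \<open>l + t x\<close> has dimensions at least those of the flag of \<open>l\<close>. If \<open>l\<close> maximizes their
  sum, no dimension can grow, and the derivative at \<open>t = 0\<close> gives a condition on \<open>l\<close>.
\<close>

lemma generic_linear_form_exists:
  assumes J: "J \<subseteq> forms n f"
  obtains l where "l \<in> forms n 1"
    "\<And>j s x. Suc j \<le> f \<Longrightarrow> s \<in> forms n j \<Longrightarrow> l ^ (f - j) * s \<in> J \<Longrightarrow> x \<in> forms n 1
      \<Longrightarrow> l ^ (f - Suc j) * (x * s) \<in> flag n f J l j"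
proof -
  define G where "G = (\<lambda>l. \<Sum>j\<le>f. dim (flag n f J l j))"
  have bound: "G l \<le> (\<Sum>j\<le>f. dim (forms n f))" if "l \<in> forms n 1" for l
    unfolding G_def
    by (intro sum_mono dim_le_dim[OF fin_span_forms] order_trans[OF flag_subset[OF J that] span_superset]) auto
  have "\<exists>l. l \<in> forms n 1 \<and> (\<forall>l'. l' \<in> forms n 1 \<longrightarrow> G l' \<le> G l)"
    by (rule ex_has_greatest_nat[of _ 0 _ "Suc (\<Sum>j\<le>f. dim (forms n f))"])
      (use bound in \<open>auto intro: subspace_0 simp: less_Suc_eq_le\<close>)
  then obtain l where l: "l \<in> forms n 1" "\<And>l'. l' \<in> forms n 1 \<Longrightarrow> G l' \<le> G l" by blast
  show ?thesis
  proof (rule that[OF l(1)], rule ccontr)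
    fix j s x
    assume a: "Suc j \<le> f" "s \<in> forms n j" "l ^ (f - j) * s \<in> J" "x \<in> forms n 1"
      "l ^ (f - Suc j) * (x * s) \<notin> flag n f J l j"
    have "\<forall>\<^sub>F t in at 0. \<forall>i\<in>{..f}. dim (flag n f J l i) \<le> dim (flag n f J (l + t *\<^sub>R x) i)"
      using dim_flag_le_eventually(1)[OF J l(1) a(4)] by (intro eventually_ball_finite) auto
    moreover have "\<forall>\<^sub>F t in at 0. dim (flag n f J l j) < dim (flag n f J (l + t *\<^sub>R x) j)"
      using a by (intro dim_flag_le_eventually(2)[OF J l(1) a(4)]) auto
    ultimately have "\<forall>\<^sub>F t in at (0::real). G l < G (l + t *\<^sub>R x)"
    proof eventually_elim
      case (elim t)
      show ?case unfolding G_def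
      proof (rule sum_strict_mono_ex1)
        show "\<exists>i\<in>{..f}. dim (flag n f J l i) < dim (flag n f J (l + t *\<^sub>R x) i)"
          using elim(2) a(1) by (intro bexI[of _ j]) auto
      qed (use elim(1) in auto)
    qed
    from eventually_happens'[OF at_neq_bot this]
    obtain t where "G l < G (l + t *\<^sub>R x)" by (rule exE)
    moreover have "l + t *\<^sub>R x \<in> forms n 1"
      using l(1) a(4) by (intro subspace_add subspace_scale) auto
    ultimately show False using l(2) by (meson not_less)
  qed
qed

section \<open>Flags defined by a generic linear form\<close>

lemma lmult_image_subspace:
  assumes "l \<in> forms n 1"
  shows "(\<lambda>s. l * s) ` forms n e \<subseteq> forms n (Suc e)"
  using forms_mult[OF assms, of _ e] by auto

lemma forms_Suc_hyperplane:
  assumes A: "A \<subseteq> forms n (Suc e)" and l: "l \<in> forms n 1"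
    and S: "forms n (Suc e) \<subseteq> span (A \<union> (\<lambda>s. l * s) ` forms n e)"
  shows "forms n (Suc (Suc e)) \<subseteq> span ((forms n 1 \<odot> A) \<union> (\<lambda>s. l * s) ` forms n (Suc e))"
proof -
  let ?R = "span ((forms n 1 \<odot> A) \<union> (\<lambda>s. l * s) ` forms n (Suc e))"
  have "forms n 1 \<odot> span (A \<union> (\<lambda>s. l * s) ` forms n e) \<subseteq> ?R"
    unfolding pmul_span_right
  proof (rule pmul_subsetI)
    fix a b assume a: "a \<in> forms n 1" and b: "b \<in> A \<union> (\<lambda>s. l * s) ` forms n e"
    show "a * b \<in> ?R"
    proof (cases "b \<in> A")
      case True
      then show ?thesis using a by (intro span_base UnI1 pmulI)
    next
      case False
      then obtain s where s: "s \<in> forms n e" "b = l * s" using b by blast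
      have "a * s \<in> forms n (Suc e)" using forms_mult[OF a s(1)] by simp
      then have "l * (a * s) \<in> ?R" by (intro span_base UnI2 imageI)
      then show ?thesis using s by (simp only: mult.left_commute)
    qed
  qed simp
  moreover have "forms n 1 \<odot> forms n (Suc e) \<subseteq> forms n 1 \<odot> span (A \<union> (\<lambda>s. l * s) ` forms n e)"
    using S by (intro pmul_mono) auto
  ultimately show ?thesis unfolding forms_Suc[of n "Suc e"] by (rule order_trans[rotated])
qed

lemma forms_hyperplane_add:
  assumes A: "A \<subseteq> forms n (Suc e)" and l: "l \<in> forms n 1"
    and S: "forms n (Suc e) \<subseteq> span (A \<union> (\<lambda>s. l * s) ` forms n e)"
  shows "forms n (Suc (e + i)) \<subseteq> span ((forms n i \<odot> A) \<union> (\<lambda>s. l * s) ` forms n (e + i))"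
proof (induction i)
  case 0
  have "A \<subseteq> forms n 0 \<odot> A" using pmulI[of 1 "forms n 0" _ A] by auto
  then have "span (A \<union> (\<lambda>s. l * s) ` forms n e) \<subseteq> span ((forms n 0 \<odot> A) \<union> (\<lambda>s. l * s) ` forms n e)"
    by (intro span_mono Un_mono) auto
  then show ?case using S by auto
next
  case (Suc i)
  have "forms n i \<odot> A \<subseteq> forms n i \<odot> forms n (Suc e)" by (intro pmul_mono A order_refl)
  also have "\<dots> = forms n (Suc (e + i))" by (metis forms_add add_Suc add.commute)
  finally have "forms n (Suc (Suc (e + i)))
      \<subseteq> span ((forms n 1 \<odot> (forms n i \<odot> A)) \<union> (\<lambda>s. l * s) ` forms n (Suc (e + i)))"
    using Suc.IH by (intro forms_Suc_hyperplane l) auto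
  then show ?case unfolding pmul_assoc[symmetric] forms_Suc[of n i, symmetric] by simp
qed

text \<open>Multiplication by \<open>l\<close> induces a surjection from the quotient of
  \<open>forms n (Suc e)\<close> by \<open>A\<close> onto the quotient of the next degree by
  \<open>forms n 1 \<odot> A\<close>.\<close>

lemma codim_mult_linear_le:
  assumes A: "subspace A" "A \<subseteq> forms n (Suc e)" and l: "l \<in> forms n 1"
    and S: "forms n (Suc e) \<subseteq> span (A \<union> (\<lambda>s. l * s) ` forms n e)"
  shows "dim (forms n (Suc (Suc e))) + dim A \<le> dim (forms n 1 \<odot> A) + dim (forms n (Suc e))"
proof -
  obtain Q where Q: "finite Q" "forms n (Suc e) \<subseteq> span (A \<union> Q)"
      "card Q + dim A = dim (forms n (Suc e))"
    using complement_exists[OF fin_span_forms A(2) order_refl subset_span_Un(2)] by metis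
  let ?R = "span ((forms n 1 \<odot> A) \<union> (\<lambda>s. l * s) ` Q)"
  have "l * s \<in> ?R" if s: "s \<in> forms n (Suc e)" for s
  proof (rule span_mult_subset[of _ "A \<union> Q"])
    show "s \<in> span (A \<union> Q)" using s Q(2) by blast
    show "l * a \<in> ?R" if "a \<in> A \<union> Q" for a
      using that l by (auto intro!: span_base pmulI)
  qed simp
  then have "(forms n 1 \<odot> A) \<union> (\<lambda>s. l * s) ` forms n (Suc e) \<subseteq> ?R"
    using subset_span_Un(1)[of "forms n 1 \<odot> A" "(\<lambda>s. l * s) ` Q"] by auto
  then have "span ((forms n 1 \<odot> A) \<union> (\<lambda>s. l * s) ` forms n (Suc e)) \<subseteq> ?R"
    by (intro span_minimal) auto
  then have sub: "forms n (Suc (Suc e)) \<subseteq> ?R"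
    using forms_Suc_hyperplane[OF A(2) l S] by (rule order_trans[rotated])
  have "forms n 1 \<odot> A \<subseteq> forms n (Suc (Suc e))"
    unfolding forms_Suc[of n "Suc e"] by (intro pmul_mono A order_refl)
  then have "dim (forms n (Suc (Suc e))) \<le> dim (forms n 1 \<odot> A) + card ((\<lambda>s. l * s) ` Q)"
    using sub Q(1) by (intro dim_le_add_card fin_span_mono[OF fin_span_forms]) auto
  also have "card ((\<lambda>s. l * s) ` Q) \<le> card Q" using Q(1) by (rule card_image_le)
  finally show ?thesis using Q(3) by linarith
qed

lemma codim_mult_forms_le:
  assumes A: "subspace A" "A \<subseteq> forms n (Suc e)" and l: "l \<in> forms n 1"
    and S: "forms n (Suc e) \<subseteq> span (A \<union> (\<lambda>s. l * s) ` forms n e)"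
  shows "dim (forms n (Suc (e + i))) + dim A \<le> dim (forms n i \<odot> A) + dim (forms n (Suc e))"
proof (induction i)
  case 0 then show ?case using pmul_forms_0[OF A(1)] by simp
next
  case (Suc i)
  have sub: "forms n i \<odot> A \<subseteq> forms n (Suc (e + i))"
    using pmul_mono[OF order_refl A(2), of "forms n i"] by (metis forms_add add_Suc add.commute)
  have "dim (forms n (Suc (Suc (e + i)))) + dim (forms n i \<odot> A)
      \<le> dim (forms n 1 \<odot> (forms n i \<odot> A)) + dim (forms n (Suc (e + i)))"
    by (intro codim_mult_linear_le[OF _ sub l] forms_hyperplane_add[OF A(2) l S]) simp
  also have "forms n 1 \<odot> (forms n i \<odot> A) = forms n (Suc i) \<odot> A"
    unfolding pmul_assoc[symmetric] forms_Suc[of n i, symmetric] ..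
  finally show ?case using Suc by simp
qed

text \<open>\<open>generic\<close> is the condition supplied by
  \<open>generic_linear_form_exists\<close>; \<open>codim\<close> compares the codimension of
  \<open>J\<close> with its degree and so limits the number of strict inclusions in the flag of
  \<open>l\<close>.\<close>

locale generic_hyperplane =
  fixes n f :: nat and J :: "mpoly set" and l :: mpoly
  assumes J: "subspace J" "J \<subseteq> forms n f"
    and l: "l \<in> forms n 1"
    and generic: "\<And>j s x. Suc j \<le> f \<Longrightarrow> s \<in> forms n j \<Longrightarrow> l ^ (f - j) * s \<in> J \<Longrightarrow> x \<in> forms n 1
      \<Longrightarrow> l ^ (f - Suc j) * (x * s) \<in> flag n f J l j"
    and codim: "dim (forms n f) \<le> dim J + f"
begin

text \<open>The index is shifted by one against \<open>flag\<close> so that \<open>J\<close> itself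
  is the bottom; there are \<open>f + 1\<close> inclusions between \<open>Fl 0\<close> and
  \<open>Fl (Suc f)\<close>.\<close>

definition Fl where "Fl i = (case i of 0 \<Rightarrow> J | Suc j \<Rightarrow> flag n f J l j)"

text \<open>\<open>H j\<close> is the sum of the colon space \<open>(J : l ^ (f - j))\<close> and \<open>l S\<^sub>j\<^sub>-\<^sub>1\<close>. By genericity it behaves like an ideal.\<close>

definition H where "H j = {s \<in> forms n j. l ^ (f - j) * s \<in> Fl j}"

definition L where "L j = (case j of 0 \<Rightarrow> {0} | Suc i \<Rightarrow> (\<lambda>s. l * s) ` forms n i)"

lemma subspace_Fl: "subspace (Fl i)"
  by (cases i) (auto simp: Fl_def flag_def J)

lemma Fl_subset: "i \<le> Suc f \<Longrightarrow> Fl i \<subseteq> forms n f"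
  using flag_subset[OF J(2) l] J by (cases i) (auto simp: Fl_def)

lemma J_subset_Fl: "J \<subseteq> Fl i"
  using subset_span_Un(1) by (cases i) (auto simp: Fl_def flag_def)

lemma subspace_H: "subspace (H j)"
  unfolding H_def by (intro subspace_preimage linear_mult_mpoly subspace_Fl subspace_forms)

lemma H_subset: "H j \<subseteq> forms n j"
  by (auto simp: H_def)

lemma L_subset: "L j \<subseteq> forms n j"
  using lmult_image_subspace[OF l] subspace_0[OF subspace_forms] by (cases j) (auto simp: L_def)

lemma mult_L: "x \<in> forms n i \<Longrightarrow> w \<in> L j \<Longrightarrow> x * w \<in> L (i + j)"
proof (cases j)
  case (Suc j')
  assume x: "x \<in> forms n i" and "w \<in> L j"
  then obtain s where s: "s \<in> forms n j'" "w = l * s" using Suc by (auto simp: L_def)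
  have "x * w = l * (x * s)" using s by (simp add: ac_simps)
  then show ?thesis using forms_mult[OF x s(1)] Suc by (auto simp: L_def)
qed (auto simp: L_def subspace_0 split: nat.split intro!: image_eqI[of _ _ 0])

lemma L_subset_H: "j \<le> f \<Longrightarrow> L j \<subseteq> H j"
proof (cases j)
  case 0 then show ?thesis using subspace_0[OF subspace_H] by (simp add: L_def)
next
  case (Suc i)
  assume j: "j \<le> f"
  have "l * s \<in> H j" if s: "s \<in> forms n i" for s
  proof -
    have "l ^ (f - j) * (l * s) = l ^ Suc (f - j) * s" by (simp add: ac_simps)
    also have "Suc (f - j) = f - i" using j Suc by simp
    finally have "l ^ (f - j) * (l * s) \<in> (\<lambda>s. l ^ (f - i) * s) ` forms n i"
      using s by (simp only: imageI)
    then have "l ^ (f - j) * (l * s) \<in> Fl j"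
      unfolding Suc Fl_def flag_def nat.case by (intro span_base UnI2)
    then show ?thesis using forms_mult[OF l s] Suc by (simp add: H_def)
  qed
  then show ?thesis using Suc by (auto simp: L_def)
qed

text \<open>Genericity speaks of the colon space only; splitting off a multiple of \<open>l\<close>
  makes it applicable to elements of \<open>H j\<close>.\<close>

lemma H_decomp:
  assumes "s \<in> H j" "j \<le> f"
  obtains s' w where "s = s' + w" "s' \<in> forms n j" "l ^ (f - j) * s' \<in> J" "w \<in> L j"
proof (cases j)
  case 0
  then show ?thesis using assms that[of s 0] by (auto simp: H_def Fl_def L_def)
next
  case (Suc i)
  let ?h = "\<lambda>s. l ^ (f - i) * s"
  have "l ^ (f - j) * s \<in> span (J \<union> ?h ` forms n i)"
    using assms Suc by (auto simp: H_def Fl_def flag_def)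
  then obtain u w where uw: "u \<in> J" "w \<in> span (?h ` forms n i)" "l ^ (f - j) * s = u + w"
    using mem_span_UnD J(1) by blast
  have "span (?h ` forms n i) = ?h ` forms n i"
    unfolding linear_span_image[OF linear_mult_mpoly] by (simp add: span_eq_iff[THEN iffD2])
  then obtain t where t: "t \<in> forms n i" "w = l ^ (f - i) * t" using uw(2) by blast
  have "f - i = Suc (f - j)" using assms(2) Suc by simp
  then have "l ^ (f - j) * (s - l * t) = u"
    using uw(3) t(2) by (simp add: algebra_simps)
  moreover have "l * t \<in> L j" unfolding Suc L_def nat.case by (intro imageI t(1))
  moreover have "s - l * t \<in> forms n j"
    using assms(1) H_subset L_subset calculation(2) by (intro subspace_diff) auto
  ultimately show ?thesis using that[of "s - l * t" "l * t"] uw(1) by simp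
qed

text \<open>On the colon part this is exactly \<open>generic\<close>, and multiples of
  \<open>l\<close> stay multiples of \<open>l\<close>.\<close>

lemma mult_H_1:
  assumes "x \<in> forms n 1" "s \<in> H j" "Suc j \<le> f"
  shows "x * s \<in> H (Suc j)"
proof -
  have "j \<le> f" using assms by simp
  from H_decomp[OF assms(2) this] obtain s' w where
    s: "s = s' + w" "s' \<in> forms n j" "l ^ (f - j) * s' \<in> J" "w \<in> L j" .
  have "x * w \<in> L (Suc j)" using mult_L[OF assms(1) s(4)] by simp
  then have "x * w \<in> H (Suc j)" using L_subset_H[OF assms(3)] by blast
  moreover have "x * s' \<in> H (Suc j)"
    using generic[OF assms(3) s(2,3) assms(1)] forms_mult[OF assms(1) s(2)] by (simp add: H_def Fl_def)
  ultimately show ?thesis unfolding s(1) distrib_left using subspace_add[OF subspace_H] by blast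
qed

lemma mult_H:
  assumes "i + j \<le> f" "s \<in> H j" "x \<in> forms n i"
  shows "x * s \<in> H (i + j)"
  using assms
proof (induction i arbitrary: x)
  case 0
  then show ?case using forms_0_eq[of x n] subspace_scale[OF subspace_H]
    by (metis add_0 mpoly_scaleR_mult_left mult_1)
next
  case (Suc i)
  have "x \<in> forms n 1 \<odot> forms n i" using Suc.prems(3) unfolding forms_Suc .
  moreover have "forms n 1 \<odot> forms n i \<subseteq> {p. s * p \<in> H (Suc i + j)}"
  proof (intro pmul_subsetI subspace_mult_preimage subspace_H CollectI)
    fix a b assume "a \<in> forms n 1" "b \<in> forms n i"
    then have "a * (b * s) \<in> H (Suc (i + j))"
      using Suc by (intro mult_H_1) auto
    then show "s * (a * b) \<in> H (Suc i + j)" by (simp add: ac_simps)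
  qed
  ultimately show ?case by (auto simp: mult.commute)
qed

lemma Fl_mono: "i \<le> f \<Longrightarrow> Fl i \<subseteq> Fl (Suc i)"
proof (cases i)
  case 0 then show ?thesis using J_subset_Fl[of 1] by (simp add: Fl_def)
next
  case (Suc j)
  assume i: "i \<le> f"
  have "l ^ (f - j) * s \<in> Fl (Suc i)" if s: "s \<in> forms n j" for s
  proof -
    have "f - j = Suc (f - i)" using i Suc by simp
    then have "l ^ (f - j) * s = l ^ (f - i) * (l * s)" by (simp add: ac_simps)
    moreover have "l * s \<in> forms n i" using forms_mult[OF l s] Suc by simp
    ultimately show ?thesis by (auto simp: Fl_def flag_def intro!: span_base)
  qed
  then have "J \<union> (\<lambda>s. l ^ (f - j) * s) ` forms n j \<subseteq> Fl (Suc i)"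
    using J_subset_Fl[of "Suc i"] by blast
  then show ?thesis unfolding Suc Fl_def[of "Suc j"] flag_def nat.case
    by (intro span_minimal) (use Suc subspace_Fl in auto)
qed

lemma span_Fl_image: "i \<le> f \<Longrightarrow> span (Fl i \<union> (\<lambda>s. l ^ (f - i) * s) ` forms n i) = Fl (Suc i)"
proof
  assume i: "i \<le> f"
  show "span (Fl i \<union> (\<lambda>s. l ^ (f - i) * s) ` forms n i) \<subseteq> Fl (Suc i)"
  proof (rule span_minimal[OF _ subspace_Fl])
    have "(\<lambda>s. l ^ (f - i) * s) ` forms n i \<subseteq> Fl (Suc i)"
      unfolding Fl_def flag_def nat.case by (rule subset_span_Un)
    then show "Fl i \<union> (\<lambda>s. l ^ (f - i) * s) ` forms n i \<subseteq> Fl (Suc i)" using Fl_mono[OF i] by simp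
  qed
  show "Fl (Suc i) \<subseteq> span (Fl i \<union> (\<lambda>s. l ^ (f - i) * s) ` forms n i)"
    unfolding Fl_def[of "Suc i"] flag_def nat.case
    by (intro span_mono Un_mono order_refl J_subset_Fl)
qed

lemma fin_span_Fl: "i \<le> Suc f \<Longrightarrow> fin_span (Fl i)"
  using fin_span_mono[OF fin_span_forms Fl_subset] .

text \<open>The codimension of \<open>H i\<close> is the size of step \<open>i\<close> of the flag,
  so these codimensions add up to the codimension of \<open>J\<close>.\<close>

lemma dim_H: "i \<le> f \<Longrightarrow> dim (H i) + dim (Fl (Suc i)) = dim (forms n i) + dim (Fl i)"
  using dim_preimage[OF linear_mult_mpoly[of "l ^ (f - i)"] subspace_forms fin_span_forms subspace_Fl fin_span_Fl, of i n i]
    span_Fl_image[of i]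
  unfolding H_def by (simp del: dim_span)

lemma Fl_last: "Fl (Suc f) = forms n f"
proof
  show "Fl (Suc f) \<subseteq> forms n f" by (rule Fl_subset) simp
  show "forms n f \<subseteq> Fl (Suc f)"
    using subset_span_Un(2)[of "forms n f" J] by (simp add: Fl_def flag_def)
qed

lemma H_all_mono:
  assumes "H j = forms n j" "j + i \<le> f"
  shows "H (j + i) = forms n (j + i)"
proof
  show "forms n (j + i) \<subseteq> H (j + i)"
  proof -
    have "forms n i \<odot> forms n j \<subseteq> H (i + j)"
      using assms by (intro pmul_subsetI subspace_H mult_H) auto
    then show ?thesis by (simp only: forms_add[symmetric] add.commute)
  qed
qed (rule H_subset)

text \<open>Otherwise all \<open>f + 1\<close> inclusions of the flag would be strict, against the bound on the codimension of \<open>J\<close>.\<close>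

lemma H_last: "H f = forms n f"
proof (rule ccontr)
  assume nH: "H f \<noteq> forms n f"
  have "dim (Fl i) < dim (Fl (Suc i))" if i: "i \<le> f" for i
  proof -
    have "H i \<noteq> forms n i" using H_all_mono[of i "f - i"] nH i by auto
    then have "dim (H i) < dim (forms n i)"
      using subspace_eq_of_dim_le[OF subspace_H H_subset fin_span_forms] by (meson not_less)
    then show ?thesis using dim_H[OF i] by linarith
  qed
  then have "i \<le> Suc f \<Longrightarrow> dim J + i \<le> dim (Fl i)" for i
  proof (induction i)
    case 0 then show ?case by (simp add: Fl_def)
  next
    case (Suc i)
    then have "dim (Fl i) < dim (Fl (Suc i))" "dim J + i \<le> dim (Fl i)" by auto
    then show ?case by linarith
  qed
  from this[of "Suc f"] show False using codim Fl_last by simp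
qed

lemma forms_hyperplane: "0 < f \<Longrightarrow> forms n f \<subseteq> span (J \<union> (\<lambda>s. l * s) ` forms n (f - 1))"
proof -
  assume f: "0 < f"
  have "s \<in> Fl f" if "s \<in> forms n f" for s using that unfolding H_last[symmetric] by (simp add: H_def)
  moreover have "Fl f = span (J \<union> (\<lambda>s. l * s) ` forms n (f - 1))"
    unfolding Fl_def flag_def using f by (auto split: nat.split)
  ultimately show ?thesis by blast
qed

lemma complement_family:
  obtains e :: "nat \<Rightarrow> nat" and b :: "nat \<Rightarrow> mpoly"
  where "\<And>i. b i \<in> forms n (e i)"
    "\<And>j. j \<le> f \<Longrightarrow> forms n j \<subseteq> span (H j \<union> {b i |i. i < dim (forms n f) - dim J \<and> e i = j})"
proof -
  have "\<exists>Q. finite Q \<and> Q \<subseteq> forms n j \<and> forms n j \<subseteq> span (H j \<union> Q) \<and> card Q + dim (H j) = dim (forms n j)" for j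
    using complement_exists[OF fin_span_forms H_subset order_refl subset_span_Un(2)] by metis
  then obtain Q where Q: "\<And>j. finite (Q j)" "\<And>j. Q j \<subseteq> forms n j"
      "\<And>j. forms n j \<subseteq> span (H j \<union> Q j)" "\<And>j. card (Q j) + dim (H j) = dim (forms n j)" by metis
  let ?I = "Sigma {..f} Q"
  have "i \<le> Suc f \<Longrightarrow> (\<Sum>j<i. card (Q j)) + dim J = dim (Fl i)" for i
  proof (induction i)
    case 0 then show ?case by (simp add: Fl_def)
  next
    case (Suc i)
    then show ?case using dim_H[of i] Q(4)[of i] by simp
  qed
  from this[of "Suc f"] have "(\<Sum>j\<le>f. card (Q j)) = dim (forms n f) - dim J"
    using Fl_last by (simp add: lessThan_Suc_atMost)
  then have cI: "card ?I = dim (forms n f) - dim J" using Q(1) by simp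
  have "finite ?I" using Q(1) by simp
  from ex_bij_betw_nat_finite[OF this] obtain g where g: "bij_betw g {0..<dim (forms n f) - dim J} ?I"
    unfolding cI by blast
  \<comment> \<open>Past the last index the form 0 in degree 0 keeps
    \<open>b i \<in> forms n (e i)\<close> true for all \<open>i\<close>.\<close>
  define e where "e = (\<lambda>i. if i < dim (forms n f) - dim J then fst (g i) else 0)"
  define b where "b = (\<lambda>i. if i < dim (forms n f) - dim J then snd (g i) else 0)"
  have gi: "g i \<in> ?I" if "i < dim (forms n f) - dim J" for i
    using bij_betwE[OF g] that by simp
  show ?thesis
  proof (rule that)
    show "b i \<in> forms n (e i)" for i
      using gi[of i] subsetD[OF Q(2)] subspace_0[OF subspace_forms] by (auto simp: e_def b_def)
    fix j assume j: "j \<le> f"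
    have "Q j \<subseteq> {b i |i. i < dim (forms n f) - dim J \<and> e i = j}"
    proof
      fix q assume "q \<in> Q j"
      then have "(j, q) \<in> g ` {0..<dim (forms n f) - dim J}" using g j by (simp add: bij_betw_def)
      then obtain i where "i < dim (forms n f) - dim J" "g i = (j, q)" by auto
      then show "q \<in> {b i |i. i < dim (forms n f) - dim J \<and> e i = j}"
        by (intro CollectI exI[of _ i]) (simp add: e_def b_def)
    qed
    then show "forms n j \<subseteq> span (H j \<union> {b i |i. i < dim (forms n f) - dim J \<and> e i = j})"
      using Q(3)[of j] span_mono[of "H j \<union> Q j" "H j \<union> {b i |i. i < dim (forms n f) - dim J \<and> e i = j}"] by blast
  qed
qed

end

text \<open>Sorted triples stand for multisets of three indices, since products of three forms do
  not depend on the order; this is the origin of the cubic binomial.\<close>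

definition sorted_triples :: "nat \<Rightarrow> (nat \<times> nat \<times> nat) set" where
  "sorted_triples r = {(i, j, m). i \<le> j \<and> j \<le> m \<and> m < r}"

lemma sorted_pairs_card: "finite {(i, j). i \<le> j \<and> j < r} \<and> card {(i, j). i \<le> j \<and> j < (r::nat)} \<le> (r + 1) choose 2"
proof (induction r)
  case (Suc r)
  have eq: "{(i, j). i \<le> j \<and> j < Suc r} = {(i, j). i \<le> j \<and> j < r} \<union> (\<lambda>i. (i, r)) ` {..r}"
    by (auto simp: less_Suc_eq)
  have "card {(i, j). i \<le> j \<and> j < Suc r} \<le> ((r + 1) choose 2) + Suc r"
    unfolding eq using Suc card_image_le[of "{..r}" "\<lambda>i. (i, r)"]
    by (intro order_trans[OF card_Un_le] add_mono) auto
  then show ?case using Suc by (simp add: eq numeral_2_eq_2)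
qed simp

text \<open>The triples with largest entry \<open>r\<close> correspond to the sorted pairs below
  \<open>Suc r\<close>; the rest is Pascal's rule.\<close>

lemma sorted_triples_card: "finite (sorted_triples r)" "card (sorted_triples r) \<le> (r + 2) choose 3"
proof (induction r)
  case 0
  show "finite (sorted_triples 0)" "card (sorted_triples 0) \<le> (0 + 2) choose 3"
  proof -
    have "sorted_triples 0 = {}" by (auto simp: sorted_triples_def)
    then show "finite (sorted_triples 0)" "card (sorted_triples 0) \<le> (0 + 2) choose 3" by simp_all
  qed
next
  case (Suc r)
  let ?P = "{(i, j). i \<le> j \<and> j < Suc r}"
  have eq: "sorted_triples (Suc r) = sorted_triples r \<union> (\<lambda>(i, j). (i, j, r)) ` ?P"
    by (auto simp: less_Suc_eq sorted_triples_def)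
  have "card (sorted_triples (Suc r)) \<le> ((r + 2) choose 3) + ((Suc r + 1) choose 2)"
    unfolding eq using Suc(2) card_image_le[of ?P "\<lambda>(i, j). (i, j, r)"] sorted_pairs_card[of "Suc r"]
    by (intro order_trans[OF card_Un_le] add_mono) auto
  also have "\<dots> = (Suc r + 2) choose 3" by (simp add: numeral_3_eq_3 numeral_2_eq_2)
  finally show "card (sorted_triples (Suc r)) \<le> (Suc r + 2) choose 3" .
  show "finite (sorted_triples (Suc r))" using Suc(1) sorted_pairs_card[of "Suc r"] by (simp add: eq)
qed

lemma mult_mem_pmul3:
  assumes "x \<in> span A" "y \<in> span B" "z \<in> span C"
  shows "x * y * z \<in> A \<odot> B \<odot> C"
  using pmulI[OF pmulI[OF assms(1,2)] assms(3)] by simp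

context generic_hyperplane
begin

text \<open>
  With \<open>b i\<close> spanning complements of the \<open>H j\<close>, one shows by induction on \<open>j\<close> that \<open>l ^ (2 * f - j) S\<^sub>j\<close> lies in the
  right-hand side \<open>T\<close>: products of two elements of the \<open>H a\<close> land in \<open>J\<^sup>2\<close> up to multiples of \<open>l\<close>, and
  products of three elements \<open>b i\<close> span \<open>Q\<close>.
\<close>

lemma double_degree_decomposition:
  assumes f: "0 < f"
  obtains Q where "finite Q" "card Q \<le> (dim (forms n f) - dim J + 2) choose 3"
    "forms n (2 * f) \<subseteq> span (J \<odot> J \<union>
      {l ^ (f - 1) * y * s |y s. y \<in> forms n 1 \<and> l ^ (f - 1) * y \<in> J \<and> s \<in> forms n f} \<union> Q)"
proof -
  define r where "r = dim (forms n f) - dim J"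
  obtain b and e :: "nat \<Rightarrow> nat" where e: "\<And>i. b i \<in> forms n (e i)"
    and eb: "\<And>j. j \<le> f \<Longrightarrow> forms n j \<subseteq> span (H j \<union> {b i |i. i < r \<and> e i = j})"
    by (rule complement_family[folded r_def]) (rule that)
  define B where "B j = {b i |i. i < r \<and> e i = j}" for j
  have HB: "forms n j \<subseteq> span (H j \<union> B j)" if "j \<le> f" for j
    using eb[OF that] unfolding B_def .
  have B: "B j \<subseteq> forms n j" for j using e by (auto simp: B_def)
  \<comment> \<open>The power of \<open>l\<close> fills the degree up to \<open>2 * f\<close>.
    Triples of larger total degree get exponent 0 by truncated subtraction; they merely enlarge
    \<open>T\<close>.\<close>
  define q where "q = (\<lambda>(i, j, m). l ^ (2 * f - (e i + e j + e m)) * (b i * b j * b m))"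
  define Q where "Q = q ` sorted_triples r"
  define Y where "Y = {l ^ (f - 1) * y * s |y s. y \<in> forms n 1 \<and> l ^ (f - 1) * y \<in> J \<and> s \<in> forms n f}"
  define T where "T = span (J \<odot> J \<union> Y \<union> Q)"
  have JT: "J \<odot> J \<subseteq> T" and YT: "Y \<subseteq> T" and QT: "Q \<subseteq> T"
    unfolding T_def using span_superset[of "J \<odot> J \<union> Y \<union> Q"] by simp_all
  have T: "subspace T" by (simp add: T_def)
  have qT: "q (i, j, m) \<in> T" if "i < r" "j < r" "m < r" for i j m
  proof -
    have 1: "q (i, j, m) = q (j, i, m)" "q (i, j, m) = q (i, m, j)" for i j m
      by (simp_all add: q_def ac_simps)
    have s: "q (i, j, m) \<in> T" if "i \<le> j" "j \<le> m" "m < r" for i j m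
      using QT that unfolding Q_def sorted_triples_def by blast
    have A: "q (i, j, m) \<in> T" if "i \<le> j" "j < r" "m < r" for i j m
    proof (cases "m \<le> i")
      case True
      then show ?thesis using s[of m i j] that 1(1)[of m i j] 1(2)[of i m j] by metis
    next
      case False
      show ?thesis
      proof (cases "m \<le> j")
        case True
        then show ?thesis using s[of i m j] that False 1(2)[of i m j] by simp
      next
        case F: False
        then show ?thesis using s[of i j m] that by simp
      qed
    qed
    show ?thesis
    proof (cases "i \<le> j")
      case True
      then show ?thesis using A that by blast
    next
      case False
      then show ?thesis using A[of j i m] that 1(1)[of i j m] by simp
    qed
  qed
  define T' where "T' j = {s \<in> forms n j. l ^ (2 * f - j) * s \<in> T}" for j
  have T': "subspace (T' j)" for j
    unfolding T'_def by (intro subspace_preimage linear_mult_mpoly T subspace_forms)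
  have main: "j \<le> 2 * f \<Longrightarrow> forms n j \<subseteq> T' j" for j
  proof (induction j rule: less_induct)
    case (less j)
    \<comment> \<open>Multiples of \<open>l\<close> are covered by the previous degree, so
      everything below may be computed modulo \<open>l\<close>.\<close>
    have LT: "L j \<subseteq> T' j"
    proof (cases j)
      case 0 then show ?thesis using subspace_0[OF T'] by (simp add: L_def)
    next
      case (Suc i)
      have "l * s \<in> T' j" if s: "s \<in> forms n i" for s
      proof -
        have "s \<in> T' i" using less.IH[of i] less.prems Suc s by auto
        moreover have "2 * f - i = Suc (2 * f - j)" using less.prems Suc by simp
        ultimately show ?thesis using forms_mult[OF l s] Suc by (simp add: T'_def ac_simps)
      qed
      then show ?thesis using Suc by (auto simp: L_def)
    qed
    have HH: "u * v \<in> T' j" if ab: "a + a' = j" "a \<le> f" "a' \<le> f" and uv: "u \<in> H a" "v \<in> H a'" for a a' u v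
    proof -
      obtain u' w where u: "u = u' + w" "u' \<in> forms n a" "l ^ (f - a) * u' \<in> J" "w \<in> L a"
        by (rule H_decomp[OF uv(1) ab(2)])
      obtain v' w' where v: "v = v' + w'" "v' \<in> forms n a'" "l ^ (f - a') * v' \<in> J" "w' \<in> L a'"
        by (rule H_decomp[OF uv(2) ab(3)])
      have "l ^ (2 * f - j) = l ^ (f - a) * l ^ (f - a')"
        unfolding power_add[symmetric] using ab by (intro arg_cong[of _ _ "power l"]) auto
      then have "l ^ (2 * f - j) * (u' * v') = (l ^ (f - a) * u') * (l ^ (f - a') * v')"
        by (simp add: ac_simps)
      also have "\<dots> \<in> T" using JT pmulI[OF u(3) v(3)] by blast
      finally have 1: "u' * v' \<in> T' j" using forms_mult[OF u(2) v(2)] ab by (simp add: T'_def)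
      have "v \<in> forms n a'" using uv(2) H_subset by blast
      from mult_L[OF this u(4)] have 2: "v * w \<in> T' j" using LT ab by (auto simp: add.commute)
      have 3: "u' * w' \<in> T' j" using mult_L[OF u(2) v(4)] LT ab by auto
      have "u * v = u' * v' + u' * w' + v * w" by (simp add: u(1) v(1) algebra_simps)
      then show ?thesis using 1 2 3 T' by (metis subspace_add)
    qed
    \<comment> \<open>If enough degree is left, \<open>s\<close> factors through
      \<open>forms n f\<close>, which equals \<open>H f\<close>; the other factor pushes
      \<open>u\<close> into \<open>H (j - f)\<close>, and \<open>HH\<close> applies.\<close>
    have Hbig: "u * s \<in> T' j" if a: "a + f \<le> j" and u: "u \<in> H a" "s \<in> forms n (j - a)" for a u s
    proof -
      have af: "a + (j - f - a) = j - f" "j - f \<le> f" "(j - f - a) + f = j - a" "(j - f) + f = j"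
        using a less.prems by auto
      have "forms n (j - f - a) \<odot> forms n f \<subseteq> {p. u * p \<in> T' j}"
      proof (intro pmul_subsetI subspace_mult_preimage T' CollectI)
        fix x y assume x: "x \<in> forms n (j - f - a)" and y: "y \<in> forms n f"
        have "x * u \<in> H (j - f)" using mult_H[of "j - f - a" a u x] x u(1) af by (simp add: add.commute)
        moreover have "y \<in> H f" using y H_last by simp
        ultimately have "(x * u) * y \<in> T' j" using HH[of "j - f" f] af by simp
        then show "u * (x * y) \<in> T' j" by (simp add: ac_simps)
      qed
      then show ?thesis using u(2) unfolding forms_add[symmetric] af by blast
    qed
    have BBB: "B a1 \<odot> B a2 \<odot> B a3 \<subseteq> T' j" if j: "a1 + a2 + a3 = j" for a1 a2 a3
      unfolding pmul_assoc
    proof (rule pmul_subsetI[OF T'])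
      fix x w assume x: "x \<in> B a1" and w: "w \<in> B a2 \<odot> B a3"
      have "B a2 \<odot> B a3 \<subseteq> {p. x * p \<in> T' j}"
      proof (intro pmul_subsetI subspace_mult_preimage T' CollectI)
        fix y z assume yz: "y \<in> B a2" "z \<in> B a3"
        obtain i1 i2 i3 where i: "x = b i1" "y = b i2" "z = b i3" "i1 < r" "i2 < r" "i3 < r"
            "e i1 = a1" "e i2 = a2" "e i3 = a3" using x yz by (auto simp: B_def)
        have "b i1 * b i2 * b i3 \<in> forms n (e i1 + e i2 + e i3)"
          by (intro forms_mult e)
        then have "x * y * z \<in> T' j" using qT[OF i(4-6)] i(1-3,7-9) j by (simp add: T'_def q_def)
        then show "x * (y * z) \<in> T' j" by (simp add: mult.assoc)
      qed
      then show "x * w \<in> T' j" using w by blast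
    qed
    \<comment> \<open>The purpose of \<open>Y\<close>: when \<open>l ^ (f - 1) * y'\<close> is in
      \<open>J\<close>, the remaining power of \<open>l\<close> is moved to \<open>s\<close> and
      fills its degree up to \<open>f\<close>.\<close>
    have H1: "y * s \<in> T' j" if j: "1 \<le> j" and y: "y \<in> H 1" and s: "s \<in> forms n (j - 1)" for y s
    proof (cases "j \<le> f + 1")
      case True
      have "1 \<le> f" using f by simp
      from H_decomp[OF y this] obtain y' w where
        y': "y = y' + w" "y' \<in> forms n 1" "l ^ (f - 1) * y' \<in> J" "w \<in> L 1" .
      have eq: "l ^ (2 * f - j) = l ^ (f - 1) * l ^ (f + 1 - j)"
        unfolding power_add[symmetric] using True f j by (intro arg_cong[of _ _ "power l"]) auto
      have eqs: "l ^ (2 * f - j) * (y' * s) = l ^ (f - 1) * y' * (l ^ (f + 1 - j) * s)"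
        unfolding eq by (simp only: ac_simps)
      have "l ^ (f + 1 - j) * s \<in> forms n f"
        using forms_mult[OF forms_power1[OF l, of "f + 1 - j"] s] True j by simp
      then have "l ^ (f - 1) * y' * (l ^ (f + 1 - j) * s) \<in> Y" using y'(2,3) unfolding Y_def by blast
      then have "l ^ (2 * f - j) * (y' * s) \<in> T" unfolding eqs using YT by (rule subsetD[rotated])
      then have "y' * s \<in> T' j"
        using forms_mult[OF y'(2) s] j by (simp add: T'_def)
      moreover have "s * w \<in> T' j" using mult_L[OF s y'(4)] LT j by auto
      ultimately have "y' * s + s * w \<in> T' j" using T' by (rule subspace_add[rotated])
      then show ?thesis by (simp add: y'(1) algebra_simps)
    next
      case False
      then show ?thesis using Hbig[of 1] y s by simp
    qed
    have Hi1: "u * s \<in> T' j" if "Suc i \<le> f" "Suc i \<le> j" "u \<in> H (Suc i)" "s \<in> forms n (j - Suc i)" for i u s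
      using that
    proof (induction i arbitrary: u s)
      case 0 then show ?case using H1[of u s] by simp
    next
      case (Suc i)
      define a where "a = Suc i"
      note IH = Suc.IH[folded a_def] and a = Suc.prems[folded a_def]
      show ?case
      proof (cases "f \<le> j - Suc a")
        case True
        then show ?thesis using Hbig[of "Suc a" u s] a by simp
      next
        case False
        \<comment> \<open>Modulo \<open>V\<close>, the form \<open>u\<close> is a combination
          \<open>\<beta>\<close> of products of two forms \<open>b i\<close>. As \<open>u\<close>
          and \<open>p\<close> both lie in \<open>H (Suc a)\<close>, so does \<open>\<beta>\<close>:
          against the part \<open>h\<close> of \<open>s\<close> it is covered by \<open>HH\<close>,
          against the part \<open>\<gamma>\<close> it gives triple products.\<close>
        define V where "V = span ((H 1 \<odot> forms n a) \<union> (forms n 1 \<odot> H a))"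
        have "x * y \<in> span (V \<union> B 1 \<odot> B a)" if x: "x \<in> forms n 1" and y: "y \<in> forms n a" for x y
        proof -
          obtain h \<beta> where h: "h \<in> H 1" "\<beta> \<in> span (B 1)" "x = h + \<beta>"
            using mem_span_UnD[OF subsetD[OF HB x] subspace_H] a by auto
          obtain h' \<beta>' where h': "h' \<in> H a" "\<beta>' \<in> span (B a)" "y = h' + \<beta>'"
            using mem_span_UnD[OF subsetD[OF HB y] subspace_H] a by auto
          have "span (B 1) \<subseteq> forms n 1" by (intro span_minimal B) simp
          then have \<beta>: "\<beta> \<in> forms n 1" using h(2) by blast
          have "h * y \<in> V" unfolding V_def by (intro span_base UnI1 pmulI h(1) y)
          moreover have "\<beta> * h' \<in> V" unfolding V_def by (intro span_base UnI2 pmulI \<beta> h'(1))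
          ultimately have "h * y + \<beta> * h' \<in> V" unfolding V_def by (rule span_add)
          moreover have "\<beta> * \<beta>' \<in> B 1 \<odot> B a" using pmulI[OF h(2) h'(2)] by simp
          moreover have "x * y = (h * y + \<beta> * h') + \<beta> * \<beta>'"
            by (simp add: h(3) h'(3) algebra_simps)
          ultimately show ?thesis by (metis mem_span_UnI span_base)
        qed
        then have "forms n 1 \<odot> forms n a \<subseteq> span (V \<union> B 1 \<odot> B a)" by (intro pmul_subsetI) auto
        then have "u \<in> span (V \<union> B 1 \<odot> B a)" using a(3) H_subset unfolding forms_Suc[symmetric] by blast
        then obtain p \<beta> where p: "p \<in> V" "\<beta> \<in> span (B 1 \<odot> B a)" "u = p + \<beta>"
          using mem_span_UnD[of u V "B 1 \<odot> B a"] unfolding V_def by auto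
        have \<beta>: "\<beta> \<in> B 1 \<odot> B a" using p(2) by (simp add: span_eq_iff[THEN iffD2])
        have VH: "V \<subseteq> H (Suc a)"
          unfolding V_def
        proof (rule span_minimal[OF _ subspace_H], rule Un_least; rule pmul_subsetI[OF subspace_H])
          fix x y assume "x \<in> H 1" "y \<in> forms n a"
          then have "y * x \<in> H (a + 1)" using a by (intro mult_H) auto
          then show "x * y \<in> H (Suc a)" by (simp add: mult.commute)
        next
          fix x y assume "x \<in> forms n 1" "y \<in> H a"
          then show "x * y \<in> H (Suc a)" using a(1) by (rule mult_H_1)
        qed
        have \<beta>H: "\<beta> \<in> H (Suc a)"
          using subspace_diff[OF subspace_H a(3) subsetD[OF VH p(1)]] p(3) by simp
        have sp: "s * p \<in> T' j"
          using p(1) unfolding V_def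
        proof (rule span_mult_subset[OF T', rotated])
          have j: "a + (j - Suc a) = j - 1" "1 + (j - Suc a) = j - a" using a by auto
          fix v assume "v \<in> (H 1 \<odot> forms n a) \<union> (forms n 1 \<odot> H a)"
          moreover have "H 1 \<odot> forms n a \<subseteq> {v. s * v \<in> T' j}"
          proof (intro pmul_subsetI subspace_mult_preimage T' CollectI)
            fix x y assume x: "x \<in> H 1" and y: "y \<in> forms n a"
            have "x * (y * s) \<in> T' j" using H1[of x "y * s"] x forms_mult[OF y a(4)] j a by simp
            then show "s * (x * y) \<in> T' j" by (simp add: ac_simps)
          qed
          moreover have "forms n 1 \<odot> H a \<subseteq> {v. s * v \<in> T' j}"
          proof (intro pmul_subsetI subspace_mult_preimage T' CollectI)
            fix x y assume x: "x \<in> forms n 1" and y: "y \<in> H a"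
            have "x * s \<in> forms n (j - a)" using forms_mult[OF x a(4)] unfolding j .
            then have "y * (x * s) \<in> T' j" using a y by (intro IH) auto
            then show "s * (x * y) \<in> T' j" by (simp add: ac_simps)
          qed
          ultimately show "s * v \<in> T' j" by blast
        qed
        obtain h \<gamma> where h: "h \<in> H (j - Suc a)" "\<gamma> \<in> span (B (j - Suc a))" "s = h + \<gamma>"
          using mem_span_UnD[OF subsetD[OF HB a(4)] subspace_H] False by auto
        have "\<beta> * h \<in> T' j" using \<beta>H h(1) a False by (intro HH[of "Suc a" "j - Suc a"]) auto
        moreover have "\<beta> * \<gamma> \<in> T' j"
          using BBB[of 1 a "j - Suc a"] a pmulI[OF \<beta> h(2)] by auto
        ultimately have "s * p + (\<beta> * h + \<beta> * \<gamma>) \<in> T' j" using sp T' by (intro subspace_add)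
        then show ?thesis by (simp add: p(3) h(3) algebra_simps)
      qed
    qed
    have Hi: "u * s \<in> T' j" if i: "i \<le> f" "i \<le> j" and u: "u \<in> H i" "s \<in> forms n (j - i)" for i u s
    proof (cases i)
      case (Suc i')
      then show ?thesis using Hi1[of i' u s] i u by simp
    next
      case 0
      show ?thesis
      proof (cases "f \<le> j")
        case True then show ?thesis using Hbig[of 0 u s] 0 u by simp
      next
        case False
        then have su: "s * u \<in> H j" using mult_H[of j 0 u s] 0 u by simp
        show ?thesis
        proof (cases j)
          case 0
          have uu: "u * u \<in> T' j" using u(1) 0 \<open>i = 0\<close> by (intro HH[of 0 0]) auto
          obtain c where c: "u = c *\<^sub>R 1" using forms_0_eq[of u n] u(1) H_subset \<open>i = 0\<close> by blast
          obtain c' where c': "s = c' *\<^sub>R 1" using forms_0_eq[of s n] u(2) 0 \<open>i = 0\<close> by auto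
          \<comment> \<open>For \<open>c = 0\<close> both sides are 0, whatever the
            quotient.\<close>
          have "u * s = (c' / c) *\<^sub>R (u * u)" unfolding c c' by simp
          then show ?thesis using uu subspace_scale[OF T'] by simp
        next
          case (Suc j')
          then show ?thesis using Hi1[of j' "s * u" 1] su False by (simp add: mult.commute)
        qed
      qed
    qed
    show ?case
    proof (cases "j \<le> f")
      case True
      \<comment> \<open>Splitting 1 in degree 0 pads single forms to triple products: with
        \<open>h = 1 - \<beta>\<close>, the form \<open>s\<close> is the sum of
        \<open>s * \<beta> * \<beta>\<close> and \<open>h * (s * (1 + \<beta>))\<close>.\<close>
      obtain h \<beta> where h: "h \<in> H 0" "\<beta> \<in> span (B 0)" "1 = h + \<beta>"
        using mem_span_UnD[OF subsetD[OF HB one_in_forms] subspace_H] by auto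
      have \<beta>0: "\<beta> \<in> forms n 0" using h H_subset by (metis add_diff_cancel_left' one_in_forms subsetD subspace_diff subspace_forms)
      show ?thesis
      proof
        fix s assume s: "s \<in> forms n j"
        obtain h' \<gamma> where h': "h' \<in> H j" "\<gamma> \<in> span (B j)" "s = h' + \<gamma>"
          using mem_span_UnD[OF subsetD[OF HB s] subspace_H] True by auto
        have "\<gamma> * \<beta> * \<beta> \<in> T' j" using mult_mem_pmul3[OF h'(2) h(2) h(2)] BBB[of j 0 0] by auto
        moreover have "h' * (\<beta> * \<beta>) \<in> T' j"
          using h'(1) forms_mult[OF \<beta>0 \<beta>0] True by (intro Hi[of j]) auto
        moreover have "h * (s * (1 + \<beta>)) \<in> T' j"
          using h(1) forms_mult[OF s subspace_add[OF subspace_forms one_in_forms \<beta>0]] by (intro Hi[of 0]) auto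
        ultimately have "\<gamma> * \<beta> * \<beta> + h' * (\<beta> * \<beta>) + h * (s * (1 + \<beta>)) \<in> T' j"
          using T' by (intro subspace_add)
        moreover have "h = 1 - \<beta>" by (simp add: h(3))
        ultimately show "s \<in> T' j" by (simp add: h'(3) algebra_simps)
      qed
    next
      case False
      have "forms n f \<odot> forms n (j - f) \<subseteq> T' j"
        using False by (intro pmul_subsetI T' Hi[of f]) (auto simp: H_last)
      then show ?thesis using False by (simp flip: forms_add)
    qed
  qed
  have "forms n (2 * f) \<subseteq> T" using main[of "2 * f"] by (auto simp: T'_def)
  moreover have "finite Q" unfolding Q_def using sorted_triples_card(1) by simp
  moreover have "card Q \<le> (r + 2) choose 3"
    unfolding Q_def using card_image_le[OF sorted_triples_card(1)] sorted_triples_card(2) by (rule order_trans)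
  ultimately show ?thesis using that unfolding T_def Y_def r_def by blast
qed

end

section \<open>Complex evaluation and common zeros\<close>

definition mon_eval :: "(nat \<Rightarrow> complex) \<Rightarrow> (nat \<Rightarrow>\<^sub>0 nat) \<Rightarrow> complex" where
  "mon_eval \<xi> m = (\<Prod>i\<in>keys m. \<xi> i ^ lookup m i)"

lemma mon_eval_superset: "finite A \<Longrightarrow> keys m \<subseteq> A \<Longrightarrow> mon_eval \<xi> m = (\<Prod>i\<in>A. \<xi> i ^ lookup m i)"
  unfolding mon_eval_def by (rule prod.mono_neutral_left) (auto simp: in_keys_iff)

lemma mon_eval_add: "mon_eval \<xi> (m + m') = mon_eval \<xi> m * mon_eval \<xi> m'"
  using keys_add[of m m']
  by (simp add: mon_eval_superset[of "keys m \<union> keys m'"] lookup_add power_add prod.distrib)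

lemma mon_eval_0 [simp]: "mon_eval \<xi> 0 = 1"
  by (simp add: mon_eval_def)

lemma mon_eval_single [simp]: "mon_eval \<xi> (single i 1) = \<xi> i"
  by (simp add: mon_eval_def)

lemma eval_complex_superset:
  "finite A \<Longrightarrow> keys p \<subseteq> A \<Longrightarrow> eval_complex \<xi> p = (\<Sum>m\<in>A. of_real (lookup p m) * mon_eval \<xi> m)"
  unfolding eval_complex_def mon_eval_def
  by (rule sum.mono_neutral_left) (auto simp: in_keys_iff)

lemma eval_complex_add: "eval_complex \<xi> (p + q) = eval_complex \<xi> p + eval_complex \<xi> q"
  using keys_add[of p q]
  by (simp add: eval_complex_superset[of "keys p \<union> keys q"] lookup_add distrib_right sum.distrib)

lemma eval_complex_scaleR: "eval_complex \<xi> (c *\<^sub>R p) = c *\<^sub>R eval_complex \<xi> p"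
proof -
  have "keys (c *\<^sub>R p) \<subseteq> keys p" by (auto simp: in_keys_iff)
  then show ?thesis
    by (simp add: eval_complex_superset[of "keys p"] scaleR_conv_of_real[where 'a=complex] sum_distrib_left mult.assoc)
qed

lemma linear_eval_complex: "linear (eval_complex \<xi>)"
  by (rule linearI) (auto simp: eval_complex_add eval_complex_scaleR)

lemma eval_complex_sum: "eval_complex \<xi> (\<Sum>i\<in>I. p i) = (\<Sum>i\<in>I. eval_complex \<xi> (p i))"
  by (rule linear_sum[OF linear_eval_complex])

lemma eval_complex_single: "eval_complex \<xi> (single m c) = of_real c * mon_eval \<xi> m"
  by (simp add: eval_complex_superset[of "{m}"])

lemma mpoly_eq_sum_single: "(p::mpoly) = (\<Sum>m\<in>keys p. single m (lookup p m))"
  by (rule poly_mapping_eqI) (auto simp: lookup_sum lookup_single when_def in_keys_iff)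

lemma eval_complex_mult: "eval_complex \<xi> (p * q) = eval_complex \<xi> p * eval_complex \<xi> q"
proof -
  have "p * q = (\<Sum>m\<in>keys p. \<Sum>m'\<in>keys q. single (m + m') (lookup p m * lookup q m'))"
    using arg_cong2[OF mpoly_eq_sum_single[of p] mpoly_eq_sum_single[of q], of times]
    unfolding sum_product mult_single .
  then have "eval_complex \<xi> (p * q) = (\<Sum>m\<in>keys p. \<Sum>m'\<in>keys q.
      (of_real (lookup p m) * mon_eval \<xi> m) * (of_real (lookup q m') * mon_eval \<xi> m'))"
    by (simp add: eval_complex_sum eval_complex_single mon_eval_add mult_ac)
  then show ?thesis
    by (simp only: eval_complex_superset[OF finite_keys order_refl] sum_product)
qed

section \<open>Complex functionals on real vector spaces and their eigenvectors\<close>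

lemma functional_exists:
  fixes V :: "'a::real_vector set"
  assumes V: "subspace V" and x: "x \<notin> V"
  obtains \<phi> :: "'a \<Rightarrow> real" where "linear \<phi>" "\<And>v. v \<in> V \<Longrightarrow> \<phi> v = 0" "\<phi> x = 1"
proof -
  obtain B where B: "B \<subseteq> V" "independent B" "V \<subseteq> span B"
    by (rule basis_exists[of V])
  have xB: "x \<notin> span B" using span_minimal[OF B(1) V] x by blast
  obtain \<phi> where \<phi>: "linear \<phi>" "\<forall>y\<in>insert x B. \<phi> y = (if y = x then 1 else 0 :: real)"
    using linear_independent_extend[OF independent_insertI[OF xB B(2)], of "\<lambda>y. if y = x then 1 else 0"]
    by (elim exE conjE)
  have "\<phi> v = 0" if "v \<in> V" for v
  proof (rule linear_eq_0_on_span[OF \<phi>(1)])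
    show "v \<in> span B" using that B(3) by (rule subsetD[rotated])
    show "\<phi> y = 0" if "y \<in> B" for y
    proof -
      have "y \<noteq> x" using span_base[OF that] xB by blast
      then show ?thesis using \<phi>(2) that by simp
    qed
  qed
  then show ?thesis using that \<phi> by simp
qed

lemma fin_span_dependent_sequence:
  fixes f :: "nat \<Rightarrow> 'a::real_vector"
  assumes "fin_span W" "\<And>k. f k \<in> W"
  obtains N c k where "(\<Sum>k\<le>N. c k *\<^sub>R f k) = 0" "k \<le> N" "c k \<noteq> 0"
proof (rule ccontr)
  assume "\<not> thesis"
  then have "card {..dim W} \<le> dim W"
    using that by (intro card_le_dim_family[of _ W f] assms) auto
  then show False by simp
qed

text \<open>The polynomial \<open>p\<close> in the transpose of \<open>h\<close>, applied to the
  functional \<open>a\<close>. Complex values of \<open>a\<close> replace a complexification of the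
  real space.\<close>

definition poly_act :: "complex poly \<Rightarrow> ('a \<Rightarrow> 'a) \<Rightarrow> ('a \<Rightarrow> complex) \<Rightarrow> 'a \<Rightarrow> complex" where
  "poly_act p h a u = (\<Sum>k\<le>degree p. coeff p k * a ((h ^^ k) u))"

lemma poly_act_superset: "degree p \<le> N \<Longrightarrow> poly_act p h a u = (\<Sum>k\<le>N. coeff p k * a ((h ^^ k) u))"
  unfolding poly_act_def by (rule sum.mono_neutral_left) (auto simp: coeff_eq_0)

lemma poly_act_pCons: "poly_act (pCons c q) h a u = c * a u + poly_act q h a (h u)"
proof -
  have "poly_act (pCons c q) h a u = (\<Sum>k\<le>Suc (degree q). coeff (pCons c q) k * a ((h ^^ k) u))"
    by (rule poly_act_superset) (rule degree_pCons_le)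
  also have "\<dots> = c * a u + (\<Sum>k\<le>degree q. coeff q k * a ((h ^^ Suc k) u))"
    unfolding sum.atMost_Suc_shift by simp
  finally show ?thesis by (simp add: poly_act_def funpow_swap1)
qed

lemma poly_act_add: "poly_act (p + q) h a u = poly_act p h a u + poly_act q h a u"
proof -
  have "degree (p + q) \<le> max (degree p) (degree q)" by (rule degree_add_le_max)
  then show ?thesis
    by (simp add: poly_act_superset[of _ "max (degree p) (degree q)"] distrib_right sum.distrib)
qed

lemma poly_act_smult: "poly_act (smult c p) h a u = c * poly_act p h a u"
  using degree_smult_le[of c p]
  by (simp add: poly_act_superset[of _ "degree p"] sum_distrib_left mult.assoc)

lemma poly_act_linear_factor: "poly_act ([:- r, 1:] * q) h a u = poly_act q h a (h u) - r * poly_act q h a u"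
proof -
  have "[:- r, 1:] * q = smult (- r) q + pCons 0 q" by simp
  then show ?thesis by (simp only: poly_act_add poly_act_smult poly_act_pCons) simp
qed

lemma linear_cscale: "linear g \<Longrightarrow> linear (\<lambda>u. (c::complex) * g u)"
  by (rule linearI) (auto simp: linear_add linear_scale algebra_simps)

lemma linear_funpow:
  assumes "linear h" shows "linear ((h::'a::real_vector \<Rightarrow> 'a) ^^ k)"
proof (induction k)
  case 0 then show ?case using linear_id unfolding id_def by simp
next
  case (Suc k) then show ?case using linear_compose[OF Suc assms] by (simp add: o_def)
qed

lemma linear_poly_act:
  fixes h :: "'a::real_vector \<Rightarrow> 'a"
  assumes "linear h" "linear a"
  shows "linear (poly_act p h a)"
proof -
  have "linear (\<lambda>u. a ((h ^^ k) u))" for k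
    using linear_compose[OF linear_funpow[OF assms(1), of k] assms(2)] by (simp add: o_def)
  then show ?thesis unfolding poly_act_def[abs_def]
    by (intro linear_compose_sum ballI linear_cscale) 
qed

text \<open>Linear factors of \<open>p\<close> are removed while the quotient still annihilates
  \<open>a\<close>. The first quotient that does not gives an eigenvector, whose eigenvalue is the
  root just removed.\<close>

lemma eigenvector_of_annihilated:
  assumes "p \<noteq> 0" "\<And>u. u \<in> S \<Longrightarrow> poly_act p h a u = 0" "\<exists>u\<in>S. a u \<noteq> 0"
  shows "\<exists>q r. (\<exists>u\<in>S. poly_act q h a u \<noteq> 0) \<and> (\<forall>u\<in>S. poly_act q h a (h u) = r * poly_act q h a u)"
  using assms(1,2)
proof (induction "degree p" arbitrary: p)
  case 0
  then obtain c where "p = [:c:]" by (metis degree_eq_zeroE)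
  with 0 assms(3) show ?case by (auto simp: poly_act_def)
next
  case (Suc m)
  have "\<not> constant (poly p)" using Suc.hyps(2) by (simp add: constant_degree)
  then obtain r where "poly p r = 0" using fundamental_theorem_of_algebra by blast
  then obtain q where q: "p = [:- r, 1:] * q" by (auto simp: poly_eq_0_iff_dvd)
  have q0: "q \<noteq> 0" using q Suc.prems(1) by auto
  have "degree p = Suc (degree q)" unfolding q by (subst degree_mult_eq) (use q0 in auto)
  then have dq: "m = degree q" using Suc.hyps(2) by simp
  have r: "poly_act q h a (h u) = r * poly_act q h a u" if "u \<in> S" for u
    using Suc.prems(2)[OF that] unfolding q poly_act_linear_factor by simp
  show ?case
  proof (cases "\<exists>u\<in>S. poly_act q h a u \<noteq> 0")
    case True
    then show ?thesis using r by blast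
  next
    case False
    then show ?thesis using Suc.hyps(1)[OF dq q0] by blast
  qed
qed

text \<open>The iterates of \<open>a\<close> under \<open>h\<close> are determined by their values
  on a finite basis, hence linearly dependent; a dependence is an annihilating polynomial.\<close>

lemma eigenvector_exists:
  fixes a :: "'a::real_vector \<Rightarrow> complex"
  assumes S: "fin_span S" and h: "linear h" "h ` S \<subseteq> S" and a: "linear a" and nz: "\<exists>u\<in>S. a u \<noteq> 0"
  shows "\<exists>q r. (\<exists>u\<in>S. poly_act q h a u \<noteq> 0) \<and> (\<forall>u\<in>S. poly_act q h a (h u) = r * poly_act q h a u)"
proof -
  obtain B where "B \<subseteq> S" "independent B" and B: "S \<subseteq> span B" and "card B = dim S" and fB: "finite B"
    by (rule finite_basis_exists[OF S])
  define v :: "nat \<Rightarrow> 'a \<Rightarrow>\<^sub>0 complex" where "v = (\<lambda>k. \<Sum>u\<in>B. single u (a ((h ^^ k) u)))"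
  \<comment> \<open>A real space with two generators per basis element. Real dependence is enough,
    so the coefficients of \<open>p\<close> are real; only its roots need be complex.\<close>
  define W :: "('a \<Rightarrow>\<^sub>0 complex) set" where "W = span ((\<lambda>u. single u 1) ` B \<union> (\<lambda>u. single u \<i>) ` B)"
  have sc: "lookup (c *\<^sub>R (p :: 'a \<Rightarrow>\<^sub>0 complex)) m = c *\<^sub>R lookup p m" for c p m
  proof -
    have "finite {m. c *\<^sub>R lookup p m \<noteq> 0}"
      by (rule finite_subset[OF _ finite_lookup[of p]]) auto
    then show ?thesis by (simp add: scaleR_poly_mapping_def Abs_poly_mapping_inverse)
  qed
  have sz: "single u z = Re z *\<^sub>R single u 1 + Im z *\<^sub>R single u \<i>" for u :: 'a and z
    by (rule poly_mapping_eqI) (auto simp: sc lookup_add lookup_single when_def complex_eq_iff)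
  have "single u z \<in> W" if "u \<in> B" for u z
    unfolding W_def sz[of u z] using that by (intro span_add span_scale span_base) auto
  then have vW: "v k \<in> W" for k unfolding v_def W_def by (intro span_sum) auto
  have fW: "fin_span W" unfolding W_def using fB by (intro fin_span_span fin_span_finite) auto
  obtain N c k0 where c: "(\<Sum>k\<le>N. c k *\<^sub>R v k) = 0" "k0 \<le> N" "c k0 \<noteq> 0"
    using fin_span_dependent_sequence[where f = v, OF fW vW] by blast
  define p where "p = (\<Sum>k\<le>N. monom (of_real (c k) :: complex) k)"
  have cp: "coeff p k = (if k \<le> N then of_real (c k) else 0)" for k
    by (simp add: p_def coeff_sum coeff_monom)
  have dp: "degree p \<le> N" by (rule degree_le) (simp add: cp)
  have "p \<noteq> 0" using cp[of k0] c(2,3) by auto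
  moreover have "poly_act p h a u = 0" if u: "u \<in> S" for u
  proof (rule linear_eq_0_on_span[OF linear_poly_act[OF h(1) a]])
    show "u \<in> span B" using u B by blast
    fix w assume w: "w \<in> B"
    have "0 = lookup (\<Sum>k\<le>N. c k *\<^sub>R v k) w" using c(1) by simp
    also have "\<dots> = (\<Sum>k\<le>N. c k *\<^sub>R a ((h ^^ k) w))"
      using w fB by (simp add: lookup_sum sc v_def lookup_single when_def)
    finally show "poly_act p h a w = 0"
      using poly_act_superset[OF dp, of h a w] by (simp add: cp scaleR_conv_of_real)
  qed
  ultimately show ?thesis using eigenvector_of_annihilated nz by blast
qed

lemma linear_sub_mult: "linear \<sigma> \<Longrightarrow> linear (\<lambda>u. u - l * (\<sigma> u :: mpoly))"
  by (rule linearI) (auto simp: linear_add linear_scale algebra_simps)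

text \<open>
  Multiplication by \<open>l\<close> induces an isomorphism \<open>S\<^sub>e\<^sub>+\<^sub>1 / A \<rightarrow> S\<^sub>e\<^sub>+\<^sub>2 / S\<^sub>1 A\<close> with inverse \<open>\<sigma>\<close>. The transposes of the
  maps \<open>u \<mapsto> x\<^sub>i \<sigma>(u)\<close> commute on the complex functionals that kill \<open>S\<^sub>1 A\<close>; a common eigenvector is, up to
  a factor, the evaluation at the point of its eigenvalues.
\<close>

lemma common_zero_exists:
  assumes A: "subspace A" "A \<subseteq> forms n (Suc e)" and l: "l \<in> forms n 1"
    and S: "forms n (Suc e) \<subseteq> span (A \<union> (\<lambda>s. l * s) ` forms n e)"
    and stab: "dim (forms n (Suc (Suc e))) + dim A = dim (forms n 1 \<odot> A) + dim (forms n (Suc e))"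
    and ne: "A \<noteq> forms n (Suc e)"
  obtains \<xi> i where "i < n" "\<xi> i \<noteq> 0" "\<And>u. u \<in> forms n 1 \<odot> A \<Longrightarrow> eval_complex \<xi> u = 0"
proof -
  let ?E = "forms n (Suc e)" and ?S = "forms n (Suc (Suc e))" and ?D = "forms n 1 \<odot> A"
  let ?l = "\<lambda>s. l * s"
  have D: "?D \<subseteq> ?S" unfolding forms_Suc[of n "Suc e"] by (intro pmul_mono A order_refl)
  have lE: "?l ` ?E \<subseteq> ?S" by (rule lmult_image_subspace[OF l])
  have spS: "?S \<subseteq> span (?D \<union> ?l ` ?E)" by (rule forms_Suc_hyperplane[OF A(2) l S])
  \<comment> \<open>Multiplication by \<open>l\<close> is onto between the quotients, and
    \<open>stab\<close> says that their dimensions agree, so it is injective as well.\<close>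
  have ker: "s \<in> A" if "s \<in> ?E" "l * s \<in> ?D" for s
  proof -
    let ?K = "{s \<in> ?E. l * s \<in> ?D}"
    have "span (?D \<union> ?l ` ?E) \<subseteq> ?S" using D lE by (intro span_minimal) auto
    then have eq: "span (?D \<union> ?l ` ?E) = ?S" using spS by (rule equalityI)
    have "dim ?K + dim (span (?D \<union> ?l ` ?E)) = dim ?E + dim ?D"
      by (rule dim_preimage[OF linear_mult_mpoly subspace_forms fin_span_forms subspace_pmul
          fin_span_mono[OF fin_span_forms D]])
    then have "dim ?K + dim ?S = dim ?E + dim ?D" unfolding eq .
    then have "dim ?K \<le> dim A" using stab by linarith
    moreover have "A \<subseteq> ?K" using A(2) l by (auto intro: pmulI)
    ultimately have "A = ?K"
      using A(1) by (intro subspace_eq_of_dim_le fin_span_mono[OF fin_span_forms[of n "Suc e"]]) auto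
    then show ?thesis using that by blast
  qed
  have "\<exists>s. s \<in> ?E \<and> u - l * s \<in> ?D" if u: "u \<in> ?S" for u
  proof -
    obtain v w where vw: "v \<in> ?D" "w \<in> span (?l ` ?E)" "u = v + w"
      using mem_span_UnD[OF subsetD[OF spS u] subspace_pmul] .
    have "span (?l ` ?E) = ?l ` ?E"
      unfolding linear_span_image[OF linear_mult_mpoly] by (simp add: span_eq_iff[THEN iffD2])
    then obtain s where "s \<in> ?E" "w = l * s" using vw(2) by blast
    then show ?thesis using vw by (intro exI[of _ s]) auto
  qed
  \<comment> \<open>Preimages under multiplication by \<open>l\<close> modulo \<open>?D\<close>;
    extending linearly from a basis then gives a linear choice \<open>\<sigma>\<close>.\<close>
  then obtain \<sigma>0 where \<sigma>0: "\<And>u. u \<in> ?S \<Longrightarrow> \<sigma>0 u \<in> ?E \<and> u - l * \<sigma>0 u \<in> ?D" by metis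
  obtain B where B: "B \<subseteq> ?S" "independent B" "?S \<subseteq> span B" by (rule basis_exists[of ?S])
  obtain \<sigma> where \<sigma>: "linear \<sigma>" "\<forall>u\<in>B. \<sigma> u = \<sigma>0 u"
    using linear_independent_extend[OF B(2), of \<sigma>0] by (elim exE conjE)
  have \<sigma>S: "\<sigma> u \<in> ?E" "u - l * \<sigma> u \<in> ?D" if u: "u \<in> ?S" for u
  proof -
    have "subspace {u \<in> {u \<in> UNIV. \<sigma> u \<in> ?E}. u - l * \<sigma> u \<in> ?D}"
      by (intro subspace_preimage linear_sub_mult \<sigma>(1) subspace_UNIV subspace_forms subspace_pmul)
    moreover have "B \<subseteq> {u \<in> {u \<in> UNIV. \<sigma> u \<in> ?E}. u - l * \<sigma> u \<in> ?D}"
    proof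
      fix u assume u: "u \<in> B"
      then show "u \<in> {u \<in> {u \<in> UNIV. \<sigma> u \<in> ?E}. u - l * \<sigma> u \<in> ?D}"
        using \<sigma>0[OF subsetD[OF B(1) u]] \<sigma>(2) by simp
    qed
    ultimately have "span B \<subseteq> {u \<in> {u \<in> UNIV. \<sigma> u \<in> ?E}. u - l * \<sigma> u \<in> ?D}"
      by (rule span_minimal[rotated])
    then show "\<sigma> u \<in> ?E" "u - l * \<sigma> u \<in> ?D" using subsetD[OF B(3) u] by auto
  qed
  define h where "h = (\<lambda>i u. var i * \<sigma> u)"
  have h: "linear (h i)" for i
    using linear_compose[OF \<sigma>(1) linear_mult_mpoly] by (simp add: h_def o_def)
  have hS: "h i u \<in> ?S" if "i < n" "u \<in> ?S" for i u
    using forms_mult[OF var_in_forms[OF that(1)] \<sigma>S(1)[OF that(2)]] by (simp add: h_def)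
  define ann where "ann = (\<lambda>a :: mpoly \<Rightarrow> complex. linear a \<and> (\<forall>u\<in>?D. a u = 0))"
  have annD: "a u = 0" if "ann a" "u \<in> ?D" for a u using that by (simp add: ann_def)
  have ann_eq: "a u = a v" if "ann a" "u - v \<in> ?D" for a u v
    using annD[OF that] that(1) by (simp add: ann_def linear_diff)
  have varD: "var i * s \<in> ?D" if "i < n" "s \<in> A" for i s
    using that by (intro pmulI var_in_forms)
  have ann_h: "ann (\<lambda>u. a (h i u))" if a: "ann a" and i: "i < n" for a i
    unfolding ann_def
  proof (intro conjI ballI)
    show "linear (\<lambda>u. a (h i u))"
      using linear_compose[OF h[of i], of a] a by (simp add: o_def ann_def)
    fix u assume u: "u \<in> ?D"
    then have uS: "u \<in> ?S" using D by (rule subsetD[rotated])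
    have "u - (u - l * \<sigma> u) \<in> ?D" by (rule subspace_diff[OF subspace_pmul u \<sigma>S(2)[OF uS]])
    then have "\<sigma> u \<in> A" using ker[OF \<sigma>S(1)[OF uS]] by simp
    then show "a (h i u) = 0" unfolding h_def by (intro annD[OF a] varD i)
  qed
  have ann_hk: "ann (\<lambda>u. a ((h i ^^ k) u))" if a: "ann a" and i: "i < n" for a i k
  proof (induction k)
    case 0 then show ?case using a by simp
  next
    case (Suc k)
    then show ?case using ann_h[OF Suc i] by (simp add: funpow_swap1)
  qed
  have ann_poly: "ann (poly_act q (h i) a)" if a: "ann a" and i: "i < n" for a i q
    using linear_poly_act[OF h[of i], of a] a annD[OF ann_hk[OF a i]]
    by (simp add: ann_def poly_act_def)
  \<comment> \<open>Modulo \<open>A\<close>, \<open>\<sigma> u\<close> may be replaced by a multiple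
    \<open>l * t\<close>, and the inverse of \<open>l\<close> cancels the factor. The result is
    symmetric in \<open>i\<close> and \<open>j\<close>, which is why the operators commute.\<close>
  have half: "a (h i (h j u)) = a (var i * (var j * t))"
    if a: "ann a" and ij: "i < n" "j < n" and u: "u \<in> ?S" and t: "t \<in> forms n e" "\<sigma> u - l * t \<in> A"
    for a i j u t
  proof -
    let ?w = "\<sigma> (h j u)"
    have "var j * (\<sigma> u - l * t) - (h j u - l * ?w) \<in> ?D"
      by (rule subspace_diff[OF subspace_pmul varD[OF ij(2) t(2)] \<sigma>S(2)[OF hS[OF ij(2) u]]])
    also have "var j * (\<sigma> u - l * t) - (h j u - l * ?w) = l * (?w - var j * t)"
      by (simp add: h_def algebra_simps)
    finally have "l * (?w - var j * t) \<in> ?D" .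
    moreover have "?w - var j * t \<in> ?E"
      using \<sigma>S(1)[OF hS[OF ij(2) u]] forms_mult[OF var_in_forms[OF ij(2)] t(1)]
      by (intro subspace_diff subspace_forms) auto
    ultimately have "var i * (?w - var j * t) \<in> ?D" by (intro varD[OF ij(1)] ker)
    then show ?thesis unfolding h_def by (intro ann_eq[OF a]) (simp add: right_diff_distrib h_def)
  qed
  have comm: "a (h i (h j u)) = a (h j (h i u))" if a: "ann a" and ij: "i < n" "j < n" and u: "u \<in> ?S" for a i j u
  proof -
    obtain v w where vw: "v \<in> A" "w \<in> span (?l ` forms n e)" "\<sigma> u = v + w"
      using mem_span_UnD[OF subsetD[OF S \<sigma>S(1)[OF u]] A(1)] .
    have "span (?l ` forms n e) = ?l ` forms n e"
      unfolding linear_span_image[OF linear_mult_mpoly] by (simp add: span_eq_iff[THEN iffD2])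
    then obtain t where t: "t \<in> forms n e" "w = l * t" using vw(2) by blast
    have "\<sigma> u - l * t \<in> A" using vw t by simp
    from half[OF a ij u t(1) this] half[OF a ij(2,1) u t(1) this] show ?thesis
      by (simp add: mult.left_commute)
  qed
  have hkS: "(h i ^^ k) u \<in> ?S" if "i < n" "u \<in> ?S" for i k u
    using that by (induction k) (auto intro: hS)
  have commk: "a ((h j ^^ k) (h i u)) = a (h i ((h j ^^ k) u))"
    if a: "ann a" and ij: "i < n" "j < n" and u: "u \<in> ?S" for a i j u k
    using u
  proof (induction k arbitrary: u)
    case 0 then show ?case by simp
  next
    case (Suc k)
    have "a ((h j ^^ Suc k) (h i u)) = a ((h j ^^ k) (h j (h i u)))" by (simp add: funpow_swap1)
    also have "\<dots> = a ((h j ^^ k) (h i (h j u)))"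
      by (rule comm[OF ann_hk[OF a ij(2), of k] ij(2,1) Suc.prems])
    also have "\<dots> = a (h i ((h j ^^ k) (h j u)))" by (rule Suc.IH[OF hS[OF ij(2) Suc.prems]])
    finally show ?case by (simp add: funpow_swap1)
  qed
  \<comment> \<open>Passing from \<open>a\<close> to \<open>poly_act q (h m) a\<close> preserves the
    earlier eigenvalues because the operators commute on functionals killing
    \<open>?D\<close>.\<close>
  have "m \<le> n \<Longrightarrow> \<exists>a. ann a \<and> (\<exists>u\<in>?S. a u \<noteq> 0) \<and> (\<forall>i<m. \<exists>r. \<forall>u\<in>?S. a (h i u) = r * a u)" for m
  proof (induction m)
    case 0
    have "dim A < dim ?E"
      using ne subspace_eq_of_dim_le[OF A fin_span_forms] by (meson not_less)
    then have "?D \<noteq> ?S" using stab by (intro notI) simp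
    then obtain x where x: "x \<in> ?S" "x \<notin> ?D" using D by blast
    obtain \<phi> :: "mpoly \<Rightarrow> real" where \<phi>: "linear \<phi>" "\<And>v. v \<in> ?D \<Longrightarrow> \<phi> v = 0" "\<phi> x = 1"
      by (rule functional_exists[OF subspace_pmul x(2)]) (rule that)
    have "linear (\<lambda>u. complex_of_real (\<phi> u))"
      by (rule linearI) (auto simp: linear_add[OF \<phi>(1)] linear_scale[OF \<phi>(1)] scaleR_conv_of_real)
    then have "ann (\<lambda>u. of_real (\<phi> u))" using \<phi>(2) by (simp add: ann_def)
    then show ?case using x(1) \<phi>(3)
      by (intro exI[of _ "\<lambda>u. of_real (\<phi> u)"] conjI bexI[of _ x]) auto
  next
    case (Suc m)
    then obtain a where a: "ann a" "\<exists>u\<in>?S. a u \<noteq> 0" "\<And>i. i < m \<Longrightarrow> \<exists>r. \<forall>u\<in>?S. a (h i u) = r * a u"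
      by (metis Suc_leD)
    have m: "m < n" using Suc.prems by simp
    obtain q r where q: "\<exists>u\<in>?S. poly_act q (h m) a u \<noteq> 0"
        "\<And>u. u \<in> ?S \<Longrightarrow> poly_act q (h m) a (h m u) = r * poly_act q (h m) a u"
      using eigenvector_exists[OF fin_span_forms h[of m] _ _ a(2)] a(1) hS[OF m] unfolding ann_def
      by blast
    have "\<exists>r. \<forall>u\<in>?S. poly_act q (h m) a (h i u) = r * poly_act q (h m) a u" if i: "i < Suc m" for i
    proof (cases "i = m")
      case True then show ?thesis using q(2) by blast
    next
      case False
      then have im: "i < m" "i < n" using i m by auto
      obtain r where r: "\<And>u. u \<in> ?S \<Longrightarrow> a (h i u) = r * a u" using a(3)[OF im(1)] by blast
      have "poly_act q (h m) a (h i u) = r * poly_act q (h m) a u" if u: "u \<in> ?S" for u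
        using commk[OF a(1) im(2) m u] r[OF hkS[OF m u]]
        by (simp add: poly_act_def sum_distrib_left mult.left_commute)
      then show ?thesis by blast
    qed
    then show ?case using q(1) ann_poly[OF a(1) m] by blast
  qed
  from this[of n] obtain a where a: "ann a" "\<exists>u\<in>?S. a u \<noteq> 0" "\<forall>i<n. \<exists>r. \<forall>u\<in>?S. a (h i u) = r * a u"
    by auto
  then obtain \<xi> where \<xi>: "\<And>i u. i < n \<Longrightarrow> u \<in> ?S \<Longrightarrow> a (h i u) = \<xi> i * a u" by metis
  have av: "a (var i * t) = \<xi> i * a (l * t)" if i: "i < n" and t: "t \<in> ?E" for i t
  proof -
    have lt: "l * t \<in> ?S" using lE t by blast
    have "l * (t - \<sigma> (l * t)) \<in> ?D" using \<sigma>S(2)[OF lt] by (simp add: right_diff_distrib)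
    then have "t - \<sigma> (l * t) \<in> A" using \<sigma>S(1)[OF lt] t by (intro ker subspace_diff subspace_forms)
    then have "var i * (t - \<sigma> (l * t)) \<in> ?D" by (intro varD i)
    then have "a (var i * t) = a (h i (l * t))"
      by (intro ann_eq[OF a(1)]) (simp add: right_diff_distrib h_def)
    then show ?thesis using \<xi>[OF i lt] by simp
  qed
  \<comment> \<open>A power of \<open>l\<close> fills up the degree of a monomial; exchanging one
    variable for \<open>l\<close> costs its eigenvalue.\<close>
  have am: "a (single m 1 * l ^ (Suc (Suc e) - j)) = mon_eval \<xi> m * a (l ^ Suc (Suc e))"
    if "j \<le> Suc (Suc e)" "m \<in> exponents n j" for m j
    using that
  proof (induction j arbitrary: m)
    case 0
    then have "m = 0"
      by (intro poly_mapping_eqI) (auto simp: exponents_def in_keys_iff subset_iff)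
    then show ?case by simp
  next
    case (Suc j)
    obtain i m' where m: "i < n" "m' \<in> exponents n j" "m = single i 1 + m'"
      by (rule exponents_Suc_split[OF Suc.prems(2)])
    let ?t = "single m' 1 * l ^ (Suc e - j)"
    have "?t \<in> forms n (j + (Suc e - j))"
      by (intro forms_mult single_in_forms m(2) forms_power1 l)
    then have t: "?t \<in> ?E" using Suc.prems(1) by simp
    have "a (single m 1 * l ^ (Suc (Suc e) - Suc j)) = a (var i * ?t)"
      unfolding m(3) single_mult_single1 var_def by (simp add: mult.assoc)
    also have "\<dots> = \<xi> i * a (l * ?t)" by (rule av[OF m(1) t])
    also have "l * ?t = single m' 1 * l ^ (Suc (Suc e) - j)"
      using Suc.prems(1) by (simp add: Suc_diff_le mult.left_commute)
    also have "a \<dots> = mon_eval \<xi> m' * a (l ^ Suc (Suc e))" using Suc.prems(1) m(2) by (intro Suc.IH) auto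
    finally show ?case unfolding m(3) mon_eval_add mon_eval_single by simp
  qed
  have ev: "a u = eval_complex \<xi> u * a (l ^ Suc (Suc e))" if u: "u \<in> ?S" for u
  proof (rule linear_eq_on_span[of a])
    show "linear a" using a(1) by (simp add: ann_def)
    show "linear (\<lambda>u. eval_complex \<xi> u * a (l ^ Suc (Suc e)))"
      by (rule linearI) (auto simp: eval_complex_add eval_complex_scaleR distrib_right)
    show "u \<in> span (monomials n (Suc (Suc e)))" using u by (simp only: span_monomials)
    fix v assume "v \<in> monomials n (Suc (Suc e))"
    then obtain m where "m \<in> exponents n (Suc (Suc e))" "v = single m 1" by (auto simp: monomials_def)
    then show "a v = eval_complex \<xi> v * a (l ^ Suc (Suc e))"
      using am[of "Suc (Suc e)" m] by (simp add: eval_complex_single)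
  qed
  have nz: "a (l ^ Suc (Suc e)) \<noteq> 0" using ev a(2) by auto
  have "\<exists>i<n. \<xi> i \<noteq> 0"
  proof (rule ccontr)
    assume no: "\<not> (\<exists>i<n. \<xi> i \<noteq> 0)"
    have "eval_complex \<xi> u = 0" if u: "u \<in> ?S" for u
    proof (rule linear_eq_0_on_span[OF linear_eval_complex])
      show "u \<in> span (monomials n (Suc (Suc e)))" using u by (simp only: span_monomials)
      fix v assume "v \<in> monomials n (Suc (Suc e))"
      then obtain m where m: "m \<in> exponents n (Suc (Suc e))" "v = single m 1" by (auto simp: monomials_def)
      obtain i m' where "i < n" "m = single i 1 + m'" by (rule exponents_Suc_split[OF m(1)])
      then show "eval_complex \<xi> v = 0"
        using no unfolding m(2) eval_complex_single by (simp only: mon_eval_add mon_eval_single) auto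
    qed
    then show False using ev a(2) by auto
  qed
  moreover have "eval_complex \<xi> u = 0" if "u \<in> ?D" for u
    using ev[OF subsetD[OF D that]] annD[OF a(1) that] nz by simp
  ultimately show ?thesis using that by blast
qed

section \<open>Multiplication by spaces of small codimension\<close>

lemma dim_common_kernel:
  fixes \<phi> :: "'i \<Rightarrow> 'a::real_vector \<Rightarrow> real"
  assumes "finite I" "\<And>i. linear (\<phi> i)" "subspace S" "fin_span S"
  shows "dim S \<le> dim {s \<in> S. \<forall>i\<in>I. \<phi> i s = 0} + card I"
  using assms(1)
proof (induction I rule: finite_induct)
  case (insert i I)
  let ?K = "{s \<in> S. \<forall>i\<in>I. \<phi> i s = 0}"
  have "subspace ?K"
    using assms(2,3) by (auto simp: subspace_def linear_add linear_scale linear_0)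
  moreover have "fin_span ?K" by (rule fin_span_mono[OF assms(4)]) auto
  ultimately have "dim ?K \<le> dim {s \<in> ?K. \<phi> i s \<in> {0}} + dim (span ({0} \<union> \<phi> i ` ?K))"
    using dim_preimage[OF assms(2)[of i], of ?K "{0}"] fin_span_euclidean[of "{0::real}"] by simp
  also have "dim (span ({0} \<union> \<phi> i ` ?K)) \<le> 1"
    using dim_subset_UNIV[of "span ({0} \<union> \<phi> i ` ?K)"] by simp
  also have "{s \<in> ?K. \<phi> i s \<in> {0}} = {s \<in> S. \<forall>i\<in>insert i I. \<phi> i s = 0}" by auto
  finally show ?case using insert by simp
qed simp

section \<open>Base points and strict decrease of codimension\<close>

definition base_point_free :: "nat \<Rightarrow> mpoly set \<Rightarrow> bool" where
  "base_point_free n U \<longleftrightarrow> (\<forall>\<xi>. (\<exists>i<n. \<xi> i \<noteq> 0) \<longrightarrow> (\<exists>u\<in>U. eval_complex \<xi> u \<noteq> 0))"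

lemma base_point_free_mono: "base_point_free n U \<Longrightarrow> U \<subseteq> V \<Longrightarrow> base_point_free n V"
  unfolding base_point_free_def by blast

text \<open>At a given point, multiply a nonvanishing element of \<open>U\<close> by a power of a
  nonvanishing coordinate.\<close>

lemma base_point_free_pmul_forms:
  assumes "base_point_free n U"
  shows "base_point_free n (forms n i \<odot> U)"
  unfolding base_point_free_def
proof (intro allI impI)
  fix \<xi> :: "nat \<Rightarrow> complex" assume "\<exists>i<n. \<xi> i \<noteq> 0"
  then obtain j u where j: "j < n" "\<xi> j \<noteq> 0" and u: "u \<in> U" "eval_complex \<xi> u \<noteq> 0"
    using assms unfolding base_point_free_def by blast
  have "var j ^ i * u \<in> forms n i \<odot> U" using u(1) j(1) by (intro pmulI forms_power1 var_in_forms)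
  moreover have "eval_complex \<xi> (var j ^ i) = \<xi> j ^ i" for i
    by (induction i) (auto simp: eval_complex_mult var_def eval_complex_single mon_eval_def one_poly_mapping.rep_eq
        eval_complex_superset[of "{0}"])
  then have "eval_complex \<xi> (var j ^ i * u) \<noteq> 0" using j u by (simp add: eval_complex_mult)
  ultimately show "\<exists>u\<in>forms n i \<odot> U. eval_complex \<xi> u \<noteq> 0" by blast
qed

lemma codim_mult_linear_less:
  assumes A: "subspace A" "A \<subseteq> forms n (Suc e)" and l: "l \<in> forms n 1"
    and S: "forms n (Suc e) \<subseteq> span (A \<union> (\<lambda>s. l * s) ` forms n e)"
    and ne: "A \<noteq> forms n (Suc e)" and free: "base_point_free n (forms n 1 \<odot> A)"
  shows "dim (forms n (Suc (Suc e))) + dim A < dim (forms n 1 \<odot> A) + dim (forms n (Suc e))"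
proof (rule ccontr)
  assume "\<not> ?thesis"
  then have eq: "dim (forms n (Suc (Suc e))) + dim A = dim (forms n 1 \<odot> A) + dim (forms n (Suc e))"
    using codim_mult_linear_le[OF A l S] by linarith
  obtain \<xi> i where "i < n" "\<xi> i \<noteq> 0" "\<And>u. u \<in> forms n 1 \<odot> A \<Longrightarrow> eval_complex \<xi> u = 0"
    by (rule common_zero_exists[OF A l S eq ne]) (rule that)
  then show False using free unfolding base_point_free_def by blast
qed

text \<open>Freeness from base points survives multiplication by forms, so the strict decrease can
  be iterated until the product is everything.\<close>

lemma codim_mult_forms_decreasing:
  assumes A: "subspace A" "A \<subseteq> forms n (Suc e)" and l: "l \<in> forms n 1"
    and S: "forms n (Suc e) \<subseteq> span (A \<union> (\<lambda>s. l * s) ` forms n e)"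
    and free: "base_point_free n A"
  shows "forms n i \<odot> A = forms n (Suc (e + i)) \<or>
    dim (forms n (Suc (e + i))) + dim A + i \<le> dim (forms n i \<odot> A) + dim (forms n (Suc e))"
proof (induction i)
  case 0 then show ?case using pmul_forms_0[OF A(1)] by simp
next
  case (Suc i)
  let ?B = "forms n i \<odot> A"
  have BS: "forms n 1 \<odot> ?B = forms n (Suc i) \<odot> A"
    unfolding pmul_assoc[symmetric] forms_Suc[of n i, symmetric] ..
  show ?case
  proof (cases "?B = forms n (Suc (e + i))")
    case True
    then have "forms n (Suc i) \<odot> A = forms n 1 \<odot> forms n (Suc (e + i))" using BS by simp
    then show ?thesis unfolding forms_Suc[of n "Suc (e + i)", symmetric] by simp
  next
    case False
    have B: "?B \<subseteq> forms n (Suc (e + i))"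
      using pmul_mono[OF order_refl A(2), of "forms n i"] by (metis forms_add add_Suc add.commute)
    have "dim (forms n (Suc (Suc (e + i)))) + dim ?B < dim (forms n 1 \<odot> ?B) + dim (forms n (Suc (e + i)))"
      by (intro codim_mult_linear_less[OF _ B l] forms_hyperplane_add[OF A(2) l S] False
          base_point_free_pmul_forms free) simp
    then show ?thesis using Suc False unfolding BS by simp
  qed
qed

lemma le_choose_3: "r \<le> (r + 2) choose 3"
  by (induction r) (auto simp: numeral_3_eq_3)

context generic_hyperplane
begin

lemma forms_hyperplane_double:
  assumes f: "0 < f"
  shows "forms n (2 * f) \<subseteq> span (J \<odot> J \<union> (\<lambda>s. l * s) ` forms n (2 * f - 1))"
proof -
  let ?R = "span (J \<odot> J \<union> (\<lambda>s. l * s) ` forms n (2 * f - 1))"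
  have lR: "l * s \<in> ?R" if "s \<in> forms n (2 * f - 1)" for s
    by (intro span_base UnI2 imageI that)
  have "forms n f \<odot> forms n f \<subseteq> span (J \<union> (\<lambda>s. l * s) ` forms n (f - 1)) \<odot> span (J \<union> (\<lambda>s. l * s) ` forms n (f - 1))"
    by (intro pmul_mono forms_hyperplane f)
  also have "\<dots> = (J \<union> (\<lambda>s. l * s) ` forms n (f - 1)) \<odot> (J \<union> (\<lambda>s. l * s) ` forms n (f - 1))"
    by simp
  also have "\<dots> \<subseteq> ?R"
  proof (rule pmul_subsetI)
    fix a b assume a: "a \<in> J \<union> (\<lambda>s. l * s) ` forms n (f - 1)" and b: "b \<in> J \<union> (\<lambda>s. l * s) ` forms n (f - 1)"
    have sub: "J \<union> (\<lambda>s. l * s) ` forms n (f - 1) \<subseteq> forms n f"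
      using J(2) lmult_image_subspace[OF l, of "f - 1"] f by simp
    have e: "f - 1 + f = 2 * f - 1" using f by simp
    show "a * b \<in> ?R"
    proof (cases "a \<in> J \<and> b \<in> J")
      case True
      then show ?thesis by (intro span_base UnI1 pmulI) auto
    next
      case False
      then consider s where "s \<in> forms n (f - 1)" "a = l * s" | s where "s \<in> forms n (f - 1)" "b = l * s"
        using a b by blast
      then show ?thesis
      proof cases
        case 1
        then have "l * (s * b) \<in> ?R"
          using forms_mult[OF 1(1) subsetD[OF sub b]] unfolding e by (intro lR)
        then show ?thesis using 1 by (simp add: mult.assoc)
      next
        case 2
        then have "l * (s * a) \<in> ?R"
          using forms_mult[OF 2(1) subsetD[OF sub a]] unfolding e by (intro lR)
        then show ?thesis using 2 by (simp add: ac_simps)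
      qed
    qed
  qed simp
  finally show ?thesis unfolding forms_add[symmetric] mult_2[symmetric] .
qed

text \<open>Each degree step trades the rest outside the multiples of \<open>J \<odot> J\<close> for
  one more factor \<open>l\<close>. This brings degree \<open>d + f\<close> down to degree
  \<open>2 * f\<close>, where \<open>double_degree_decomposition\<close> applies.\<close>

lemma forms_add_double:
  assumes f: "0 < f"
  shows "forms n (2 * f + i) \<subseteq> span ((forms n i \<odot> (J \<odot> J)) \<union> (\<lambda>s. l ^ i * s) ` forms n (2 * f))"
proof (induction i)
  case 0
  have "(\<lambda>s. l ^ 0 * s) ` forms n (2 * f) = forms n (2 * f)" by simp
  then show ?case using subset_span_Un(2)[of "(\<lambda>s. l ^ 0 * s) ` forms n (2 * f)" "forms n 0 \<odot> (J \<odot> J)"]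
    by simp
next
  case (Suc i)
  let ?R = "span ((forms n (Suc i) \<odot> (J \<odot> J)) \<union> (\<lambda>s. l ^ Suc i * s) ` forms n (2 * f))"
  have JJ: "J \<odot> J \<subseteq> forms n (Suc (2 * f - 1))"
    using pmul_mono[OF J(2) J(2)] f unfolding forms_add[symmetric] by (simp add: mult_2)
  have e: "Suc (2 * f - 1) = 2 * f" "2 * f - 1 + Suc i = 2 * f + i"
    "Suc (2 * f - 1 + Suc i) = 2 * f + Suc i" using f by simp_all
  have "forms n (Suc (2 * f - 1 + Suc i))
      \<subseteq> span ((forms n (Suc i) \<odot> (J \<odot> J)) \<union> (\<lambda>s. l * s) ` forms n (2 * f - 1 + Suc i))"
    using forms_hyperplane_double[OF f] by (intro forms_hyperplane_add[OF JJ l]) (simp only: e(1))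
  also have "\<dots> \<subseteq> ?R"
  proof (intro span_minimal Un_least subspace_span)
    show "forms n (Suc i) \<odot> (J \<odot> J) \<subseteq> ?R" by (rule subset_span_Un)
    show "(\<lambda>s. l * s) ` forms n (2 * f - 1 + Suc i) \<subseteq> ?R"
    proof (intro image_subsetI)
      fix s assume "s \<in> forms n (2 * f - 1 + Suc i)"
      then have s: "s \<in> span ((forms n i \<odot> (J \<odot> J)) \<union> (\<lambda>s. l ^ i * s) ` forms n (2 * f))"
        using Suc unfolding e by blast
      show "l * s \<in> ?R"
      proof (rule span_mult_subset[OF subspace_span _ s])
        fix a assume a: "a \<in> (forms n i \<odot> (J \<odot> J)) \<union> (\<lambda>s. l ^ i * s) ` forms n (2 * f)"
        show "l * a \<in> ?R"
        proof (cases "a \<in> forms n i \<odot> (J \<odot> J)")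
          case True
          then have "l * a \<in> forms n 1 \<odot> (forms n i \<odot> (J \<odot> J))" by (intro pmulI l)
          then show ?thesis unfolding pmul_assoc[symmetric, of "forms n 1" "forms n i"] forms_Suc[of n i, symmetric]
            by (intro span_base UnI1)
        next
          case False
          then obtain t where t: "t \<in> forms n (2 * f)" "a = l ^ i * t" using a by blast
          then have "l * a = l ^ Suc i * t" by (simp add: mult.assoc)
          then show ?thesis using t(1) by (simp only: span_base UnI2 imageI)
        qed
      qed
    qed
  qed
  finally show ?case unfolding e(3) .
qed

text \<open>By \<open>JV\<close>, degree \<open>d + f\<close> reduces modulo
  \<open>J \<odot> V\<close> to \<open>l ^ (d - f)\<close> times degree \<open>2 * f\<close>. There
  the triple products cost the binomial. The products with linear forms in the colon space cost
  \<open>r * c\<close>: a subspace \<open>X\<close> of codimension at most \<open>r\<close>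
  multiplies everything into \<open>J \<odot> V\<close>.\<close>

lemma codim_product_bound:
  assumes f: "0 < f" "f < d" and V: "subspace V" "V \<subseteq> forms n d" and JV: "J \<odot> forms n (d - f) \<subseteq> V"
    and free: "base_point_free n V"
    and J0: "J \<noteq> forms n f"
    and dich: "\<And>s. s \<in> forms n 1 \<Longrightarrow> (\<forall>t\<in>forms n (f - 1). s * t \<in> J) \<or>
      forms n f \<subseteq> span (J \<union> (\<lambda>t. s * t) ` forms n (f - 1))"
  shows "dim (forms n (d + f)) \<le> dim (J \<odot> V) + (dim (forms n f) - dim J) * (dim (forms n d) - dim V)
    + ((dim (forms n f) - dim J + 2) choose 3)"
proof -
  define r where "r = dim (forms n f) - dim J"
  define c where "c = dim (forms n d) - dim V"
  have Jdim: "dim J \<le> dim (forms n f)" using J(2) span_superset by (intro dim_le_dim) auto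
  have Vdim: "dim V \<le> dim (forms n d)" using V(2) span_superset by (intro dim_le_dim) auto
  have fe: "Suc (f - 1) = f" using f by simp
  have hyp: "forms n (Suc (f - 1)) \<subseteq> span (J \<union> (\<lambda>s. l * s) ` forms n (f - 1))"
    using forms_hyperplane[OF f(1)] by (simp only: fe)
  have Jf: "J \<subseteq> forms n (Suc (f - 1))" using J(2) by (simp only: fe)
  have codimJ: "dim (forms n (f + i)) \<le> dim (forms n i \<odot> J) + r" for i
    using codim_mult_forms_le[OF J(1) Jf l hyp, of i] Jdim f by (simp add: r_def)
  show ?thesis
  proof (cases "c = 0")
    case True
    then have "V = forms n d" using V Vdim by (intro subspace_eq_of_dim_le) (auto simp: c_def)
    then show ?thesis using codimJ[of d] le_choose_3[of r] unfolding r_def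
      by (simp add: pmul_commute[of J] add.commute[of f])
  next
    case False
    have "V \<noteq> forms n d" using False by (auto simp: c_def)
    then obtain z where z: "z \<in> forms n d" "z \<notin> V" using V(2) by blast
    \<comment> \<open>Any functional that kills \<open>V\<close> without killing all forms of degree
      \<open>d\<close> would do; its role is to produce \<open>X\<close>.\<close>
    obtain \<alpha> :: "mpoly \<Rightarrow> real" where \<alpha>: "linear \<alpha>" "\<And>v. v \<in> V \<Longrightarrow> \<alpha> v = 0" "\<alpha> z = 1"
      by (rule functional_exists[OF V(1) z(2)]) (rule that)
    have e1: "d - 1 = f + (d - 1 - f)" "f - 1 + (d - f) = d - 1" "f + (d - f) = d" "Suc (d - 1 - f) = d - f"
      using f by simp_all
    define A where "A = forms n (d - 1 - f) \<odot> J"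
    have A: "A \<subseteq> forms n (d - 1)"
      unfolding A_def using pmul_mono[OF order_refl J(2)] e1(1) by (metis forms_add add.commute)
    have A1: "forms n 1 \<odot> A = J \<odot> forms n (d - f)"
      unfolding A_def pmul_assoc[symmetric] forms_Suc[symmetric] e1(4) by (rule pmul_commute)
    have codimA: "dim (forms n (d - 1)) \<le> dim A + r"
      using codimJ[of "d - 1 - f"] unfolding e1(1)[symmetric] A_def .
    obtain W where W: "finite W" "forms n (d - 1) \<subseteq> span (A \<union> W)" "card W + dim A = dim (forms n (d - 1))"
      using complement_exists[OF fin_span_forms A order_refl subset_span_Un(2)] by metis
    have Wr: "card W \<le> r" using W(3) codimA by linarith
    \<comment> \<open>As \<open>\<alpha>\<close> kills all linear multiples of \<open>A\<close>, the
      at most \<open>r\<close> conditions from \<open>W\<close> suffice for it to kill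
      \<open>x\<close> times every form of degree \<open>d - 1\<close>.\<close>
    define X where "X = {s \<in> forms n 1. \<forall>w\<in>W. \<alpha> (w * s) = 0}"
    have linw: "linear (\<lambda>s. \<alpha> (w * s))" for w
      using linear_compose[OF linear_mult_mpoly \<alpha>(1)] by (simp add: o_def)
    have Xdim: "dim (forms n 1) \<le> dim X + r"
      using dim_common_kernel[where \<phi> = "\<lambda>w s. \<alpha> (w * s)", OF W(1) linw subspace_forms fin_span_forms, of n 1] Wr
      unfolding X_def by linarith
    have X\<alpha>: "\<alpha> (x * t) = 0" if x: "x \<in> X" and t: "t \<in> forms n (d - 1)" for x t
    proof (rule linear_eq_0_on_span[OF linw])
      show "t \<in> span (A \<union> W)" using W(2) t by (rule subsetD)
      fix a assume "a \<in> A \<union> W"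
      then show "\<alpha> (x * a) = 0"
      proof
        assume a: "a \<in> A"
        have "x * a \<in> forms n 1 \<odot> A" using x a by (intro pmulI) (auto simp: X_def)
        then show ?thesis unfolding A1 using JV by (intro \<alpha>(2)) blast
      next
        assume "a \<in> W" then show ?thesis using x by (auto simp: X_def mult.commute)
      qed
    qed
    \<comment> \<open>Otherwise \<open>dich\<close> makes \<open>J\<close> and the multiples of
      \<open>x\<close> fill degree \<open>f\<close>. Multiplied up to degree \<open>d\<close>, both
      parts are killed by \<open>\<alpha>\<close>, which is impossible at \<open>z\<close>.\<close>
    have XJ: "x * t \<in> J" if x: "x \<in> X" and t: "t \<in> forms n (f - 1)" for x t
    proof (rule ccontr)
      assume nJ: "x * t \<notin> J"
      have "x \<in> forms n 1" using x by (simp add: X_def)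
      then have S: "forms n f \<subseteq> span (J \<union> (\<lambda>t. x * t) ` forms n (f - 1))" using dich t nJ by blast
      have "forms n (d - f) \<odot> (J \<union> (\<lambda>t. x * t) ` forms n (f - 1)) \<subseteq> {s \<in> UNIV. \<alpha> s \<in> {0}}"
      proof (intro pmul_subsetI subspace_preimage \<alpha>(1) subspace_UNIV)
        fix a b assume a: "a \<in> forms n (d - f)" and b: "b \<in> J \<union> (\<lambda>t. x * t) ` forms n (f - 1)"
        have "\<alpha> (a * b) = 0"
        proof (cases "b \<in> J")
          case True
          then have "b * a \<in> J \<odot> forms n (d - f)" using a by (intro pmulI)
          then show ?thesis using JV by (intro \<alpha>(2)) (auto simp: mult.commute)
        next
          case False
          then obtain t where t: "t \<in> forms n (f - 1)" "b = x * t" using b by blast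
          have "t * a \<in> forms n (d - 1)" using forms_mult[OF t(1) a] unfolding e1(2) .
          from X\<alpha>[OF x this] show ?thesis unfolding t(2) by (simp add: ac_simps)
        qed
        then show "a * b \<in> {s \<in> UNIV. \<alpha> s \<in> {0}}" by simp
      qed simp
      moreover have "forms n d \<subseteq> forms n (d - f) \<odot> span (J \<union> (\<lambda>t. x * t) ` forms n (f - 1))"
        using pmul_mono[OF order_refl S, of "forms n (d - f)"] f by (simp only: forms_add[symmetric]) simp
      ultimately have "\<alpha> z = 0" using z(1) unfolding pmul_span_right by auto
      then show False using \<alpha>(3) by simp
    qed
    have A_ne: "A \<noteq> forms n (d - 1)"
    proof
      assume "A = forms n (d - 1)"
      then have "forms n d \<subseteq> V" using A1 JV forms_Suc[of n "d - 1"] f by simp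
      then show False using z by blast
    qed
    have e2: "Suc (d - 2) = d - 1" "Suc (d - 1) = d" using f by simp_all
    have hypA: "forms n (d - 1) \<subseteq> span (A \<union> (\<lambda>s. l * s) ` forms n (d - 2))"
    proof -
      have "f - 1 + (d - 1 - f) = d - 2" using f by simp
      from forms_hyperplane_add[OF Jf l hyp, of "d - 1 - f", unfolded this] show ?thesis
        unfolding A_def e2 .
    qed
    have hypV: "forms n (Suc (d - 1)) \<subseteq> span (V \<union> (\<lambda>s. l * s) ` forms n (d - 1))"
    proof -
      have "forms n (Suc (d - 1)) \<subseteq> span ((J \<odot> forms n (d - f)) \<union> (\<lambda>s. l * s) ` forms n (d - 1))"
        using forms_hyperplane_add[OF Jf l hyp, of "d - f"] unfolding e1(2) pmul_commute[of J] .
      also have "\<dots> \<subseteq> span (V \<union> (\<lambda>s. l * s) ` forms n (d - 1))" by (intro span_mono Un_mono JV order_refl)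
      finally show ?thesis .
    qed
    \<comment> \<open>If \<open>c\<close> were at least \<open>r\<close>, then \<open>V\<close>
      would equal \<open>forms n 1 \<odot> A\<close>. By base point freeness its codimension is
      smaller than that of \<open>A\<close>, which is at most \<open>r\<close>.\<close>
    have cr: "c < r"
    proof (rule ccontr)
      assume "\<not> c < r"
      have le: "dim (forms n d) \<le> dim (J \<odot> forms n (d - f)) + r"
        using codimJ[of "d - f"] unfolding e1(3) pmul_commute[of J] .
      then have "dim V \<le> dim (J \<odot> forms n (d - f))"
        using \<open>\<not> c < r\<close> Vdim unfolding c_def by linarith
      then have VJ: "J \<odot> forms n (d - f) = V"
        by (intro subspace_eq_of_dim_le subspace_pmul JV fin_span_mono[OF fin_span_forms V(2)])
      have AS: "A \<subseteq> forms n (Suc (d - 2))" "forms n (Suc (d - 2)) \<subseteq> span (A \<union> (\<lambda>s. l * s) ` forms n (d - 2))"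
        "A \<noteq> forms n (Suc (d - 2))"
        unfolding e2 by (fact A hypA A_ne)+
      have "subspace A" by (simp add: A_def)
      from codim_mult_linear_less[OF this AS(1) l AS(2,3)] 
      have "dim (forms n d) + dim A < dim V + dim (forms n (d - 1))"
        unfolding e2 A1 VJ using free by simp
      then show False using codimA \<open>\<not> c < r\<close> Vdim unfolding c_def by linarith
    qed
    have V1: "V \<subseteq> forms n (Suc (d - 1))" using V(2) by (simp only: e2)
    \<comment> \<open>The codimension of \<open>V\<close> is at most r - 1 \<le> f - 1, so
      \<open>f - 1\<close> strict drops exhaust it.\<close>
    have full: "forms n (f - 1) \<odot> V = forms n (d + f - 1)"
    proof -
      have rf: "r \<le> f" using codim by (simp add: r_def)
      have e3: "Suc (d - 1 + (f - 1)) = d + f - 1" using f by simp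
      have sub: "forms n (f - 1) \<odot> V \<subseteq> forms n (d + f - 1)"
        using pmul_mono[OF order_refl V1, of "forms n (f - 1)"] e3
        by (metis forms_add add_Suc add.commute)
      have "dim (forms n (d + f - 1)) + dim V + (f - 1) \<le> dim (forms n (f - 1) \<odot> V) + dim (forms n d)
          \<Longrightarrow> forms n (f - 1) \<odot> V = forms n (d + f - 1)"
        using cr rf by (intro subspace_eq_of_dim_le sub) (auto simp: c_def)
      then show ?thesis
        using codim_mult_forms_decreasing[OF V(1) V1 l hypV free, of "f - 1"] unfolding e3 e2 by blast
    qed
    have XS: "x * s \<in> J \<odot> V" if x: "x \<in> X" and s: "s \<in> forms n (d + f - 1)" for x s
    proof -
      have "forms n (f - 1) \<odot> V \<subseteq> {s. x * s \<in> J \<odot> V}"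
      proof (intro pmul_subsetI subspace_mult_preimage subspace_pmul CollectI)
        fix a b assume "a \<in> forms n (f - 1)" "b \<in> V"
        then have "(x * a) * b \<in> J \<odot> V" using XJ[OF x] by (intro pmulI)
        then show "x * (a * b) \<in> J \<odot> V" by (simp add: mult.assoc)
      qed
      then show ?thesis using s unfolding full by blast
    qed
    define J1 where "J1 = {y \<in> forms n 1. l ^ (f - 1) * y \<in> J}"
    have J1S: "J1 \<subseteq> forms n 1" by (auto simp: J1_def)
    have XJ1: "X \<subseteq> J1"
    proof
      fix x assume x: "x \<in> X"
      have "x * l ^ (f - 1) \<in> J" by (intro XJ[OF x] forms_power1 l)
      then show "x \<in> J1" using x by (simp add: J1_def X_def mult.commute)
    qed
    obtain E where E: "finite E" "E \<subseteq> J1" "J1 \<subseteq> span (X \<union> E)" "card E + dim X = dim J1"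
      by (rule complement_exists[OF fin_span_mono[OF fin_span_forms J1S] XJ1 order_refl subset_span_Un(2)])
    have "dim J1 \<le> dim (forms n 1)" using J1S span_superset by (intro dim_le_dim) auto
    then have Er: "card E \<le> r" using E(4) Xdim by linarith
    have subX: "subspace X"
      using linw by (auto simp: X_def subspace_def linear_0 linear_add linear_scale distrib_left
          linear_add[OF \<alpha>(1)] linear_scale[OF \<alpha>(1)] linear_0[OF \<alpha>(1)]
          subspace_add[OF subspace_forms] subspace_scale[OF subspace_forms] subspace_0[OF subspace_forms])
    obtain W' where W': "finite W'" "forms n d \<subseteq> span (V \<union> W')" "card W' + dim V = dim (forms n d)"
      using complement_exists[OF fin_span_forms V(2) order_refl subset_span_Un(2)] by metis
    obtain Q where Q: "finite Q" "card Q \<le> (r + 2) choose 3"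
      "forms n (2 * f) \<subseteq> span (J \<odot> J \<union>
        {l ^ (f - 1) * y * s |y s. y \<in> forms n 1 \<and> l ^ (f - 1) * y \<in> J \<and> s \<in> forms n f} \<union> Q)"
      by (rule double_degree_decomposition[OF f(1), folded r_def])
    \<comment> \<open>In each product, \<open>e\<close> comes from the complement of
      \<open>X\<close> in \<open>J1\<close> and \<open>w\<close> from the complement of
      \<open>V\<close>; hence at most \<open>r * c\<close> generators.\<close>
    define P where "P = (\<lambda>(e, w). l ^ (f - 1) * e * w) ` (E \<times> W')"
    define Q' where "Q' = (\<lambda>q. l ^ (d - f) * q) ` Q"
    let ?R = "span (J \<odot> V \<union> (P \<union> Q'))"
    have JVR: "J \<odot> V \<subseteq> ?R" by (rule subset_span_Un)
    have PQ: "P \<union> Q' \<subseteq> ?R" by (rule subset_span_Un)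
    have lp: "l ^ (d - f) * j \<in> V" if "j \<in> J" for j
      using JV pmulI[OF that forms_power1[OF l, of "d - f"]] by (auto simp: mult.commute)
    have y: "l ^ (d - f) * (l ^ (f - 1) * y * s) \<in> ?R" if y: "y \<in> J1" and s: "s \<in> forms n f" for y s
    proof -
      obtain x e where xe: "x \<in> X" "e \<in> span E" "y = x + e"
        using mem_span_UnD[OF subsetD[OF E(3) y] subX] .
      have ls: "l ^ (d - f) * s \<in> forms n d" using forms_mult[OF forms_power1[OF l, of "d - f"] s] f by simp
      have "l ^ (f - 1) * (l ^ (d - f) * s) \<in> forms n (d + f - 1)"
        using forms_mult[OF forms_power1[OF l, of "f - 1"] ls] f by (simp add: add.commute)
      from XS[OF xe(1) this] have 1: "l ^ (d - f) * (l ^ (f - 1) * x * s) \<in> ?R"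
        using JVR by (auto simp: ac_simps)
      have "(l ^ (d - f) * l ^ (f - 1) * s) * e \<in> ?R"
      proof (rule span_mult_subset[OF subspace_span _ xe(2)])
        fix e assume e: "e \<in> E"
        have eJ: "l ^ (f - 1) * e \<in> J" using e E(2) by (auto simp: J1_def)
        have "(l ^ (f - 1) * e) * (l ^ (d - f) * s) \<in> ?R"
        proof (rule span_mult_subset[OF subspace_span])
          show "l ^ (d - f) * s \<in> span (V \<union> W')" using W'(2) ls by (rule subsetD)
          fix a assume "a \<in> V \<union> W'"
          then show "(l ^ (f - 1) * e) * a \<in> ?R"
          proof
            assume "a \<in> V" then show ?thesis using JVR pmulI[OF eJ] by blast
          next
            assume "a \<in> W'" then show ?thesis using PQ e unfolding P_def by force
          qed
        qed
        then show "(l ^ (d - f) * l ^ (f - 1) * s) * e \<in> ?R" by (simp add: ac_simps)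
      qed
      then have 2: "l ^ (d - f) * (l ^ (f - 1) * e * s) \<in> ?R" by (simp add: ac_simps)
      have "l ^ (d - f) * (l ^ (f - 1) * y * s)
          = l ^ (d - f) * (l ^ (f - 1) * x * s) + l ^ (d - f) * (l ^ (f - 1) * e * s)"
        unfolding xe(3) by (simp only: distrib_left distrib_right)
      then show ?thesis using span_add[OF 1 2] by simp
    qed
    have l2: "l ^ (d - f) * s \<in> ?R" if s: "s \<in> forms n (2 * f)" for s
    proof (rule span_mult_subset[OF subspace_span _ subsetD[OF Q(3) s]])
      have JJ: "J \<odot> J \<subseteq> {s. l ^ (d - f) * s \<in> J \<odot> V}"
      proof (intro pmul_subsetI subspace_mult_preimage subspace_pmul CollectI)
        fix a b assume "a \<in> J" "b \<in> J"
        then have "a * (l ^ (d - f) * b) \<in> J \<odot> V" using lp by (intro pmulI)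
        then show "l ^ (d - f) * (a * b) \<in> J \<odot> V" by (simp add: mult.left_commute)
      qed
      fix a assume "a \<in> J \<odot> J \<union>
        {l ^ (f - 1) * y * s |y s. y \<in> forms n 1 \<and> l ^ (f - 1) * y \<in> J \<and> s \<in> forms n f} \<union> Q"
      then consider "a \<in> J \<odot> J" | y s where "a = l ^ (f - 1) * y * s" "y \<in> J1" "s \<in> forms n f" | "a \<in> Q"
        unfolding J1_def by blast
      then show "l ^ (d - f) * a \<in> ?R"
      proof cases
        case 1 then show ?thesis using JJ JVR by blast
      next
        case 2 then show ?thesis using y by simp
      next
        case 3 then show ?thesis using PQ unfolding Q'_def by blast
      qed
    qed
    have "forms n (d + f) \<subseteq> ?R"
    proof -
      have "forms n (d + f) \<subseteq> span ((forms n (d - f) \<odot> (J \<odot> J)) \<union> (\<lambda>s. l ^ (d - f) * s) ` forms n (2 * f))"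
        using forms_add_double[OF f(1), of "d - f"] f by (simp add: mult_2 add.commute)
      also have "\<dots> \<subseteq> ?R"
      proof (intro span_minimal Un_least subspace_span)
        have "forms n (d - f) \<odot> (J \<odot> J) = J \<odot> (J \<odot> forms n (d - f))"
          by (metis pmul_assoc pmul_commute)
        also have "\<dots> \<subseteq> J \<odot> V" by (intro pmul_mono JV order_refl)
        finally show "forms n (d - f) \<odot> (J \<odot> J) \<subseteq> ?R" using JVR by (rule order_trans)
        show "(\<lambda>s. l ^ (d - f) * s) ` forms n (2 * f) \<subseteq> ?R" using l2 by (rule image_subsetI)
      qed
      finally show ?thesis .
    qed
    moreover have finPQ: "finite (P \<union> Q')" using E(1) W'(1) Q(1) by (simp add: P_def Q'_def)
    moreover have "J \<odot> V \<subseteq> forms n (f + d)" unfolding forms_add by (intro pmul_mono J V)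
    ultimately have "dim (forms n (d + f)) \<le> dim (J \<odot> V) + card (P \<union> Q')"
      by (intro dim_le_add_card fin_span_mono[OF fin_span_forms])
    also have "card (P \<union> Q') \<le> card P + card Q'" by (rule card_Un_le)
    also have "card Q' \<le> (r + 2) choose 3" unfolding Q'_def using card_image_le[OF Q(1)] Q(2) by (rule order_trans)
    also have "card P \<le> card (E \<times> W')" unfolding P_def using E(1) W'(1) by (intro card_image_le) simp
    also have "\<dots> \<le> r * c"
      unfolding card_cartesian_product using W'(3) by (intro mult_le_mono Er) (simp add: c_def)
    finally show ?thesis unfolding r_def c_def by simp
  qed
qed

end

section \<open>The square of a subspace of small codimension\<close>

lemma choose_2_eq: "2 * (Suc m choose 2) = m * (m + 1)"
  by (induction m) (auto simp: numeral_2_eq_2)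

lemma choose_3_eq: "6 * ((m + 2) choose 3) = m * (m + 1) * (m + 2)"
proof (induction m)
  case (Suc m)
  have "(Suc m + 2) choose 3 = ((m + 2) choose 3) + (Suc (Suc m) choose 2)"
    by (simp add: numeral_3_eq_3 numeral_2_eq_2)
  then show ?case using Suc choose_2_eq[of "Suc m"] by (simp add: algebra_simps)
qed simp

lemma choose_2_step:
  assumes "c < m"
  shows "(Suc c choose 2) + m \<le> Suc m choose 2"
proof -
  obtain p where "m = Suc (c + p)" using assms less_imp_Suc_add by blast
  then have "2 * (Suc c choose 2) + 2 * m \<le> 2 * (Suc m choose 2)"
    unfolding choose_2_eq by (simp add: algebra_simps)
  then show ?thesis by simp
qed

text \<open>Six times the difference of the sides is 3 (c - r) (c - r + 1) plus terms that are
  nonnegative because r \<ge> 1. A product of two consecutive integers is nonnegative, whatever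
  their sign.\<close>

lemma codim_bound_step:
  assumes "1 \<le> r" "r \<le> k"
  shows "(k - r)^2 + ((k - r + 2) choose 3) + (Suc k choose 2) + r * c + ((r + 2) choose 3)
    \<le> k^2 + ((k + 2) choose 3) + (Suc c choose 2)"
proof -
  define a where "a = k - r"
  have k: "k = a + r" using assms by (simp add: a_def)
  define A R C where "A = int a" and "R = int r" and "C = int c"
  have nn: "A \<ge> 0" "R \<ge> 1" using assms by (auto simp: A_def R_def)
  have "0 \<le> (C - R) * (C - R + 1)"
    by (cases "C - R \<ge> 0") (auto intro: mult_nonneg_nonneg mult_nonpos_nonpos)
  moreover have "0 \<le> (R - 1) * (A * A)" "0 \<le> (R - 1) * A" "0 \<le> A * R * R" "0 \<le> A * R"
    using nn by auto
  ultimately have "6 * A^2 + A * (A + 1) * (A + 2) + 3 * ((A + R) * (A + R + 1)) + 6 * (R * C) + R * (R + 1) * (R + 2)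
      \<le> 6 * (A + R)^2 + (A + R) * (A + R + 1) * (A + R + 2) + 3 * (C * (C + 1))"
    by (simp add: algebra_simps power2_eq_square)
  then have "int (6 * a^2 + a * (a + 1) * (a + 2) + 3 * (k * (k + 1)) + 6 * (r * c) + r * (r + 1) * (r + 2))
      \<le> int (6 * k^2 + k * (k + 1) * (k + 2) + 3 * (c * (c + 1)))"
    unfolding k A_def R_def C_def
    by (simp only: of_nat_add of_nat_mult of_nat_power of_nat_numeral of_nat_1)
  then have "6 * a^2 + a * (a + 1) * (a + 2) + 3 * (k * (k + 1)) + 6 * (r * c) + r * (r + 1) * (r + 2)
      \<le> 6 * k^2 + k * (k + 1) * (k + 2) + 3 * (c * (c + 1))"
    by (simp only: of_nat_le_iff)
  then have "6 * (a^2 + ((a + 2) choose 3) + (Suc k choose 2) + r * c + ((r + 2) choose 3))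
      \<le> 6 * (k^2 + ((k + 2) choose 3) + (Suc c choose 2))"
    unfolding choose_3_eq[symmetric] unfolding choose_2_eq[symmetric] by (simp add: distrib_left)
  then show ?thesis unfolding a_def nat_mult_le_cancel_disj by simp
qed

text \<open>Products of \<open>J\<close> with \<open>g * s\<close> are multiples of \<open>g\<close>
  by forms of degree \<open>d\<close>. Since \<open>g\<close> is in \<open>J\<close>, multiples by
  elements of \<open>V\<close> are already in \<open>J \<odot> V\<close>, so only a complement of
  \<open>V\<close> contributes.\<close>

lemma dim_pmul_adjoin_le:
  assumes J: "J \<subseteq> forms n f" and f: "f \<le> d" and V: "V \<subseteq> forms n d" and g: "g \<in> J"
  shows "dim (J \<odot> span (V \<union> (\<lambda>s. g * s) ` forms n (d - f))) \<le> dim (J \<odot> V) + (dim (forms n d) - dim V)"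
proof -
  obtain W where W: "finite W" "forms n d \<subseteq> span (V \<union> W)" "card W + dim V = dim (forms n d)"
    using complement_exists[OF fin_span_forms V order_refl subset_span_Un(2)] by metis
  let ?R = "span (J \<odot> V \<union> (\<lambda>w. g * w) ` W)"
  have gR: "g * s \<in> ?R" if "s \<in> forms n d" for s
  proof (rule span_mult_subset[OF subspace_span _ subsetD[OF W(2) that]])
    fix a assume "a \<in> V \<union> W"
    then show "g * a \<in> ?R"
      using pmulI[OF g, of a V] by (auto intro!: span_base)
  qed
  have "J \<odot> (V \<union> (\<lambda>s. g * s) ` forms n (d - f)) \<subseteq> ?R"
  proof (rule pmul_subsetI)
    fix a b assume a: "a \<in> J" and b: "b \<in> V \<union> (\<lambda>s. g * s) ` forms n (d - f)"
    show "a * b \<in> ?R"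
    proof (cases "b \<in> V")
      case True
      then show ?thesis using a by (intro span_base UnI1 pmulI)
    next
      case False
      then obtain s where s: "s \<in> forms n (d - f)" "b = g * s" using b by blast
      have "a * s \<in> forms n d" using forms_mult[OF subsetD[OF J a] s(1)] f by simp
      from gR[OF this] show ?thesis by (simp add: s(2) mult.left_commute)
    qed
  qed simp
  moreover have "J \<odot> V \<subseteq> forms n (f + d)" unfolding forms_add by (intro pmul_mono J V)
  ultimately have "dim (J \<odot> span (V \<union> (\<lambda>s. g * s) ` forms n (d - f))) \<le> dim (J \<odot> V) + card ((\<lambda>w. g * w) ` W)"
    using W(1) by (intro dim_le_add_card fin_span_mono[OF fin_span_forms]) auto
  also have "card ((\<lambda>w. g * w) ` W) \<le> card W" using W(1) by (rule card_image_le)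
  finally show ?thesis using W(3) by simp
qed

text \<open>Adjoining the multiples of one \<open>g\<close> at a time costs the current codimension,
  which strictly drops. The costs are therefore distinct numbers above the codimension of
  \<open>C\<close> and up to that of \<open>V\<close>; all such numbers add up to the difference of
  the binomials.\<close>

lemma dim_pmul_saturate_le:
  assumes J: "J \<subseteq> forms n f" and f: "f \<le> d" and V: "subspace V" "V \<subseteq> forms n d"
    and C: "C = span (V \<union> (J \<odot> forms n (d - f)))"
  shows "dim (J \<odot> C) + (Suc (dim (forms n d) - dim C) choose 2)
    \<le> dim (J \<odot> V) + (Suc (dim (forms n d) - dim V) choose 2)"
  using V C
proof (induction "dim (forms n d) - dim V" arbitrary: V rule: less_induct)
  case less
  show ?case
  proof (cases "J \<odot> forms n (d - f) \<subseteq> V")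
    case True
    then have "V \<union> (J \<odot> forms n (d - f)) = V" by blast
    then have "C = V" using less.prems(1,3) by (simp add: span_eq_iff[THEN iffD2])
    then show ?thesis by simp
  next
    case False
    then have "\<not> (\<forall>g\<in>J. \<forall>s\<in>forms n (d - f). g * s \<in> V)"
      using pmul_subsetI[OF less.prems(1)] by blast
    then obtain g s where g: "g \<in> J" "s \<in> forms n (d - f)" "g * s \<notin> V" by blast
    define V' where "V' = span (V \<union> (\<lambda>s. g * s) ` forms n (d - f))"
    have gJ: "(\<lambda>s. g * s) ` forms n (d - f) \<subseteq> J \<odot> forms n (d - f)"
      using pmulI[OF g(1)] by (rule image_subsetI)
    have JS: "J \<odot> forms n (d - f) \<subseteq> forms n d"
      using pmul_mono[OF J order_refl, of "forms n (d - f)"] f unfolding forms_add[symmetric] by simp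
    have VV': "V \<subseteq> V'" unfolding V'_def by (rule subset_span_Un)
    have V'S: "V' \<subseteq> forms n d"
      unfolding V'_def using less.prems(2) gJ JS by (intro span_minimal Un_least) auto
    have "g * s \<in> V'" unfolding V'_def using g(2) by (intro span_base UnI2 imageI)
    then have "V \<noteq> V'" using g(3) by blast
    then have dV: "dim V < dim V'"
      using subspace_eq_of_dim_le[OF less.prems(1) VV' fin_span_mono[OF fin_span_forms V'S]] by (meson not_less)
    have dV': "dim V' \<le> dim (forms n d)"
      by (intro dim_le_dim fin_span_forms order_trans[OF V'S span_superset])
    have "span (V' \<union> (J \<odot> forms n (d - f))) = C"
      unfolding less.prems(3)
    proof (rule equalityI; intro span_minimal Un_least subspace_span)
      show "V' \<subseteq> span (V \<union> (J \<odot> forms n (d - f)))"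
        unfolding V'_def by (intro span_mono Un_mono gJ order_refl)
      show "V \<subseteq> span (V' \<union> (J \<odot> forms n (d - f)))"
        using VV' subset_span_Un(1) by (rule order_trans)
    qed (rule subset_span_Un)+
    then have "dim (J \<odot> C) + (Suc (dim (forms n d) - dim C) choose 2)
        \<le> dim (J \<odot> V') + (Suc (dim (forms n d) - dim V') choose 2)"
      using dV dV' V'S by (intro less.hyps) (auto simp: V'_def)
    also have "dim (J \<odot> V') \<le> dim (J \<odot> V) + (dim (forms n d) - dim V)"
      unfolding V'_def by (rule dim_pmul_adjoin_le[OF J f less.prems(2) g(1)])
    finally show ?thesis
      using choose_2_step[of "dim (forms n d) - dim V'" "dim (forms n d) - dim V"] dV dV' by linarith
  qed
qed

lemma dim_square_le:
  assumes U: "subspace U" "U \<subseteq> forms n d" and g: "g \<in> forms n (d - f)" and f: "f \<le> d"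
    and J: "J = {s \<in> forms n f. g * s \<in> U}" and Ug: "Ug = span (U \<union> (\<lambda>s. g * s) ` forms n f)"
  shows "dim (Ug \<odot> Ug) + dim (J \<odot> U) \<le> dim (U \<odot> U) + dim (forms n (d + f))"
proof -
  have JU: "J \<odot> U \<subseteq> forms n (d + f)"
    unfolding pmul_commute[of J] forms_add by (intro pmul_mono U) (auto simp: J)
  obtain R where R: "finite R" "forms n (d + f) \<subseteq> span ((J \<odot> U) \<union> R)" "card R + dim (J \<odot> U) = dim (forms n (d + f))"
    using complement_exists[OF fin_span_forms JU order_refl subset_span_Un(2)] by metis
  let ?R = "span ((U \<odot> U) \<union> (\<lambda>r. g * r) ` R)"
  have gJU: "J \<odot> U \<subseteq> {s. g * s \<in> U \<odot> U}"
  proof (intro pmul_subsetI subspace_mult_preimage subspace_pmul CollectI)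
    fix a b assume "a \<in> J" "b \<in> U"
    then have "(g * a) * b \<in> U \<odot> U" by (intro pmulI) (auto simp: J)
    then show "g * (a * b) \<in> U \<odot> U" by (simp add: mult.assoc)
  qed
  have gR: "g * s \<in> ?R" if "s \<in> forms n (d + f)" for s
  proof (rule span_mult_subset[OF subspace_span _ subsetD[OF R(2) that]])
    fix a assume "a \<in> (J \<odot> U) \<union> R"
    then show "g * a \<in> ?R" using gJU by (auto intro!: span_base)
  qed
  have gS: "(\<lambda>s. g * s) ` forms n f \<subseteq> forms n d"
    using forms_mult[OF g, of _ f] f by auto
  let ?X = "U \<union> (\<lambda>s. g * s) ` forms n f"
  have "?X \<odot> ?X \<subseteq> ?R"
  proof (rule pmul_subsetI)
    have key: "a * b \<in> ?R" if "a \<in> (\<lambda>s. g * s) ` forms n f" "b \<in> forms n d" for a b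
    proof -
      from that(1) obtain s where s: "s \<in> forms n f" "a = g * s" by blast
      have "b * s \<in> forms n (d + f)" by (intro forms_mult that(2) s(1))
      from gR[OF this] show ?thesis by (simp add: s(2) ac_simps)
    qed
    fix a b assume a: "a \<in> ?X" and b: "b \<in> ?X"
    have abd: "a \<in> forms n d" "b \<in> forms n d" using a b gS U(2) by auto
    consider "a \<in> U" "b \<in> U" | "a \<in> (\<lambda>s. g * s) ` forms n f" | "b \<in> (\<lambda>s. g * s) ` forms n f"
      using a b by blast
    then show "a * b \<in> ?R"
    proof cases
      case 1 then show ?thesis by (intro span_base UnI1 pmulI)
    next
      case 2 then show ?thesis using key abd by blast
    next
      case 3 then show ?thesis using key[of b a] abd by (simp add: mult.commute)
    qed
  qed simp
  then have "Ug \<odot> Ug \<subseteq> ?R" unfolding Ug by simp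
  moreover have "U \<odot> U \<subseteq> forms n (d + d)" unfolding forms_add by (intro pmul_mono U)
  ultimately have "dim (Ug \<odot> Ug) \<le> dim (U \<odot> U) + card ((\<lambda>r. g * r) ` R)"
    using R(1) by (intro dim_le_add_card fin_span_mono[OF fin_span_forms]) auto
  also have "card ((\<lambda>r. g * r) ` R) \<le> card R" using R(1) by (rule card_image_le)
  finally show ?thesis using R(3) by linarith
qed

lemma codim_square_bound:
  assumes U: "subspace U" "U \<subseteq> forms n d" "dim U + k = dim (forms n d)" and kd: "k < d"
    and free: "base_point_free n U"
  shows "dim (forms n (2 * d)) \<le> dim (U \<odot> U) + k^2 + ((k + 2) choose 3)"
  using U kd free
proof (induction k arbitrary: U rule: less_induct)
  case (less k)
  note U = less.prems(1-3) and kd = less.prems(4) and free = less.prems(5)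
  show ?case
  proof (cases "k = 0")
    case True
    then have "U = forms n d" using U by (intro subspace_eq_of_dim_le fin_span_forms) auto
    then show ?thesis unfolding mult_2 forms_add by simp
  next
    case False
    define colon where "colon f g = {s \<in> forms n f. g * s \<in> U}" for f g
    have sub_colon: "subspace (colon f g)" for f g
      unfolding colon_def by (intro subspace_preimage linear_mult_mpoly U subspace_forms)
    have colon_S: "colon f g \<subseteq> forms n f" for f g by (auto simp: colon_def)
    have colon_dim: "dim (colon f g) + dim (span (U \<union> (\<lambda>s. g * s) ` forms n f)) = dim (forms n f) + dim U" for f g
      unfolding colon_def
      by (intro dim_preimage linear_mult_mpoly U fin_span_mono[OF fin_span_forms U(2)]) auto
    have Ug: "span (U \<union> (\<lambda>s. g * s) ` forms n f) \<subseteq> forms n d" if "f \<le> d" "g \<in> forms n (d - f)" for f g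
      using forms_mult[OF that(2), of _ f] that(1) U(2) by (intro span_minimal) auto
    have codim_le: "dim (forms n f) \<le> dim (colon f g) + k" if "f \<le> d" "g \<in> forms n (d - f)" for f g
    proof -
      have "dim (span (U \<union> (\<lambda>s. g * s) ` forms n f)) \<le> dim (forms n d)"
        by (intro dim_le_dim fin_span_forms order_trans[OF Ug[OF that] span_superset])
      then show ?thesis using colon_dim[of f g] U(3) by linarith
    qed
    \<comment> \<open>The condition \<open>r \<le> f\<close> is the assumption \<open>codim\<close>
      of the generic flag.\<close>
    define P where "P r \<longleftrightarrow> (\<exists>f g. 0 < f \<and> f < d \<and> g \<in> forms n (d - f) \<and>
      dim (forms n f) = dim (colon f g) + r \<and> 1 \<le> r \<and> r \<le> f)" for r
    \<comment> \<open>Take \<open>f = d - 1\<close> and a linear \<open>g\<close> that does not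
      multiply everything into \<open>U\<close>; the colon space then has codimension at most
      \<open>k\<close>, hence at most \<open>f\<close>.\<close>
    have ex: "\<exists>r. P r"
    proof -
      have "forms n d = forms n 1 \<odot> forms n (d - 1)" using forms_Suc[of n "d - 1"] kd by simp
      moreover have "U \<noteq> forms n d" using U(3) False by auto
      ultimately have "\<not> (forms n 1 \<odot> forms n (d - 1) \<subseteq> U)" using U(2) by blast
      then have "\<not> (\<forall>g\<in>forms n 1. \<forall>s\<in>forms n (d - 1). g * s \<in> U)"
        using pmul_subsetI[OF U(1)] by blast
      then obtain g s where g: "g \<in> forms n 1" "s \<in> forms n (d - 1)" "g * s \<notin> U" by blast
      have g1: "g \<in> forms n (d - (d - 1))" using g(1) kd False by simp
      have "colon (d - 1) g \<noteq> forms n (d - 1)" using g by (auto simp: colon_def)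
      then have "dim (colon (d - 1) g) < dim (forms n (d - 1))"
        using subspace_eq_of_dim_le[OF sub_colon colon_S fin_span_forms] by (meson not_less)
      moreover have "dim (forms n (d - 1)) \<le> dim (colon (d - 1) g) + k" by (rule codim_le[OF _ g1]) simp
      ultimately have "P (dim (forms n (d - 1)) - dim (colon (d - 1) g))"
        unfolding P_def using g1 kd False by (intro exI[of _ "d - 1"] exI[of _ g]) auto
      then show ?thesis by blast
    qed
    define r where "r = (LEAST r. P r)"
    have "P r" unfolding r_def using ex by (rule LeastI_ex)
    then obtain f g where fg: "0 < f" "f < d" "g \<in> forms n (d - f)" "dim (forms n f) = dim (colon f g) + r"
      "1 \<le> r" "r \<le> f" unfolding P_def by blast
    have minimal: "r \<le> r'" if "P r'" for r' unfolding r_def using that by (rule Least_le)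
    define J where "J = colon f g"
    have fd: "f \<le> d" using fg(2) by simp
    have J: "subspace J" "J \<subseteq> forms n f" unfolding J_def by (rule sub_colon colon_S)+
    obtain l where l: "l \<in> forms n 1"
      "\<And>j s x. Suc j \<le> f \<Longrightarrow> s \<in> forms n j \<Longrightarrow> l ^ (f - j) * s \<in> J \<Longrightarrow> x \<in> forms n 1
      \<Longrightarrow> l ^ (f - Suc j) * (x * s) \<in> flag n f J l j"
      by (rule generic_linear_form_exists[OF J(2)]) (rule that)
    interpret generic_hyperplane n f J l
      using J l fg(4,6) by unfold_locales (auto simp: J_def)
    \<comment> \<open>The codimension of \<open>colon (f - 1) (g * s)\<close> is
      \<open>dim ?T - dim J\<close>. If it is positive and \<open>?T\<close> is not everything, it
      is below \<open>r\<close> and at most \<open>f - 1\<close>, so \<open>f - 1\<close> and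
      \<open>g * s\<close> contradict the minimality of \<open>r\<close>.\<close>
    have dich: "(\<forall>t\<in>forms n (f - 1). s * t \<in> J) \<or> forms n f \<subseteq> span (J \<union> (\<lambda>t. s * t) ` forms n (f - 1))"
      if s: "s \<in> forms n 1" for s
    proof (cases "\<forall>t\<in>forms n (f - 1). s * t \<in> J")
      case False
      have Jeq: "{t \<in> forms n (f - 1). s * t \<in> J} = colon (f - 1) (g * s)"
        using forms_mult[OF s, of _ "f - 1"] fg(1) by (auto simp: J_def colon_def mult.assoc)
      let ?T = "span (J \<union> (\<lambda>t. s * t) ` forms n (f - 1))"
      have T: "?T \<subseteq> forms n f"
        using forms_mult[OF s, of _ "f - 1"] fg(1) J(2) by (intro span_minimal) auto
      have dT: "dim ?T \<le> dim (forms n f)"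
        by (intro dim_le_dim fin_span_forms order_trans[OF T span_superset])
      have eq: "dim (colon (f - 1) (g * s)) + dim ?T = dim (forms n (f - 1)) + dim J"
        unfolding Jeq[symmetric]
        by (intro dim_preimage linear_mult_mpoly J subspace_forms fin_span_forms fin_span_mono[OF fin_span_forms J(2)])
      have "colon (f - 1) (g * s) \<noteq> forms n (f - 1)" using False unfolding Jeq[symmetric] by blast
      then have lt: "dim (colon (f - 1) (g * s)) < dim (forms n (f - 1))"
        using subspace_eq_of_dim_le[OF sub_colon colon_S fin_span_forms] by (meson not_less)
      have "dim (forms n f) \<le> dim ?T"
      proof (rule ccontr)
        assume "\<not> ?thesis"
        then have less: "dim (forms n (f - 1)) - dim (colon (f - 1) (g * s)) < r"
          using eq fg(4) lt unfolding J_def by linarith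
        have "g * s \<in> forms n (d - (f - 1))"
          using forms_mult[OF fg(3) s] fg(1,2) by (simp add: Suc_diff_le)
        then have "P (dim (forms n (f - 1)) - dim (colon (f - 1) (g * s)))"
          unfolding P_def using lt less fg(1,2,6)
          by (intro exI[of _ "f - 1"] exI[of _ "g * s"]) auto
        then show False using minimal less by fastforce
      qed
      then have "?T = forms n f" using T by (intro subspace_eq_of_dim_le fin_span_forms subspace_span)
      then show ?thesis by simp
    qed simp
    define V where "V = span (U \<union> (J \<odot> forms n (d - f)))"
    have V: "subspace V" "J \<odot> forms n (d - f) \<subseteq> V" "U \<subseteq> V"
      unfolding V_def by (simp, (rule subset_span_Un)+)
    have VS: "V \<subseteq> forms n d"
    proof -
      have "J \<odot> forms n (d - f) \<subseteq> forms n d"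
        using pmul_mono[OF J(2) order_refl, of "forms n (d - f)"] fd unfolding forms_add[symmetric] by simp
      then show ?thesis unfolding V_def using U(2) by (intro span_minimal Un_least) auto
    qed
    define c where "c = dim (forms n d) - dim V"
    have "J \<noteq> forms n f" using fg(4,5) by (auto simp: J_def)
    from codim_product_bound[OF fg(1,2) V(1) VS V(2) base_point_free_mono[OF free V(3)] this dich]
    have 1: "dim (forms n (d + f)) \<le> dim (J \<odot> V) + r * c + ((r + 2) choose 3)"
      using fg(4) unfolding J_def c_def by simp
    have 2: "dim (J \<odot> V) + (Suc c choose 2) \<le> dim (J \<odot> U) + (Suc k choose 2)"
    proof -
      have "dim (forms n d) - dim U = k" using U(3) by linarith
      with dim_pmul_saturate_le[OF J(2) fd U(1,2) V_def] show ?thesis unfolding c_def by simp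
    qed
    define Ug where "Ug = span (U \<union> (\<lambda>s. g * s) ` forms n f)"
    have 3: "dim (Ug \<odot> Ug) + dim (J \<odot> U) \<le> dim (U \<odot> U) + dim (forms n (d + f))"
      by (rule dim_square_le[OF U(1,2) fg(3) fd _ Ug_def]) (simp add: J_def colon_def)
    have rk: "r \<le> k" using codim_le[OF fd fg(3)] fg(4) by simp
    have dUg: "dim Ug = dim U + r" using colon_dim[of f g] fg(4) unfolding Ug_def by linarith
    have "U \<subseteq> Ug" unfolding Ug_def by (rule subset_span_Un)
    then have "base_point_free n Ug" by (rule base_point_free_mono[OF free])
    then have 4: "dim (forms n (2 * d)) \<le> dim (Ug \<odot> Ug) + (k - r)^2 + ((k - r + 2) choose 3)"
      using fg(5) rk kd dUg U(3) Ug[OF fd fg(3)]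
      by (intro less.IH) (auto simp: Ug_def)
    show ?thesis using 1 2 3 4 codim_bound_step[OF fg(5) rk, of c] by linarith
  qed
qed

section \<open>Faces of Gram spectrahedra\<close>

lemma partial_deriv_superset:
  "finite A \<Longrightarrow> keys p \<subseteq> A \<Longrightarrow>
    partial_deriv i p = (\<Sum>m\<in>A. single (m - single i 1) (real (lookup m i) * lookup p m))"
  unfolding partial_deriv_def by (rule sum.mono_neutral_left) (auto simp: in_keys_iff)

lemma linear_partial_deriv: "linear (partial_deriv i)"
proof (rule linearI)
  fix p q :: mpoly
  show "partial_deriv i (p + q) = partial_deriv i p + partial_deriv i q"
    using keys_add[of p q]
    by (simp add: partial_deriv_superset[of "keys p \<union> keys q"] lookup_add distrib_left single_add sum.distrib)
next
  fix c :: real and p :: mpoly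
  have "keys (c *\<^sub>R p) \<subseteq> keys p" by (auto simp: in_keys_iff)
  moreover have "single m (real k * (c * x)) = c *\<^sub>R single m (real k * x)" for m :: "nat \<Rightarrow>\<^sub>0 nat" and k x
    by (rule poly_mapping_eqI) (simp add: lookup_single when_def)
  ultimately show "partial_deriv i (c *\<^sub>R p) = c *\<^sub>R partial_deriv i p"
    by (simp add: partial_deriv_superset[of "keys p"] scaleR_sum_right)
qed

lemma partial_deriv_single:
  "partial_deriv i (single m c) = single (m - single i 1) (real (lookup m i) * c)"
  by (simp add: partial_deriv_superset[of "{m}"])

lemma partial_deriv_single_mult:
  "partial_deriv i (single m c * single m' c')
    = partial_deriv i (single m c) * single m' c' + single m c * partial_deriv i (single m' c')"
proof -
  have shift: "(m - single i 1) + m' = m + m' - single i 1" if "lookup m i \<noteq> 0" for m m' :: "nat \<Rightarrow>\<^sub>0 nat"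
    using that by (intro poly_mapping_eqI) (auto simp: lookup_add lookup_minus lookup_single when_def)
  \<comment> \<open>If \<open>lookup m i = 0\<close>, truncated subtraction makes the two exponents
    unequal in general, but the coefficient vanishes.\<close>
  have "single ((m - single i 1) + m') (real (lookup m i) * c * c')
      = single (m + m' - single i 1) (real (lookup m i) * c * c')" for m m' c c'
    using shift[of m m'] by (cases "lookup m i = 0") auto
  note s = this
  have "partial_deriv i (single m c) * single m' c' + single m c * partial_deriv i (single m' c')
     = single ((m - single i 1) + m') (real (lookup m i) * c * c')
       + single ((m' - single i 1) + m) (real (lookup m' i) * c' * c)"
    unfolding partial_deriv_single mult_single by (simp add: ac_simps)
  also have "\<dots> = single (m + m' - single i 1) (real (lookup m i) * c * c' + real (lookup m' i) * c' * c)"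
    unfolding s by (simp add: single_add add.commute)
  also have "\<dots> = partial_deriv i (single m c * single m' c')"
    unfolding mult_single partial_deriv_single by (simp add: lookup_add algebra_simps)
  finally show ?thesis by simp
qed

lemma partial_deriv_mult:
  "partial_deriv i (p * q) = partial_deriv i p * q + p * partial_deriv i q"
proof -
  have D: "partial_deriv i (\<Sum>m\<in>A. g m) = (\<Sum>m\<in>A. partial_deriv i (g m))" for A and g :: "'b \<Rightarrow> mpoly"
    by (rule linear_sum[OF linear_partial_deriv])
  define P Q where "P m = single m (lookup p m)" and "Q m = single m (lookup q m)" for m
  have p: "p = (\<Sum>m\<in>keys p. P m)" and q: "q = (\<Sum>m\<in>keys q. Q m)"
    unfolding P_def Q_def by (rule mpoly_eq_sum_single)+
  have dp: "partial_deriv i p = (\<Sum>m\<in>keys p. partial_deriv i (P m))"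
    using arg_cong[OF p, of "partial_deriv i"] unfolding D .
  have dq: "partial_deriv i q = (\<Sum>m\<in>keys q. partial_deriv i (Q m))"
    using arg_cong[OF q, of "partial_deriv i"] unfolding D .
  have "p * q = (\<Sum>m\<in>keys p. \<Sum>m'\<in>keys q. P m * Q m')"
    using arg_cong2[OF p q, of times] unfolding sum_product .
  then have "partial_deriv i (p * q) = (\<Sum>m\<in>keys p. \<Sum>m'\<in>keys q. partial_deriv i (P m * Q m'))"
    by (simp add: D)
  also have "\<dots> = (\<Sum>m\<in>keys p. \<Sum>m'\<in>keys q. partial_deriv i (P m) * Q m' + P m * partial_deriv i (Q m'))"
    unfolding P_def Q_def partial_deriv_single_mult ..
  also have "\<dots> = (\<Sum>m\<in>keys p. partial_deriv i (P m)) * (\<Sum>m\<in>keys q. Q m)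
      + (\<Sum>m\<in>keys p. P m) * (\<Sum>m\<in>keys q. partial_deriv i (Q m))"
    unfolding sum_product sum.distrib ..
  finally show ?thesis unfolding dp[symmetric] dq[symmetric] p[symmetric] q[symmetric] .
qed

section \<open>Gram matrices, their kernels and their images\<close>

definition lin_form :: "mpoly ^ 'm::finite \<Rightarrow> real ^ 'm \<Rightarrow> mpoly" where
  "lin_form X v = (\<Sum>i\<in>UNIV. (v $ i) *\<^sub>R (X $ i))"

lemma linear_lin_form: "linear (lin_form X)"
  by (rule linearI) (simp_all add: lin_form_def scaleR_add_left sum.distrib scaleR_sum_right)

lemma linear_gram_poly: "linear (gram_poly X)"
  by (rule linearI) (simp_all add: gram_poly_def scaleR_add_left sum.distrib scaleR_sum_right)

lemma gram_poly_eq: "gram_poly X G = (\<Sum>i\<in>UNIV. X $ i * lin_form X (row i G))"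
  by (simp add: gram_poly_def lin_form_def row_def sum_distrib_left)

lemma row_symmetric:
  fixes G :: "real ^ 'm::finite ^ 'm"
  assumes "transpose G = G"
  shows "row i G = G *v axis i 1"
proof -
  have "G *v axis i 1 = column i G" by (rule matrix_vector_mult_basis)
  also have "\<dots> = row i (transpose G)" by (simp add: row_transpose)
  finally show ?thesis using assms by simp
qed

lemma symmetric_dot:
  fixes G :: "real ^ 'm::finite ^ 'm"
  assumes "transpose G = G"
  shows "v \<bullet> (G *v w) = (G *v v) \<bullet> w"
  by (metis assms dot_lmul_matrix transpose_matrix_vector)

text \<open>Symmetrising the outer product does not change its Gram polynomial, since multiplication
  is commutative; it provides preimages of products within the symmetric matrices.\<close>

lemma gram_poly_sym_outer:
  "gram_poly X (\<chi> i j. (v $ i * w $ j + w $ i * v $ j) / 2) = lin_form X v * lin_form X w"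
proof -
  have 1: "(\<Sum>i\<in>UNIV. \<Sum>j\<in>UNIV. (v $ i * w $ j) *\<^sub>R (X $ i * X $ j)) = lin_form X v * lin_form X w" for v w
    by (simp add: lin_form_def sum_product scaleR_scaleR mult.commute)
  have "2 *\<^sub>R gram_poly X (\<chi> i j. (v $ i * w $ j + w $ i * v $ j) / 2)
      = lin_form X v * lin_form X w + lin_form X w * lin_form X v"
    unfolding 1[symmetric] gram_poly_def scaleR_sum_right sum.distrib[symmetric] scaleR_add_left[symmetric]
    by (intro sum.cong) auto
  then have "2 *\<^sub>R gram_poly X (\<chi> i j. (v $ i * w $ j + w $ i * v $ j) / 2) = 2 *\<^sub>R (lin_form X v * lin_form X w)"
    by (simp add: mult.commute scaleR_2)
  then show ?thesis by simp
qed

text \<open>Otherwise moving \<open>v\<close> slightly against \<open>G *v v\<close> would make the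
  quadratic form negative to first order.\<close>

lemma psd_kernel:
  fixes G :: "real ^ 'm::finite ^ 'm"
  assumes "psd G" "v \<bullet> (G *v v) = 0"
  shows "G *v v = 0"
proof (rule ccontr)
  assume "G *v v \<noteq> 0"
  define w where "w = G *v v"
  define q where "q = w \<bullet> w"
  define c where "c = w \<bullet> (G *v w)"
  have q: "q > 0" using \<open>G *v v \<noteq> 0\<close> by (simp add: q_def w_def)
  have c: "c \<ge> 0" using assms(1) by (simp add: psd_def c_def)
  have sym: "transpose G = G" using assms(1) by (simp add: psd_def)
  have "v \<bullet> (G *v w) = q" unfolding symmetric_dot[OF sym] q_def w_def ..
  moreover have "w \<bullet> (G *v v) = q" by (simp add: q_def w_def)
  ultimately have "(v - s *\<^sub>R w) \<bullet> (G *v (v - s *\<^sub>R w)) = s * (s * c - 2 * q)" for s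
    using assms(2)
    by (simp add: matrix_vector_mult_diff_distrib matrix_vector_mult_scaleR inner_diff_left inner_diff_right
        c_def algebra_simps)
  then have *: "0 \<le> s * (s * c - 2 * q)" for s
    using assms(1) unfolding psd_def by metis
  \<comment> \<open>Small enough that the quadratic term is dominated; \<open>c + 1\<close> instead
    of \<open>c\<close> covers \<open>c = 0\<close>.\<close>
  define s where "s = q / (c + 1)"
  have s: "s > 0" using q c by (simp add: s_def)
  have "s * c \<le> q" using q c by (simp add: s_def field_simps)
  then have "s * (s * c - 2 * q) < 0" using s q by (intro mult_pos_neg) auto
  then show False using *[of s] by simp
qed

text \<open>The segment from \<open>G\<close> to \<open>G0\<close> extends beyond \<open>G0\<close>
  within \<open>F\<close>. At the extended point the quadratic form at \<open>v\<close> is a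
  negative multiple of that of \<open>G\<close>, so both must vanish.\<close>

lemma kernel_rel_interior:
  fixes F :: "(real ^ 'm::finite ^ 'm) set"
  assumes F: "convex F" "F \<subseteq> Collect psd" and G0: "G0 \<in> rel_interior F" and G: "G \<in> F"
    and v: "G0 *v v = 0"
  shows "G *v v = 0"
proof -
  have "F \<noteq> {}" using G by blast
  then obtain e where e: "e > 1" "(1 - e) *\<^sub>R G + e *\<^sub>R G0 \<in> F"
    using convex_rel_interior_iff[OF F(1)] G0 G by blast
  have "0 \<le> v \<bullet> (((1 - e) *\<^sub>R G + e *\<^sub>R G0) *v v)" using e(2) F(2) by (auto simp: psd_def)
  also have "\<dots> = (1 - e) * (v \<bullet> (G *v v))"
    by (simp add: matrix_vector_mult_add_rdistrib scaleR_matrix_vector_assoc[symmetric] v)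
  finally have "v \<bullet> (G *v v) \<le> 0" using e(1) by (simp add: zero_le_mult_iff)
  moreover have "psd G" using F(2) G by blast
  ultimately show ?thesis by (intro psd_kernel) (auto simp: psd_def intro: antisym)
qed

definition sym_supported :: "real ^ 'm::finite ^ 'm \<Rightarrow> (real ^ 'm ^ 'm) set" where
  "sym_supported G = {H. transpose H = H \<and> (\<forall>v. G *v v = 0 \<longrightarrow> H *v v = 0)}"

lemma subspace_sym_supported:
  fixes G :: "real ^ 'm::finite ^ 'm"
  shows "subspace (sym_supported G)"
proof -
  have "transpose (A + B) = transpose A + transpose B" "transpose (c *\<^sub>R A) = c *\<^sub>R transpose A"
    for A B :: "real ^ 'm ^ 'm" and c
    by (simp_all add: transpose_def vec_eq_iff)
  moreover have "transpose (0 :: real ^ 'm ^ 'm) = 0" by (simp add: transpose_def vec_eq_iff)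
  ultimately show ?thesis
    by (auto simp: subspace_def sym_supported_def matrix_vector_mult_add_rdistrib
        scaleR_matrix_vector_assoc[symmetric])
qed

text \<open>Such a matrix is determined by the values \<open>b\<^sub>i \<bullet> H b\<^sub>j\<close>, \<open>i \<le> j\<close>, on a basis of the range of \<open>G\<close>.\<close>

lemma dim_sym_supported_le:
  fixes G :: "real ^ 'm::finite ^ 'm"
  assumes sym: "transpose G = G"
  shows "dim (sym_supported G) \<le> (rank G + 1) choose 2"
proof -
  let ?R = "range (\<lambda>x. G *v x)"
  have R: "subspace ?R" by (intro linear_subspace_image subspace_UNIV matrix_vector_mul_linear)
  obtain B where B: "B \<subseteq> ?R" "independent B" "?R \<subseteq> span B" "card B = dim ?R" by (rule basis_exists[of ?R])
  have fB: "finite B" using B(2) by (rule independent_imp_finite)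
  have cB: "card B = rank G" using B(4) by (simp add: rank_dim_range)
  obtain b where "bij_betw b {0..<rank G} B"
    using ex_bij_betw_nat_finite[OF fB] unfolding cB by blast
  then have b: "B = b ` {..<rank G}" by (simp add: bij_betw_def lessThan_atLeast0)
  let ?I = "{(i, j). i \<le> j \<and> j < rank G}"
  define \<phi> where "\<phi> = (\<lambda>(i, j) (H :: real ^ 'm ^ 'm). b i \<bullet> (H *v b j))"
  have lin: "linear (\<phi> p)" for p
    by (rule linearI) (auto simp: \<phi>_def matrix_vector_mult_add_rdistrib inner_add_right
        scaleR_matrix_vector_assoc[symmetric] split: prod.split)
  have "{H \<in> sym_supported G. \<forall>p\<in>?I. \<phi> p H = 0} \<subseteq> {0}"
  proof
    fix H assume H: "H \<in> {H \<in> sym_supported G. \<forall>p\<in>?I. \<phi> p H = 0}"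
    have Hs: "transpose H = H" and HG: "\<And>v. G *v v = 0 \<Longrightarrow> H *v v = 0"
      using H by (auto simp: sym_supported_def)
    have bb: "b i \<bullet> (H *v b j) = 0" if "i < rank G" "j < rank G" for i j
    proof (cases "i \<le> j")
      case True
      then show ?thesis using H that by (auto simp: \<phi>_def)
    next
      case False
      then have "b j \<bullet> (H *v b i) = 0" using H that by (auto simp: \<phi>_def)
      moreover have "b i \<bullet> (H *v b j) = b j \<bullet> (H *v b i)"
        by (subst symmetric_dot[OF Hs]) (rule inner_commute)
      ultimately show ?thesis by simp
    qed
    have 1: "b i \<bullet> (H *v y) = 0" if "i < rank G" "y \<in> ?R" for i y
    proof (rule linear_eq_0_on_span[of "\<lambda>y. b i \<bullet> (H *v y)" B])
      show "linear (\<lambda>y. b i \<bullet> (H *v y))"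
        by (rule linearI) (simp_all add: matrix_vector_right_distrib inner_add_right matrix_vector_mult_scaleR)
      show "y \<in> span B" using that(2) B(3) by (rule subsetD[rotated])
    qed (use b bb that(1) in auto)
    have 2: "x \<bullet> (H *v y) = 0" if "x \<in> ?R" "y \<in> ?R" for x y
    proof (rule linear_eq_0_on_span[of "\<lambda>x. x \<bullet> (H *v y)" B])
      show "linear (\<lambda>x. x \<bullet> (H *v y))"
        by (rule linearI) (simp_all add: inner_add_left)
      show "x \<in> span B" using that(1) B(3) by (rule subsetD[rotated])
    qed (use b 1 that(2) in auto)
    \<comment> \<open>A symmetric matrix splits the space orthogonally into its range and its
      kernel.\<close>
    have dec: "\<exists>y z. y \<in> ?R \<and> G *v z = 0 \<and> x = y + z" for x
    proof -
      obtain y z where yz: "y \<in> span ?R" "\<And>w. w \<in> span ?R \<Longrightarrow> orthogonal z w" "x = y + z"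
        using orthogonal_subspace_decomp_exists[of ?R x] by metis
      have "G *v (G *v z) \<in> span ?R" by (intro span_base rangeI)
      then have "z \<bullet> (G *v (G *v z)) = 0" using yz(2) by (simp add: orthogonal_def)
      then have "(G *v z) \<bullet> (G *v z) = 0" unfolding symmetric_dot[OF sym] .
      then show ?thesis using yz(1,3) span_eq_iff[THEN iffD2, OF R] by auto
    qed
    have "x \<bullet> (H *v x') = 0" for x x'
    proof -
      obtain y z where yz: "y \<in> ?R" "G *v z = 0" "x = y + z" using dec by blast
      obtain y' z' where yz': "y' \<in> ?R" "G *v z' = 0" "x' = y' + z'" using dec by blast
      have "H *v z = 0" "H *v z' = 0" using HG yz(2) yz'(2) by auto
      then show ?thesis
        using 2[OF yz(1) yz'(1)] symmetric_dot[OF Hs, of z y']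
        by (simp add: yz(3) yz'(3) matrix_vector_right_distrib inner_add_left)
    qed
    then have "H *v x = 0" for x by (metis inner_eq_zero_iff)
    then have "H = 0" by (simp add: matrix_eq)
    then show "H \<in> {0}" by simp
  qed
  then have "dim {H \<in> sym_supported G. \<forall>p\<in>?I. \<phi> p H = 0} = 0"
    by (simp only: dim_eq_0)
  moreover have "finite ?I" using sorted_pairs_card by blast
  ultimately have "dim (sym_supported G) \<le> card ?I"
    using dim_common_kernel[where \<phi> = \<phi>, OF _ lin subspace_sym_supported fin_span_euclidean, of ?I G]
    by linarith
  then show ?thesis using sorted_pairs_card[of "rank G"] by linarith
qed


lemma dim_singleton_0: "dim {0 :: 'a::real_vector} = 0"
  using dim_le_card[of "{0 :: 'a}" "{}"] by simp

definition image_forms :: "mpoly ^ 'm::finite \<Rightarrow> real ^ 'm ^ 'm \<Rightarrow> mpoly set" where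
  "image_forms X G = lin_form X ` range (\<lambda>v. G *v v)"

lemma subspace_image_forms: "subspace (image_forms X G)"
  unfolding image_forms_def
  by (intro linear_subspace_image linear_lin_form subspace_UNIV matrix_vector_mul_linear)

lemma range_lin_form:
  assumes "monomial_vector n d X"
  shows "range (lin_form X) = forms n d"
proof
  have X: "range (($) X) = monomials n d" using assms by (simp add: monomial_vector_def bij_betw_def)
  have XS: "X $ i \<in> forms n d" for i
  proof -
    have "X $ i \<in> span (monomials n d)" unfolding X[symmetric] by (intro span_base rangeI)
    then show ?thesis unfolding span_monomials .
  qed
  show "range (lin_form X) \<subseteq> forms n d"
    unfolding lin_form_def by (intro image_subsetI subspace_sum subspace_scale subspace_forms XS)
  have ax: "lin_form X (axis i 1) = X $ i" for i
    unfolding lin_form_def by (subst sum.remove[of _ i]) (auto simp: axis_def intro!: sum.neutral)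
  have "monomials n d \<subseteq> range (lin_form X)" unfolding X[symmetric]
  proof (rule image_subsetI)
    fix i show "X $ i \<in> range (lin_form X)"
      using rangeI[of "lin_form X" "axis i 1"] unfolding ax .
  qed
  then have "span (monomials n d) \<subseteq> range (lin_form X)"
    by (intro span_minimal linear_subspace_image linear_lin_form subspace_UNIV)
  then show "forms n d \<subseteq> range (lin_form X)" unfolding span_monomials .
qed

text \<open>\<open>lin_form X\<close> maps onto all forms of degree \<open>d\<close>, whose
  dimension is that of its domain; hence it is injective and preserves the dimension of the range of
  \<open>G\<close>.\<close>

lemma dim_image_forms:
  fixes X :: "mpoly ^ 'm::finite"
  assumes X: "monomial_vector n d X"
  shows "dim (image_forms X G) = rank G"
proof -
  let ?R = "range (\<lambda>v. G *v v)" and ?K = "\<lambda>S. {v \<in> S. lin_form X v \<in> {0}}"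
  have R: "subspace ?R" by (intro linear_subspace_image subspace_UNIV matrix_vector_mul_linear)
  have z: "fin_span {0 :: mpoly}" by (rule fin_span_finite) simp
  have im: "dim (?K S) + dim (lin_form X ` S) = dim S" if "subspace S" for S
  proof -
    have "0 \<in> lin_form X ` S"
      using subspace_0[OF that] linear_0[OF linear_lin_form, of X] by (metis imageI)
    then have "{0} \<union> lin_form X ` S = lin_form X ` S" by blast
    then show ?thesis
      using dim_preimage[OF linear_lin_form that fin_span_euclidean subspace_single_0 z, of X]
      by (simp add: dim_singleton_0)
  qed
  have "dim (?K UNIV) = 0"
    using im[OF subspace_UNIV] card_eq_dim_forms[OF X] unfolding range_lin_form[OF X] by simp
  moreover have "dim (?K ?R) \<le> dim (?K UNIV)" by (intro dim_subset) auto
  ultimately show ?thesis using im[OF R] unfolding image_forms_def rank_dim_range by linarith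
qed

lemma row_in_image_forms:
  fixes X :: "mpoly ^ 'm::finite"
  assumes "transpose G = G"
  shows "lin_form X (row i G) \<in> image_forms X G"
  unfolding row_symmetric[OF assms] image_forms_def by (intro imageI rangeI)

text \<open>By the symmetry of \<open>G\<close>, each partial derivative of \<open>f\<close> is
  twice the sum of the products of the derivatives of \<open>X $ i\<close> with the forms of the
  rows of \<open>G\<close>. These forms lie in the image, so a common zero of the image is a
  singular point of \<open>f\<close>.\<close>

lemma base_point_free_image_forms:
  fixes X :: "mpoly ^ 'm::finite"
  assumes ns: "nonsingular_form n f" and sym: "transpose G = G" and f: "gram_poly X G = f"
  shows "base_point_free n (image_forms X G)"
  unfolding base_point_free_def
proof (intro allI impI, rule ccontr)
  fix \<xi> :: "nat \<Rightarrow> complex"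
  assume nz: "\<exists>i<n. \<xi> i \<noteq> 0" and no: "\<not> (\<exists>u\<in>image_forms X G. eval_complex \<xi> u \<noteq> 0)"
  define Y where "Y i = lin_form X (row i G)" for i
  have Y0: "eval_complex \<xi> (Y i) = 0" for i
    using no row_in_image_forms[OF sym, of X i] unfolding Y_def by blast
  have "eval_complex \<xi> (partial_deriv t f) = 0" for t
  proof -
    note D = linear_sum[OF linear_partial_deriv[of t]] linear_scale[OF linear_partial_deriv[of t]]
    have G: "G $ i $ j = G $ j $ i" for i j using sym by (simp add: transpose_def vec_eq_iff)
    have "(\<Sum>i\<in>UNIV. X $ i * partial_deriv t (Y i))
        = (\<Sum>i\<in>UNIV. \<Sum>j\<in>UNIV. (G $ i $ j) *\<^sub>R (X $ i * partial_deriv t (X $ j)))"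
      by (simp add: Y_def lin_form_def row_def D sum_distrib_left)
    also have "\<dots> = (\<Sum>j\<in>UNIV. \<Sum>i\<in>UNIV. (G $ i $ j) *\<^sub>R (X $ i * partial_deriv t (X $ j)))"
      by (rule sum.swap)
    also have "\<dots> = (\<Sum>j\<in>UNIV. partial_deriv t (X $ j) * Y j)"
    proof (rule sum.cong[OF refl])
      fix j
      show "(\<Sum>i\<in>UNIV. (G $ i $ j) *\<^sub>R (X $ i * partial_deriv t (X $ j))) = partial_deriv t (X $ j) * Y j"
        unfolding Y_def lin_form_def row_def sum_distrib_left by (intro sum.cong refl) (simp add: G[of _ j] mult.commute)
    qed
    finally have "partial_deriv t f = (\<Sum>i\<in>UNIV. partial_deriv t (X $ i) * Y i) + (\<Sum>i\<in>UNIV. partial_deriv t (X $ i) * Y i)"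
      unfolding f[symmetric] gram_poly_eq D(1) partial_deriv_mult sum.distrib Y_def[symmetric] by simp
    then show ?thesis by (simp add: eval_complex_add eval_complex_sum eval_complex_mult Y0)
  qed
  then show False using ns nz unfolding nonsingular_form_def by blast
qed

text \<open>Rank-nullity for \<open>gram_poly\<close> on \<open>sym_supported G\<close>; symmetrised
  outer products of vectors in the range of \<open>G\<close> show that every product of two image
  forms is attained.\<close>

lemma dim_gram_kernel_le:
  fixes X :: "mpoly ^ 'm::finite"
  assumes sym: "transpose G = G" and X: "monomial_vector n d X"
  shows "dim {H \<in> sym_supported G. gram_poly X H \<in> {0}} + dim (image_forms X G \<odot> image_forms X G)
    \<le> (rank G + 1) choose 2"
proof -
  let ?T = "span ({0} \<union> gram_poly X ` sym_supported G)"
  have "fin_span {0 :: mpoly}" by (rule fin_span_finite) simp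
  then have "dim {H \<in> sym_supported G. gram_poly X H \<in> {0}} + dim ?T = dim (sym_supported G) + dim {0 :: mpoly}"
    by (intro dim_preimage linear_gram_poly subspace_sym_supported fin_span_euclidean subspace_single_0)
  moreover have "dim (image_forms X G \<odot> image_forms X G) \<le> dim ?T"
  proof (rule dim_le_dim)
    show "fin_span ?T"
      by (intro fin_span_span fin_span_Un fin_span_image linear_gram_poly fin_span_euclidean fin_span_finite) simp
    have "image_forms X G \<odot> image_forms X G \<subseteq> ?T"
    proof (rule pmul_subsetI[OF subspace_span])
      fix u u' assume "u \<in> image_forms X G" "u' \<in> image_forms X G"
      then obtain a a' where u: "u = lin_form X (G *v a)" "u' = lin_form X (G *v a')"
        by (auto simp: image_forms_def)
      define w w' where "w = G *v a" and "w' = G *v a'"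
      define H :: "real ^ 'm ^ 'm" where "H = (\<chi> i j. (w $ i * w' $ j + w' $ i * w $ j) / 2)"
      have "transpose H = H" by (simp add: transpose_def H_def vec_eq_iff add.commute mult.commute)
      moreover have "H *v v = 0" if v: "G *v v = 0" for v
      proof -
        have "w \<bullet> v = 0" "w' \<bullet> v = 0"
          unfolding w_def w'_def symmetric_dot[OF sym, symmetric] v by simp_all
        moreover have "H *v v = ((w' \<bullet> v) / 2) *\<^sub>R w + ((w \<bullet> v) / 2) *\<^sub>R w'"
          by (simp add: vec_eq_iff H_def matrix_vector_mult_def inner_vec_def sum_distrib_right sum_distrib_left
              sum_divide_distrib sum.distrib[symmetric] add_divide_distrib algebra_simps)
        ultimately show ?thesis by simp
      qed
      ultimately have "H \<in> sym_supported G" by (simp add: sym_supported_def)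
      then have "gram_poly X H \<in> ?T" by (intro span_base UnI2 imageI)
      then show "u * u' \<in> ?T" unfolding H_def gram_poly_sym_outer u w_def w'_def .
    qed
    then show "image_forms X G \<odot> image_forms X G \<subseteq> span ?T" by (simp only: span_span)
  qed
  ultimately show ?thesis using dim_sym_supported_le[OF sym] unfolding dim_singleton_0 by linarith
qed

lemma aff_dim_face_le:
  fixes X :: "mpoly ^ 'm::finite"
  assumes F: "convex F" "F \<subseteq> Gram X f" and G0: "G0 \<in> rel_interior F" and X: "monomial_vector n d X"
  shows "aff_dim F + int (dim (image_forms X G0 \<odot> image_forms X G0)) \<le> int ((rank G0 + 1) choose 2)"
proof -
  have G0F: "G0 \<in> F" using G0 rel_interior_subset by blast
  have sym: "transpose G = G" "gram_poly X G = f" if "G \<in> F" for G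
    using F(2) that by (auto simp: Gram_def psd_def)
  let ?K = "{H \<in> sym_supported G0. gram_poly X H \<in> {0}}"
  have K: "subspace ?K" by (intro subspace_preimage linear_gram_poly subspace_sym_supported subspace_single_0)
  have "F \<subseteq> (+) G0 ` ?K"
  proof
    fix G assume G: "G \<in> F"
    have "transpose (G - G0) = transpose G - transpose G0" by (simp add: transpose_def vec_eq_iff)
    then have "transpose (G - G0) = G - G0" using sym(1)[OF G] sym(1)[OF G0F] by simp
    moreover have "(G - G0) *v v = 0" if "G0 *v v = 0" for v
      using kernel_rel_interior[OF F(1) _ G0 G that] F(2) that
      by (auto simp: Gram_def matrix_vector_mult_diff_rdistrib)
    moreover have "gram_poly X (G - G0) = 0"
      using sym(2)[OF G] sym(2)[OF G0F] by (simp add: linear_diff[OF linear_gram_poly])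
    ultimately have "G - G0 \<in> ?K" by (simp add: sym_supported_def)
    then show "G \<in> (+) G0 ` ?K" by (intro image_eqI[of _ _ "G - G0"]) auto
  qed
  then have "aff_dim F \<le> aff_dim ((+) G0 ` ?K)" by (rule aff_dim_subset)
  also have "\<dots> = int (dim ?K)" unfolding aff_dim_translation_eq by (rule aff_dim_subspace[OF K])
  finally show ?thesis using dim_gram_kernel_le[OF sym(1)[OF G0F] X] by linarith
qed

theorem theorem9p3:
  fixes n d k :: nat
    and f :: mpoly
    and X :: "mpoly ^ 'm::finite"
    and F :: "(real ^ 'm ^ 'm) set"
  assumes "n \<ge> 2" and "d \<ge> 2"
    and "monomial_vector n d X"
    and "f \<in> sos_forms n d"
    and "nonsingular_form n f"
    and "F face_of Gram X f"
    and "has_corank F k"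
    and "1 \<le> k" and "k \<le> d - 1"
  shows "aff_dim F \<le>
           int ((dim (forms n d) - k + 1) choose 2) - int (dim (forms n (2 * d)))
           + int (k ^ 2) + int ((k + 2) choose 3)"
proof -
  have F: "convex F" "F \<subseteq> Gram X f" "F \<noteq> {}"
    using assms(6,7) by (auto simp: face_of_def has_corank_def)
  then obtain G0 where G0: "G0 \<in> rel_interior F" using rel_interior_eq_empty[OF F(1)] by blast
  then have "G0 \<in> F" using rel_interior_subset by blast
  then have G: "transpose G0 = G0" "gram_poly X G0 = f" using F(2) by (auto simp: Gram_def psd_def)
  have rk: "rank G0 + k = dim (forms n d)"
    using assms(7) G0 card_eq_dim_forms[OF assms(3)] by (auto simp: has_corank_def)
  have "image_forms X G0 \<subseteq> range (lin_form X)" by (auto simp: image_forms_def)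
  then have le: "dim (forms n (2 * d)) \<le> dim (image_forms X G0 \<odot> image_forms X G0) + k ^ 2 + ((k + 2) choose 3)"
    using assms(2,9) rk dim_image_forms[OF assms(3), of G0]
    by (intro codim_square_bound subspace_image_forms base_point_free_image_forms[OF assms(5) G])
      (auto simp: range_lin_form[OF assms(3)])
  have "int (dim (forms n (2 * d)))
      \<le> int (dim (image_forms X G0 \<odot> image_forms X G0)) + int (k ^ 2) + int ((k + 2) choose 3)"
    using le unfolding of_nat_add[symmetric] of_nat_le_iff .
  moreover have rk': "dim (forms n d) - k = rank G0" using rk by linarith
  ultimately show ?thesis using aff_dim_face_le[OF F(1,2) G0 assms(3)] unfolding rk' by linarith
qed

end
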